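(* Let $\ell\in\{0,1\}$, let $n\ge 2$ be an integer and let $r>0$. Then the range of the endomorphism $\partial^{\ell}\delta_{S(0,r)}/\partial r^{\ell}*$ of $\mathcal{C}_0^\infty(\mathbb{R}^{n})$ is characterized by $$\mathrm{range}\left(\frac{\partial^{\ell}\delta_{S(0,r)}}{\partial r^{\ell}}*\colon\mathcal{C}_0^\infty(\mathbb{R}^{n})\to\mathcal{C}_0^\infty(\mathbb{R}^{n})\right)=\left\{ w\in\mathcal{C}_0^\infty(\mathbb{R}^{n}) : \hat{w}(\zeta)=0 \text{ for every } \zeta\in\mathbb{C}^n \text{ with } \left(\frac{\partial^{\ell}\delta_{S(0,r)}}{\partial r^{\ell}}\right)^{\wedge}(\zeta)=0\right\}.$$
   Context: $\mathcal{C}_0^\infty(\mathbb{R}^n)$ is the space of compactly supported smooth functions. For $x\in\mathbb{R}^n$ ($n\ge2$) and $r>0$, $S(x,r)=\{y\in\mathbb{R}^n : |y-x|=r\}$, $dS_{x,r}$ is its surface area measure, and $c_r$ is the reciprocal of the total surface area of $S(x,r)$. The spherical mean value operator is $M_ru(x)=c_r\int_{S(x,r)}u(y)\,dS_{x,r}(y)$. The compactly supported distribution $\delta_{S(0,r)}\in\mathcal{E}'(\mathbb{R}^n)$ is defined by $u\mapsto M_ru(0)$ for $u\in\mathcal{C}^\infty(\mathbb{R}^n)$. For an integer $\ell\ge0$, $\partial^\ell\delta_{S(0,r)}/\partial r^\ell\in\mathcal{E}'(\mathbb{R}^n)$ is the $\ell$-th derivative with respect to the parameter $r$ of $\delta_{S(0,r)}$,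 i.e. the distribution $u\mapsto \frac{\partial^\ell}{\partial r^\ell}\big(M_ru(0)\big)=c_1\int_{S(0,1)}\frac{\partial^\ell}{\partial r^\ell}u(r\omega)\,dS_{0,1}(\omega)$ (for $\ell=0$ it is $\delta_{S(0,r)}$). Here $*$ denotes convolution. The Fourier transform of $u\in\mathcal{E}'(\mathbb{R}^n)$, denoted $\hat u$ or $(u)^\wedge$, is the entire function $\hat u(\zeta)=\langle u(x),e^{-i\langle x,\zeta\rangle}\rangle$, $\zeta\in\mathbb{C}^n$, with $\langle x,\zeta\rangle=\sum_j x_j\zeta_j$. *)

theory Defs
  imports "HOL-Analysis.Analysis"
begin

primrec C_k :: "nat \<Rightarrow> (real^'n \<Rightarrow> complex) \<Rightarrow> bool" where
  "C_k 0 f \<longleftrightarrow> continuous_on UNIV f"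
| "C_k (Suc k) f \<longleftrightarrow> (\<forall>x. f differentiable (at x)) \<and>
     (\<forall>i. C_k k (\<lambda>x. frechet_derivative f (at x) (axis i 1)))"

definition C_infinity :: "(real^'n \<Rightarrow> complex) set" where
  "C_infinity = {f. \<forall>k. C_k k f}"

definition test_functions :: "(real^'n \<Rightarrow> complex) set" where
  "test_functions = {f \<in> C_infinity. compact (closure {x. f x \<noteq> 0})}"

(* Polar-coordinate (cone) description of surface area: a Borel set A of S(x,r) has
   area (n/r) * (volume of the union of the segments from x to the points of A).
   As a measure on all of R^n, this is n/r times the image of Lebesgue measure on
   the ball B(x,r) under the radial projection onto S(x,r) (the centre, a null set,
   is sent to itself). *)
definition surface_measure :: "real^'n \<Rightarrow> real \<Rightarrow> (real^'n) measure" where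
  "surface_measure x r =
     distr (density lborel (\<lambda>y. ennreal (real CARD('n) / r) * indicator (ball x r) y))
       borel (\<lambda>y. x + (r / norm (y - x)) *\<^sub>R (y - x))"

definition spherical_mean :: "real \<Rightarrow> (real^'n \<Rightarrow> complex) \<Rightarrow> real^'n \<Rightarrow> complex" where
  "spherical_mean r u x =
     (1 / measure (surface_measure x r) (sphere x r)) *\<^sub>R
       (LINT y:sphere x r|surface_measure x r. u y)"

(* Distributions are represented by their action; only values on C_infinity matter. *)
type_synonym 'n distribution = "(real^'n \<Rightarrow> complex) \<Rightarrow> complex"

definition sphere_delta :: "real \<Rightarrow> 'n::finite distribution" where
  "sphere_delta r u = spherical_mean r u 0"

definition sphere_delta_deriv :: "nat \<Rightarrow> real \<Rightarrow> 'n::finite distribution" where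
  "sphere_delta_deriv l r u =
     ((\<lambda>g s. vector_derivative g (at s)) ^^ l) (\<lambda>s. sphere_delta s u) r"

definition distr_of_fun :: "(real^'n \<Rightarrow> complex) \<Rightarrow> 'n::finite distribution" where
  "distr_of_fun w u = (LINT x|lborel. w x * u x)"

definition convolve :: "'n::finite distribution \<Rightarrow> (real^'n \<Rightarrow> complex) \<Rightarrow> real^'n \<Rightarrow> complex" where
  "convolve T u x = T (\<lambda>y. u (x - y))"

definition fourier :: "'n::finite distribution \<Rightarrow> complex^'n \<Rightarrow> complex" where
  "fourier T \<zeta> = T (\<lambda>x. exp (- \<i> * (\<Sum>j\<in>UNIV. complex_of_real (x $ j) * \<zeta> $ j)))"

end

theory Submission
  imports Defs "HOL-Complex_Analysis.Complex_Analysis" "HOL-Probability.Probability"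
begin

text \<open>
  With \<open>B (\<bar>\<xi>\<bar>\<^sup>2)\<close> the mean of \<open>exp (- \<i> \<langle>\<omega>, \<xi>\<rangle>)\<close> over the unit sphere, the
  Fourier transform of the distribution \<open>T\<close> (the surface measure or its radial derivative) is
  \<open>\<phi> (\<langle>\<zeta>, \<zeta>\<rangle>)\<close> for an entire function \<open>\<phi>\<close> of one variable: \<open>B (r\<^sup>2 s)\<close> or its
  \<open>r\<close>-derivative. The differential equation of \<open>B\<close> shows that \<open>\<phi>\<close> has only simple zeros, and
  Sonine's energy \<open>B\<^sup>2 + 4 x B'\<^sup>2\<close> shows that \<open>\<phi>\<close> is slowly decreasing on the positive axis.

  Division by \<open>\<phi> (\<langle>\<zeta>, \<zeta>\<rangle>)\<close> never needs several complex variables. Fix real values for all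
  coordinates but the \<open>j\<close>-th and let \<open>c\<close> be the sum of their squares. If \<open>\<phi> c \<noteq> 0\<close>, which holds
  almost surely, then \<open>z \<mapsto> \<phi> (z\<^sup>2 + c)\<close> has simple zeros, so the quotient of the Fourier transform
  of \<open>w\<close> by it is entire in \<open>z\<close>. A bound for quotients of holomorphic functions (Blaschke factors
  and Borel-Caratheodory), centred at a nearby real point where \<open>\<phi>\<close> is not small, makes this
  quotient rapidly decreasing and of exponential type, uniformly in the other coordinates. Shifting
  the contour in one coordinate at a time then shows that its inverse Fourier transform \<open>u\<close> has
  compact support, and \<open>T * u = w\<close> by Fourier inversion.
\<close>

text \<open>Simplicity of the zeros drives the division. Off the origin it comes from the
  second-order equation of B; at s = 0 the symbol of the radial derivative has a simple zero because
  \<open>bessel' n 0\<close> is not 0. Restricting to one variable endangers it: z \<mapsto>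
  \<phi>(z^2 + c) has derivative 2 z \<phi>'(z^2 + c), so a zero of \<phi> at c becomes a double
  zero at z = 0. A second real coordinate moves c, so n \<ge> 2 makes this a null event. The
  obstacle is uniformity. The zeros of the divisor in the disc used for the estimate are not
  counted, so the bound for the quotient must not depend on their number; it uses only upper bounds
  on the disc and a lower bound at the centre. Because of the zeros no lower bound holds at every
  real point, hence the freedom to choose the centre nearby. The opposite inclusion is the
  convolution theorem. For l = 1 it is obtained by differentiating the theorem for spheres with
  respect to the radius, for complex \<zeta>, where the exponential kernel is unbounded and only
  compact supports keep the integrals under control.\<close>

no_notation fps_nth (infixl "$" 75)

subsection \<open>Quotients of holomorphic functions\<close>

lemma holomorphic_factor_at_zero:
  assumes "g holomorphic_on S" "open S" "a \<in> S" "g a = 0"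
  obtains k where "k holomorphic_on S" "\<And>z. z \<in> S \<Longrightarrow> g z = (z - a) * k z" "k a = deriv g a"
proof
  show "(\<lambda>z. if z = a then deriv g a else (g z - g a) / (z - a)) holomorphic_on S"
    using assms by (intro pole_lemma_open) auto
qed (use assms in auto)

text \<open>On the unit circle |1 - cnj a z| = |z - a|, so the hypothesis amounts there to |f| \<le>
  M, which the maximum principle carries inside. As nothing is assumed on the circle itself, the
  principle is applied to radii \<rho> < 1, at the price of a factor that tends to 1 as \<rho> tends
  to 1.\<close>

lemma blaschke_strip_bound:
  assumes f: "f holomorphic_on ball (0::complex) 1" and a: "a \<in> ball 0 1"
    and bound: "\<And>z. z \<in> ball 0 1 \<Longrightarrow> norm (f z * (z - a)) \<le> M * norm (1 - cnj a * z)"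
    and z: "z \<in> ball 0 1"
  shows "norm (f z) \<le> M"
proof -
  have M: "M \<ge> 0"
    using bound[of 0] by simp (meson dual_order.trans mult_nonneg_nonneg norm_ge_zero)
  have key: "norm (f z) \<le> M * ((1 + (1 - \<rho>\<^sup>2) / (\<rho> - norm a)) / \<rho>)"
    if \<rho>: "\<rho> > norm a" "\<rho> > norm z" "\<rho> < 1" for \<rho>
  proof -
    have \<rho>0: "\<rho> > 0" using \<rho>(1) norm_ge_zero[of a] by linarith
    show ?thesis
    proof (rule maximum_modulus_frontier[where S = "ball (0::complex) \<rho>" and f = f])
      show "f holomorphic_on interior (ball 0 \<rho>)"
        using f \<rho> by (auto intro: holomorphic_on_subset)
      show "continuous_on (closure (ball 0 \<rho>)) f"
        using \<rho> \<rho>0 by (intro holomorphic_on_imp_continuous_on holomorphic_on_subset[OF f]) auto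
      fix w :: complex assume "w \<in> frontier (ball 0 \<rho>)"
      then have w: "norm w = \<rho>" using \<rho>0 by auto
      have wa: "norm (w - a) \<ge> \<rho> - norm a" using w norm_triangle_ineq2[of w a] by simp
      then have wa0: "norm (w - a) > 0" using \<rho> by linarith
      \<comment> \<open>On the circle of radius \<rho> this turns \<open>w * (1 - a * cnj w)\<close>
        into \<open>w - a\<close> up to an error of size at most 1 - \<rho>^2.\<close>
      have "w * cnj w = \<rho>\<^sup>2" using w complex_norm_square[of w] by simp
      then have "w * (1 - a * cnj w) = (w - a) + a * (1 - of_real (\<rho>\<^sup>2))"
        by (simp add: algebra_simps)
      then have "\<rho> * norm (1 - a * cnj w) = norm ((w - a) + a * (1 - of_real (\<rho>\<^sup>2)))"
        by (metis norm_mult w)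
      also have "\<dots> \<le> norm (w - a) + norm (a * (1 - of_real (\<rho>\<^sup>2)))" by (rule norm_triangle_ineq)
      also have "norm (a * (1 - of_real (\<rho>\<^sup>2))) = norm a * (1 - \<rho>\<^sup>2)"
      proof -
        have "(1 - of_real (\<rho>\<^sup>2) :: complex) = of_real (1 - \<rho>\<^sup>2)" by simp
        moreover have "1 - \<rho>\<^sup>2 \<ge> 0" using \<rho> \<rho>0 by (simp add: power_le_one)
        ultimately show ?thesis by (metis abs_of_nonneg norm_mult norm_of_real)
      qed
      also have "\<dots> \<le> 1 * (1 - \<rho>\<^sup>2)"
        using a \<rho> \<rho>0 by (intro mult_right_mono) (auto simp: power_le_one)
      finally have *: "\<rho> * norm (1 - a * cnj w) \<le> norm (w - a) + (1 - \<rho>\<^sup>2)" by simp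
      have "norm (1 - cnj a * w) = norm (cnj (1 - a * cnj w))" by simp
      then have "norm (1 - cnj a * w) = norm (1 - a * cnj w)" by (metis complex_mod_cnj)
      then have "norm (f w) * norm (w - a) \<le> M * norm (1 - a * cnj w)"
        using bound[of w] w \<rho> by (simp add: norm_mult)
      also have "\<dots> \<le> M * ((norm (w - a) + (1 - \<rho>\<^sup>2)) / \<rho>)"
        using * \<rho>0 M by (intro mult_left_mono) (auto simp: field_simps)
      finally have "norm (f w) \<le> M * ((norm (w - a) + (1 - \<rho>\<^sup>2)) / \<rho>) / norm (w - a)"
        using wa0 by (simp only: pos_le_divide_eq)
      also have "\<dots> = M * ((1 + (1 - \<rho>\<^sup>2) / norm (w - a)) / \<rho>)"
        using wa0 \<rho>0 by (simp add: field_simps)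
      also have "\<dots> \<le> M * ((1 + (1 - \<rho>\<^sup>2) / (\<rho> - norm a)) / \<rho>)"
        using M \<rho>0 \<rho> wa wa0 
        by (intro mult_left_mono divide_right_mono add_left_mono divide_left_mono)
           (auto simp: power_le_one mult_pos_pos)
      finally show "norm (f w) \<le> M * ((1 + (1 - \<rho>\<^sup>2) / (\<rho> - norm a)) / \<rho>)" .
    qed (use \<rho> \<rho>0 in auto)
  qed
  have lim: "((\<lambda>\<rho>. M * ((1 + (1 - \<rho>\<^sup>2) / (\<rho> - norm a)) / \<rho>)) \<longlongrightarrow> M * ((1 + (1 - 1\<^sup>2) / (1 - norm a)) / 1)) (at_left 1)"
    using a by (intro tendsto_intros) auto
  have "eventually (\<lambda>\<rho>. \<rho> > max (norm a) (norm z)) (at_left (1::real))"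
    using a z by (intro order_tendstoD(1)[OF tendsto_ident_at]) auto
  moreover have "eventually (\<lambda>\<rho>. \<rho> < 1) (at_left (1::real))"
    by (rule eventually_at_leftI[of 0]) auto
  ultimately have "eventually (\<lambda>\<rho>. norm (f z) \<le> M * ((1 + (1 - \<rho>\<^sup>2) / (\<rho> - norm a)) / \<rho>)) (at_left 1)"
    by eventually_elim (rule key; simp)
  then have "norm (f z) \<le> M * ((1 + (1 - 1\<^sup>2) / (1 - norm a)) / 1)"
    by (intro tendsto_lowerbound[OF lim]) auto
  then show ?thesis by simp
qed

text \<open>Borel-Caratheodory at radius 1/2. Write g = exp L and take N > M, so that p = ln N - L
  has strictly positive real part. The Cayley transform q of p, normalised by q 0 = 0, maps the disc
  into itself, and Schwarz gives |q z| \<le> 1/2. This yields Harnack's inequality Re (p z) \<le> 3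
  Re (p 0), which exponentiates to the claim with N for M; then N tends to M.\<close>

lemma zero_free_lower_bound:
  assumes g: "g holomorphic_on ball 0 1" and nz: "\<And>z. z \<in> ball 0 1 \<Longrightarrow> g z \<noteq> 0"
    and bound: "\<And>z. z \<in> ball 0 1 \<Longrightarrow> norm (g z) \<le> M" and z: "norm z \<le> 1/2"
  shows "norm (g 0) ^ 3 \<le> M\<^sup>2 * norm (g z)"
proof -
  have M: "M > 0" using bound[of 0] nz[of 0] by simp (metis norm_le_zero_iff not_less order_trans)
  obtain L where L: "L holomorphic_on ball 0 1" and gL: "\<And>z. z \<in> ball 0 1 \<Longrightarrow> g z = exp (L z)"
    using simply_connected_imp_holomorphic_log[of g "ball 0 1"] g nz
    by (metis convex_ball convex_imp_locally_path_connected convex_imp_simply_connected)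
  have key: "norm (g 0) ^ 3 \<le> N\<^sup>2 * norm (g z)" if N: "N > M" for N
  proof -
    define p where "p = (\<lambda>w. of_real (ln N) - L w)"
    have Rep: "Re (p w) > 0" if "w \<in> ball 0 1" for w
    proof -
      have "exp (Re (L w)) < N" using bound[OF that] gL[OF that] N by (simp add: )
      then have "Re (L w) < ln N" using N M by (metis exp_gt_zero ln_exp ln_less_cancel_iff less_trans)
      then show ?thesis by (simp add: p_def)
    qed
    define q where "q = (\<lambda>w. (p w - p 0) / (p w + cnj (p 0)))"
    have den: "p w + cnj (p 0) \<noteq> 0" if "w \<in> ball 0 1" for w
    proof -
      have "Re (p w + cnj (p 0)) > 0" using Rep[OF that] Rep[of 0] by simp
      then show ?thesis by (metis less_irrefl zero_complex.sel(1))
    qed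
    have "q holomorphic_on ball 0 1"
      unfolding q_def p_def using den unfolding p_def by (intro holomorphic_intros L) auto
    moreover have "q 0 = 0" by (simp add: q_def)
    moreover have "norm (q w) < 1" if "norm w < 1" for w
    proof -
      have w: "w \<in> ball 0 1" using that by simp
      have "(norm (p w - p 0))\<^sup>2 < (norm (p w + cnj (p 0)))\<^sup>2"
        using mult_pos_pos[OF Rep[OF w] Rep[of 0]]
        unfolding cmod_power2 by (simp add: power2_eq_square algebra_simps)
      then have "norm (p w - p 0) < norm (p w + cnj (p 0))"
        using norm_ge_zero power_less_imp_less_base by blast
      then show ?thesis using den[OF w] by (simp add: q_def norm_divide)
    qed
    ultimately have "norm (q z) \<le> norm z"
      using z by (intro Schwarz_Lemma(1)) auto
    then have qz: "norm (q z) \<le> 1/2" using z by linarith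
    have zb: "z \<in> ball 0 1" using z by simp
    have "norm (p z - p 0) \<le> 1/2 * norm (p z + cnj (p 0))"
      using qz den[OF zb] by (simp add: q_def norm_divide field_simps)
    then have "(norm (p z - p 0))\<^sup>2 \<le> (1/2 * norm (p z + cnj (p 0)))\<^sup>2"
      by (intro power_mono) auto
    then have "(Re (p z) - Re (p 0))\<^sup>2 + (Im (p z) - Im (p 0))\<^sup>2 \<le> 1/4 * ((Re (p z) + Re (p 0))\<^sup>2 + (Im (p z) - Im (p 0))\<^sup>2)"
      by (simp add: cmod_power2 power_mult_distrib power_divide)
    note le = this
    have four: "A \<le> 1/4 * C" if "A + B \<le> 1/4 * (C + B)" "0 \<le> B" for A B C :: real
      using that by argo
    have "(Re (p z) - Re (p 0))\<^sup>2 \<le> 1/4 * (Re (p z) + Re (p 0))\<^sup>2"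
      by (rule four[OF le]) simp
    also have "\<dots> = ((Re (p z) + Re (p 0)) / 2)\<^sup>2"
      unfolding power_divide by simp
    finally have "(Re (p z) - Re (p 0))\<^sup>2 \<le> ((Re (p z) + Re (p 0)) / 2)\<^sup>2" .
    moreover have "0 \<le> (Re (p z) + Re (p 0)) / 2"
      using Rep[OF zb] Rep[of 0] by simp
    ultimately have "Re (p z) - Re (p 0) \<le> (Re (p z) + Re (p 0)) / 2"
      by (rule power2_le_imp_le)
    then have "3 * Re (L 0) \<le> 2 * ln N + Re (L z)" by (simp add: p_def)
    then have "exp (3 * Re (L 0)) \<le> exp (2 * ln N + Re (L z))" by simp
    moreover have "exp (2 * ln N) = N\<^sup>2" using N M by (simp add: exp_double)
    moreover have "exp (3 * Re (L 0)) = (exp (Re (L 0)))^3" using exp_of_nat_mult[of 3 "Re (L 0)"] by simp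
    moreover have "norm (g z) = exp (Re (L z))" "norm (g 0) = exp (Re (L 0))"
      using gL[OF zb] gL[of 0] by simp_all
    ultimately show ?thesis by (simp only: exp_add)
  qed
  have "((\<lambda>N. N\<^sup>2 * norm (g z)) \<longlongrightarrow> M\<^sup>2 * norm (g z)) (at_right M)"
    by (intro tendsto_intros)
  moreover have "eventually (\<lambda>N. norm (g 0) ^ 3 \<le> N\<^sup>2 * norm (g z)) (at_right M)"
    using key by (intro eventually_at_rightI[of M "M+1"]) auto
  ultimately show ?thesis by (intro tendsto_lowerbound) auto
qed

text \<open>The zeros of \<open>g\<close> are removed one at a time by Blaschke factors, which leaves all
  bounds unchanged; the zero-free rest is handled by \<open>zero_free_lower_bound\<close>.\<close>

lemma quotient_bound_unit_disc:
  assumes "g holomorphic_on ball 0 1" and G: "G holomorphic_on ball 0 1"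
    and "finite {z \<in> ball 0 1. g z = 0}"
    and "\<And>z. z \<in> ball 0 1 \<Longrightarrow> g z = 0 \<Longrightarrow> deriv g z \<noteq> 0" and "g 0 \<noteq> 0"
    and "\<And>z. z \<in> ball 0 1 \<Longrightarrow> norm (g z) \<le> M1"
    and "\<And>z. z \<in> ball 0 1 \<Longrightarrow> norm (G z * g z) \<le> M2"
    and z: "norm z \<le> 1/2"
  shows "norm (G z) * norm (g 0) ^ 3 \<le> M2 * M1\<^sup>2"
  using assms(1,3-7)
proof (induction "card {z \<in> ball 0 1. g z = 0}" arbitrary: g)
  case 0
  then have nz: "g w \<noteq> 0" if "w \<in> ball 0 1" for w using that by auto
  have "norm (G z) * norm (g 0) ^ 3 \<le> norm (G z) * (M1\<^sup>2 * norm (g z))"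
    using 0 nz z by (intro mult_left_mono zero_free_lower_bound) auto
  also have "\<dots> = norm (G z * g z) * M1\<^sup>2" by (simp add: norm_mult)
  also have "\<dots> \<le> M2 * M1\<^sup>2" using 0(7) z by (intro mult_right_mono) auto
  finally show ?case .
next
  case (Suc n)
  note g = Suc.prems
  obtain a where a: "a \<in> ball 0 1" "g a = 0" using Suc.hyps(2)
    by (metis (mono_tags, lifting) card_eq_0_iff empty_Collect_eq nat.simps(3))
  obtain k where k: "k holomorphic_on ball 0 1" "\<And>z. z \<in> ball 0 1 \<Longrightarrow> g z = (z - a) * k z" "k a = deriv g a"
    using holomorphic_factor_at_zero[OF g(1) _ a] by auto
  define g1 where "g1 = (\<lambda>z. k z * (1 - cnj a * z))"
  have hol: "g1 holomorphic_on ball 0 1" unfolding g1_def by (intro holomorphic_intros k)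
  have b_nz: "1 - cnj a * w \<noteq> 0" if "w \<in> ball 0 1" for w
  proof -
    have "norm (cnj a * w) < 1" using a that mult_strict_mono'[of "norm a" 1 "norm w" 1] by (simp add: norm_mult)
    then show ?thesis by auto
  qed
  have ka: "k a \<noteq> 0" using k(3) g(3) a by auto
  have zeros: "{z \<in> ball 0 1. g1 z = 0} = {z \<in> ball 0 1. g z = 0} - {a}"
    using b_nz k(2) ka a by (auto simp: g1_def)
  have a0: "a \<noteq> 0" using a g(4) by auto
  show ?case
  proof -
    have "norm (G z) * norm (g1 0) ^ 3 \<le> M2 * M1\<^sup>2"
    proof (rule Suc.hyps(1))
      show "n = card {z \<in> ball 0 1. g1 z = 0}"
      proof -
        have "card ({z \<in> ball 0 1. g z = 0} - {a}) = card {z \<in> ball 0 1. g z = 0} - 1"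
          using a by (intro card_Diff_singleton) auto
        then show ?thesis unfolding zeros Suc.hyps(2)[symmetric] by simp
      qed
      show "finite {z \<in> ball 0 1. g1 z = 0}" using g(2) unfolding zeros by blast
      show "g1 0 \<noteq> 0" using k(2)[of 0] g(4) by (auto simp: g1_def)
      show "norm (g1 w) \<le> M1" if "w \<in> ball 0 1" for w
      proof (rule blaschke_strip_bound[OF hol a(1) _ that])
        fix v :: complex assume v: "v \<in> ball 0 1"
        have "norm (g1 v * (v - a)) = norm (g v) * norm (1 - cnj a * v)"
          using k(2)[OF v] by (simp add: g1_def norm_mult)
        then show "norm (g1 v * (v - a)) \<le> M1 * norm (1 - cnj a * v)"
          using g(5)[OF v] by (simp add: mult_right_mono)
      qed
      show "norm (G w * g1 w) \<le> M2" if "w \<in> ball 0 1" for w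
      proof (rule blaschke_strip_bound[OF _ a(1) _ that])
        show "(\<lambda>w. G w * g1 w) holomorphic_on ball 0 1" by (intro holomorphic_intros G hol)
        fix v :: complex assume v: "v \<in> ball 0 1"
        have "norm (G v * g1 v * (v - a)) = norm (G v * g v) * norm (1 - cnj a * v)"
          using k(2)[OF v] by (simp add: g1_def norm_mult)
        then show "norm (G v * g1 v * (v - a)) \<le> M2 * norm (1 - cnj a * v)"
          using g(6)[OF v] by (simp add: mult_right_mono)
      qed
      show "deriv g1 w \<noteq> 0" if w: "w \<in> ball 0 1" and w0: "g1 w = 0" for w
      proof -
        have wa: "w \<noteq> a" and gw: "g w = 0" using zeros w w0 by auto
        have kw: "k w = 0" using w0 b_nz[OF w] by (simp add: g1_def)
        have kd: "(k has_field_derivative deriv k w) (at w)"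
          using k(1) w by (simp add: holomorphic_derivI)
        have "((\<lambda>z. (z - a) * k z) has_field_derivative (w - a) * deriv k w) (at w)"
          by (auto intro!: derivative_eq_intros kd simp: kw)
        then have "(g has_field_derivative (w - a) * deriv k w) (at w)"
          by (rule has_field_derivative_transform_within_open[where S="ball 0 1"]) (use w k(2) in auto)
        then have "deriv k w \<noteq> 0" using g(3)[OF w gw] DERIV_imp_deriv by fastforce
        moreover have "(g1 has_field_derivative deriv k w * (1 - cnj a * w)) (at w)"
          unfolding g1_def by (auto intro!: derivative_eq_intros kd simp: kw)
        ultimately show ?thesis using b_nz[OF w] DERIV_imp_deriv by fastforce
      qed
    qed (use hol in auto)
    \<comment> \<open>Since |a| < 1, removing the zero can only raise the modulus at the centre,
      which is the favourable direction.\<close>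
    moreover have "norm (g 0) = norm a * norm (g1 0)" using k(2)[of 0] by (simp add: g1_def norm_mult)
    then have "norm (g 0) \<le> norm (g1 0)" using a by (simp add: mult_left_le_one_le)
    then have "norm (G z) * norm (g 0) ^ 3 \<le> norm (G z) * norm (g1 0) ^ 3"
      by (intro mult_left_mono power_mono) auto
    ultimately show ?thesis by linarith
  qed
qed

text \<open>The conclusion does not involve the number of zeros of g in the disc. This is what makes
  the later decay estimate uniform over all lines.\<close>

lemma quotient_bound:
  fixes R :: real
  assumes g: "g holomorphic_on UNIV" and G: "G holomorphic_on UNIV"
    and simple: "\<And>z. g z = 0 \<Longrightarrow> deriv g z \<noteq> 0" and gc: "g c \<noteq> 0" and R: "R > 0"
    and M1: "\<And>z. norm (z - c) < R \<Longrightarrow> norm (g z) \<le> M1"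
    and M2: "\<And>z. norm (z - c) < R \<Longrightarrow> norm (G z * g z) \<le> M2"
    and z: "norm (z - c) \<le> R / 2"
  shows "norm (G z) \<le> M2 * M1\<^sup>2 / norm (g c) ^ 3"
proof -
  define s where "s = (\<lambda>w. c + of_real R * w)"
  have sb: "norm (s w - c) < R" if "w \<in> ball 0 1" for w
    using that R by (simp add: s_def norm_mult)
  have ds: "(s has_field_derivative of_real R) (at w)" for w
    unfolding s_def by (auto intro!: derivative_eq_intros)
  have hs: "s holomorphic_on A" for A unfolding s_def by (intro holomorphic_intros)
  have dgs: "deriv (g \<circ> s) w = deriv g (s w) * of_real R" for w
    by (intro DERIV_imp_deriv DERIV_chain[OF _ ds] holomorphic_derivI[OF g]) auto
  have nc: "\<not> g constant_on UNIV" if "g w = 0" for w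
    unfolding constant_on_def
  proof
    assume "\<exists>y. \<forall>x\<in>UNIV. g x = y"
    then show False using that gc by (metis UNIV_I)
  qed
  have "finite {w \<in> ball 0 1. (g \<circ> s) w = 0}"
  proof (cases "\<exists>w. g w = 0")
    case True
    then have "finite {w \<in> cball c R. g w = 0}"
      using nc by (intro holomorphic_compact_finite_zeros[OF g]) auto
    moreover have "inj_on s {w \<in> ball 0 1. (g \<circ> s) w = 0}"
      using R by (auto simp: inj_on_def s_def)
    moreover have "s ` {w \<in> ball 0 1. (g \<circ> s) w = 0} \<subseteq> {w \<in> cball c R. g w = 0}"
      using sb by (auto simp: dist_norm norm_minus_commute less_imp_le)
    ultimately show ?thesis using inj_on_finite by blast
  qed auto
  note fin = this
  have "norm ((G \<circ> s) ((z - c) / of_real R)) * norm ((g \<circ> s) 0) ^ 3 \<le> M2 * M1\<^sup>2"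
  proof (rule quotient_bound_unit_disc[where g = "g \<circ> s" and G = "G \<circ> s"])
    show "finite {w \<in> ball 0 1. (g \<circ> s) w = 0}" by (rule fin)
    show "g \<circ> s holomorphic_on ball 0 1" "G \<circ> s holomorphic_on ball 0 1"
      by (intro holomorphic_on_compose hs holomorphic_on_subset[OF g] holomorphic_on_subset[OF G]; simp)+
    show "norm ((z - c) / of_real R) \<le> 1/2" using z R by (simp add: norm_divide field_simps)
    show "(g \<circ> s) 0 \<noteq> 0" using gc by (simp add: s_def)
    show "deriv (g \<circ> s) w \<noteq> 0" if "(g \<circ> s) w = 0" for w
      using simple[of "s w"] that R by (simp add: dgs)
  qed (use M1 M2 sb in auto)
  then show ?thesis using R gc by (simp add: s_def field_simps)
qed

lemma entire_division:
  assumes g: "g holomorphic_on UNIV" and h: "h holomorphic_on UNIV"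
    and simple: "\<And>z. g z = 0 \<Longrightarrow> deriv g z \<noteq> 0" and van: "\<And>z. g z = 0 \<Longrightarrow> h z = 0"
  obtains G where "G holomorphic_on UNIV" "\<And>z. h z = G z * g z"
proof
  \<comment> \<open>At a zero of g the value is l'Hopital's quotient. Near such a zero a the factor
    z - a cancels, and G agrees with \<open>l / k\<close>, whose denominator does not vanish at
    a.\<close>
  define G where "G = (\<lambda>z. if g z = 0 then deriv h z / deriv g z else h z / g z)"
  show "h z = G z * g z" for z using van by (auto simp: G_def)
  have "G field_differentiable (at a)" for a
  proof (cases "g a = 0")
    case False
    have "open {z. g z \<noteq> 0}"
    proof -
      have "continuous_on UNIV g" using g by (rule holomorphic_on_imp_continuous_on)
      then show ?thesis by (auto intro: open_Collect_neq continuous_on_const)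
    qed
    moreover have "(\<lambda>z. h z / g z) holomorphic_on {z. g z \<noteq> 0}"
      by (intro holomorphic_intros holomorphic_on_subset[OF g] holomorphic_on_subset[OF h]) auto
    then have "G holomorphic_on {z. g z \<noteq> 0}"
      by (rule holomorphic_transform) (auto simp: G_def)
    ultimately show ?thesis using False holomorphic_on_imp_differentiable_at by blast
  next
    case True
    obtain k where k: "k holomorphic_on UNIV" "\<And>z. g z = (z - a) * k z" "k a = deriv g a"
      using holomorphic_factor_at_zero[OF g, of a] True by auto
    obtain l where l: "l holomorphic_on UNIV" "\<And>z. h z = (z - a) * l z" "l a = deriv h a"
      using holomorphic_factor_at_zero[OF h, of a] van[OF True] by auto
    have ka: "k a \<noteq> 0" using k(3) simple True by simp
    have "continuous_on UNIV k" using k(1) by (rule holomorphic_on_imp_continuous_on)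
    then have op: "open {z. k z \<noteq> 0}" by (auto intro: open_Collect_neq continuous_on_const)
    have "(\<lambda>z. l z / k z) holomorphic_on {z. k z \<noteq> 0}"
      by (intro holomorphic_intros holomorphic_on_subset[OF k(1)] holomorphic_on_subset[OF l(1)]) auto
    moreover have "l z / k z = G z" if "k z \<noteq> 0" for z
      using that k l True by (cases "z = a") (auto simp: G_def)
    ultimately have "G holomorphic_on {z. k z \<noteq> 0}"
      by (rule holomorphic_transform) auto
    then show ?thesis using ka op holomorphic_on_imp_differentiable_at by blast
  qed
  then show "G holomorphic_on UNIV" by (auto simp: holomorphic_on_def field_differentiable_at_within)
qed

subsection \<open>Integration along lines\<close>

lemma integrable_inverse_one_plus_square: "integrable lborel (\<lambda>x::real. inverse (1 + x\<^sup>2))"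
  using integrable_inverse_1_plus_square by (simp add: set_integrable_def)

text \<open>Cauchy's theorem for a rectangle, expressed through a primitive F. The two vertical
  sides at abscissas X and -X contribute at most C |t| / (1 + X^2) each, which tends to 0.\<close>

lemma horizontal_line_integral_shift:
  fixes f :: "complex \<Rightarrow> complex" and t :: real
  assumes f: "f holomorphic_on UNIV"
    and bound: "\<And>x y. \<bar>y\<bar> \<le> \<bar>t\<bar> \<Longrightarrow> norm (f (Complex x y)) \<le> C / (1 + x\<^sup>2)"
  shows "integrable lborel (\<lambda>x. f (Complex x t))"
    "(LINT x|lborel. f (Complex x 0)) = (LINT x|lborel. f (Complex x t))"
proof -
  have cont: "continuous_on UNIV f" using f by (rule holomorphic_on_imp_continuous_on)
  have contc: "continuous_on A (\<lambda>x. f (Complex x y))" for A y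
    by (rule continuous_on_compose2[OF cont]) (auto simp: Complex_eq intro!: continuous_intros)
  have intC: "integrable lborel (\<lambda>x. C / (1 + x\<^sup>2))"
    using integrable_mult_right[OF integrable_inverse_one_plus_square, of C] by (simp add: divide_inverse)
  have C: "C \<ge> 0" using bound[of 0 0] norm_ge_zero[of "f (Complex 0 0)"] by (simp del: norm_ge_zero)
  have integ: "integrable lborel (\<lambda>x. f (Complex x y))" if "\<bar>y\<bar> \<le> \<bar>t\<bar>" for y
    by (rule Bochner_Integration.integrable_bound[OF intC])
       (use bound[OF that] C in \<open>auto intro!: borel_measurable_continuous_onI contc\<close>)
  show "integrable lborel (\<lambda>x. f (Complex x t))" by (rule integ) simp
  obtain F where F: "\<And>z. (F has_field_derivative f z) (at z)"
    using holomorphic_convex_primitive'[of UNIV f] f by auto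
  have FTC: "(LINT x|lborel. indicator {-X..X} x *\<^sub>R f (Complex x y)) = F (Complex X y) - F (Complex (-X) y)"
    if "X \<ge> 0" for X y
  proof (rule integral_FTC_Icc)
    fix x assume "-X \<le> x" "x \<le> X"
    have "((\<lambda>x. Complex x y) has_vector_derivative 1) (at x within {-X..X})"
      unfolding Complex_eq by (auto intro!: derivative_eq_intros)
    from field_vector_diff_chain_within[OF this has_field_derivative_at_within[OF F]]
    show "((\<lambda>x. F (Complex x y)) has_vector_derivative f (Complex x y)) (at x within {-X..X})"
      by (simp add: o_def)
  qed (use that in \<open>auto intro!: contc\<close>)
  have lim: "(\<lambda>n. LINT x|lborel. indicator {- real n..real n} x *\<^sub>R f (Complex x y)) \<longlonglongrightarrow> (LINT x|lborel. f (Complex x y))"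
    if y: "\<bar>y\<bar> \<le> \<bar>t\<bar>" for y
  proof (rule integral_dominated_convergence[where w = "\<lambda>x. norm (f (Complex x y))"])
    show "AE x in lborel. (\<lambda>n. indicator {- real n..real n} x *\<^sub>R f (Complex x y)) \<longlonglongrightarrow> f (Complex x y)"
    proof (rule AE_I2)
      fix x :: real
      obtain N :: nat where "\<bar>x\<bar> \<le> real N" using real_arch_simple by blast
      then have "eventually (\<lambda>n. indicator {- real n..real n} x *\<^sub>R f (Complex x y) = f (Complex x y)) sequentially"
        by (intro eventually_sequentiallyI[of N]) (auto simp: indicator_def)
      then show "(\<lambda>n. indicator {- real n..real n} x *\<^sub>R f (Complex x y)) \<longlonglongrightarrow> f (Complex x y)"
        by (rule tendsto_eventually)
    qed
  qed (use integ[OF y] in \<open>auto intro!: borel_measurable_continuous_onI contc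
        borel_measurable_scaleR split: split_indicator\<close>)
  have side: "norm (F (Complex x t) - F (Complex x 0)) \<le> C / (1 + x\<^sup>2) * \<bar>t\<bar>" for x
  proof -
    have "norm (F (Complex x t) - F (Complex x 0)) \<le> C / (1 + x\<^sup>2) * norm (Complex x t - Complex x 0)"
    proof (rule field_differentiable_bound[where S="closed_segment (Complex x 0) (Complex x t)"])
      fix z assume "z \<in> closed_segment (Complex x 0) (Complex x t)"
      then obtain u where u: "0 \<le> u" "u \<le> 1" "z = (1 - u) *\<^sub>R Complex x 0 + u *\<^sub>R Complex x t"
        by (auto simp: in_segment)
      then have z: "z = Complex x (u * t)" by (simp add: complex_eq_iff algebra_simps)
      have "\<bar>u * t\<bar> \<le> \<bar>t\<bar>" using u by (simp add: abs_mult mult_left_le_one_le)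
      then show "norm (f z) \<le> C / (1 + x\<^sup>2)" unfolding z by (rule bound)
    qed (auto intro: F has_field_derivative_at_within)
    also have "norm (Complex x t - Complex x 0) = \<bar>t\<bar>" by (simp add: cmod_def)
    finally show ?thesis .
  qed
  have "(\<lambda>n. (LINT x|lborel. indicator {- real n..real n} x *\<^sub>R f (Complex x t))
         - (LINT x|lborel. indicator {- real n..real n} x *\<^sub>R f (Complex x 0))) \<longlonglongrightarrow> 0"
  proof (rule Lim_null_comparison)
    show "eventually (\<lambda>n. norm ((LINT x|lborel. indicator {- real n..real n} x *\<^sub>R f (Complex x t))
         - (LINT x|lborel. indicator {- real n..real n} x *\<^sub>R f (Complex x 0))) \<le> 2 * C * \<bar>t\<bar> * (1 / (1 + (real n)\<^sup>2))) sequentially"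
    proof (rule always_eventually, rule allI)
      fix n :: nat
      have "norm ((F (Complex n t) - F (Complex (- real n) t)) - (F (Complex n 0) - F (Complex (- real n) 0)))
        \<le> norm (F (Complex n t) - F (Complex n 0)) + norm (F (Complex (- real n) t) - F (Complex (- real n) 0))"
        using norm_triangle_ineq4[of "F (Complex n t) - F (Complex n 0)" "F (Complex (- real n) t) - F (Complex (- real n) 0)"]
        by (simp add: algebra_simps)
      also have "\<dots> \<le> C / (1 + (real n)\<^sup>2) * \<bar>t\<bar> + C / (1 + (- real n)\<^sup>2) * \<bar>t\<bar>"
        by (intro add_mono side)
      finally show "norm ((LINT x|lborel. indicator {- real n..real n} x *\<^sub>R f (Complex x t))
         - (LINT x|lborel. indicator {- real n..real n} x *\<^sub>R f (Complex x 0))) \<le> 2 * C * \<bar>t\<bar> * (1 / (1 + (real n)\<^sup>2))"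
        by (simp add: FTC)
    qed
    have "(\<lambda>n. 1 / (1 + (real n)\<^sup>2)) \<longlonglongrightarrow> 0" by real_asymp
    then show "(\<lambda>n. 2 * C * \<bar>t\<bar> * (1 / (1 + (real n)\<^sup>2))) \<longlonglongrightarrow> 0"
      by (rule tendsto_mult_right_zero)
  qed
  moreover have "(\<lambda>n. (LINT x|lborel. indicator {- real n..real n} x *\<^sub>R f (Complex x t))
         - (LINT x|lborel. indicator {- real n..real n} x *\<^sub>R f (Complex x 0))) \<longlonglongrightarrow>
       (LINT x|lborel. f (Complex x t)) - (LINT x|lborel. f (Complex x 0))"
    by (intro tendsto_diff lim) auto
  ultimately show "(LINT x|lborel. f (Complex x 0)) = (LINT x|lborel. f (Complex x t))"
    using LIMSEQ_unique by fastforce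
qed


text \<open>Differentiation under the integral sign with an integrable quadratic remainder in place
  of a limit theorem. The parameter space is kept general because it serves both real Fourier
  integrals and holomorphic integrals in a complex parameter.\<close>

lemma has_derivative_integral:
  fixes F :: "'a::real_normed_vector \<Rightarrow> 'b \<Rightarrow> 'c::{banach, second_countable_topology}"
  assumes F: "\<And>h. norm h \<le> 1 \<Longrightarrow> integrable M (F (x + h))"
    and D: "\<And>h. integrable M (\<lambda>y. D y h)" and lin: "\<And>y. linear (D y)"
    and B: "integrable M B" "\<And>h. AE y in M. norm (D y h) \<le> norm h * B y"
    and K: "integrable M K"
      "\<And>h. norm h \<le> 1 \<Longrightarrow> AE y in M. norm (F (x + h) y - F x y - D y h) \<le> (norm h)\<^sup>2 * K y"
  shows "((\<lambda>x. LINT y|M. F x y) has_derivative (\<lambda>h. LINT y|M. D y h)) (at x)"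
  unfolding has_derivative_at
proof
  show "bounded_linear (\<lambda>h. LINT y|M. D y h)"
  proof (rule bounded_linear_intro)
    show "(LINT y|M. D y (h + k)) = (LINT y|M. D y h) + (LINT y|M. D y k)" for h k
      using lin by (subst Bochner_Integration.integral_add[symmetric]) (auto simp: D linear_add)
    show "(LINT y|M. D y (c *\<^sub>R h)) = c *\<^sub>R (LINT y|M. D y h)" for c h
      using lin by (subst integral_scaleR_right[symmetric]) (auto simp: linear_cmul)
    show "norm (LINT y|M. D y h) \<le> norm h * (LINT y|M. B y)" for h
    proof -
      have "norm (LINT y|M. D y h) \<le> (LINT y|M. norm h * B y)"
        by (rule order_trans[OF integral_norm_bound integral_mono_AE]) (use B in \<open>auto intro: D\<close>)
      then show ?thesis by simp
    qed
  qed
  have F0: "integrable M (F x)" using F[of 0] by simp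
  have est: "norm ((LINT y|M. F (x + h) y) - (LINT y|M. F x y) - (LINT y|M. D y h)) \<le> (norm h)\<^sup>2 * (LINT y|M. K y)"
    if h: "norm h \<le> 1" for h
  proof -
    have "(LINT y|M. F (x + h) y) - (LINT y|M. F x y) - (LINT y|M. D y h) = (LINT y|M. F (x + h) y - F x y - D y h)"
      using F0 F[OF h] D[of h] by simp
    also have "norm \<dots> \<le> (LINT y|M. (norm h)\<^sup>2 * K y)"
      by (rule order_trans[OF integral_norm_bound integral_mono_AE]) (use K h F0 F[OF h] D[of h] in auto)
    finally show ?thesis by simp
  qed
  show "(\<lambda>h. norm ((LINT y|M. F (x + h) y) - (LINT y|M. F x y) - (LINT y|M. D y h)) / norm h) \<midarrow>0\<rightarrow> 0"
  proof (rule Lim_null_comparison)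
    show "\<forall>\<^sub>F h in at 0. norm (norm ((LINT y|M. F (x + h) y) - (LINT y|M. F x y) - (LINT y|M. D y h)) / norm h)
       \<le> norm h * (LINT y|M. K y)"
      unfolding eventually_at
    proof (intro exI[of _ 1] conjI ballI impI)
      fix h :: 'a assume "h \<noteq> 0 \<and> dist h 0 < 1"
      then have "norm h \<le> 1" and "norm h > 0" by auto
      then show "norm (norm ((LINT y|M. F (x + h) y) - (LINT y|M. F x y) - (LINT y|M. D y h)) / norm h)
       \<le> norm h * (LINT y|M. K y)"
        using est[of h] by (simp add: divide_le_eq power2_eq_square mult_ac)
    qed auto
    show "((\<lambda>h. norm h * (LINT y|M. K y)) \<longlongrightarrow> 0) (at (0::'a))"
      by (auto intro!: tendsto_eq_intros)
  qed
qed

section \<open>Lebesgue measure along lines, products and Fubini's theorem\<close>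

lemma nn_integral_lborel_translate:
  fixes f :: "'a::euclidean_space \<Rightarrow> ennreal"
  assumes [measurable]: "f \<in> borel_measurable borel"
  shows "(\<integral>\<^sup>+x. f (x + c) \<partial>lborel) = (\<integral>\<^sup>+x. f x \<partial>lborel)"
  by (subst (2) lborel_distr_plus[symmetric, of c]) (simp add: nn_integral_distr add.commute)

lemma integral_lborel_translate:
  fixes f :: "'a::euclidean_space \<Rightarrow> 'b::{banach, second_countable_topology}"
  assumes [measurable]: "f \<in> borel_measurable borel"
  shows "(LINT x|lborel. f (x + c)) = (LINT x|lborel. f x)"
  by (subst (2) lborel_distr_plus[symmetric, of c]) (simp add: integral_distr add.commute)

text \<open>Disintegration along lines parallel to a unit vector \<open>e\<close> without splitting off a coordinate:
  every line is weighted by the length \<open>1\<close> that it spends in the slab \<open>0 \<le> x \<bullet> e \<le> 1\<close>.\<close>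

lemma nn_integral_lborel_lines:
  fixes f :: "'a::euclidean_space \<Rightarrow> ennreal"
  assumes [measurable]: "f \<in> borel_measurable borel" and e: "e \<bullet> e = 1"
  shows "(\<integral>\<^sup>+x. indicator {0..1} (x \<bullet> e) * (\<integral>\<^sup>+a. f (x + a *\<^sub>R e) \<partial>lborel) \<partial>lborel) = (\<integral>\<^sup>+x. f x \<partial>lborel)"
proof -
  have "(\<integral>\<^sup>+x. indicator {0..1} (x \<bullet> e) * (\<integral>\<^sup>+a. f (x + a *\<^sub>R e) \<partial>lborel) \<partial>lborel)
      = (\<integral>\<^sup>+x. (\<integral>\<^sup>+a. indicator {0..1} (x \<bullet> e) * f (x + a *\<^sub>R e) \<partial>lborel) \<partial>lborel)"
    by (simp add: nn_integral_cmult)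
  also have "\<dots> = (\<integral>\<^sup>+a. (\<integral>\<^sup>+x. indicator {0..1} (x \<bullet> e) * f (x + a *\<^sub>R e) \<partial>lborel) \<partial>lborel)"
    by (rule lborel_pair.Fubini') measurable
  also have "\<dots> = (\<integral>\<^sup>+a. (\<integral>\<^sup>+x. indicator {0..1} (x \<bullet> e - a) * f x \<partial>lborel) \<partial>lborel)"
  proof (rule nn_integral_cong)
    fix a :: real
    have "(\<integral>\<^sup>+x. indicator {0..1} ((x + a *\<^sub>R e) \<bullet> e - a) * f (x + a *\<^sub>R e) \<partial>lborel) = (\<integral>\<^sup>+x. indicator {0..1} (x \<bullet> e - a) * f x \<partial>lborel)"
      by (rule nn_integral_lborel_translate[where f = "\<lambda>x. indicator {0..1} (x \<bullet> e - a) * f x"]) measurable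
    then show "(\<integral>\<^sup>+x. indicator {0..1} (x \<bullet> e) * f (x + a *\<^sub>R e) \<partial>lborel) = (\<integral>\<^sup>+x. indicator {0..1} (x \<bullet> e - a) * f x \<partial>lborel)"
      by (simp add: inner_add_left e)
  qed
  also have "\<dots> = (\<integral>\<^sup>+x. (\<integral>\<^sup>+a. indicator {0..1} (x \<bullet> e - a) * f x \<partial>lborel) \<partial>lborel)"
    by (rule lborel_pair.Fubini') measurable
  also have "\<dots> = (\<integral>\<^sup>+x. f x \<partial>lborel)"
  proof (rule nn_integral_cong)
    fix x :: 'a
    have "(\<integral>\<^sup>+a. indicator {0..1} (x \<bullet> e - a) * f x \<partial>lborel) = (\<integral>\<^sup>+a. indicator {x \<bullet> e - 1..x \<bullet> e} a * f x \<partial>lborel)"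
      by (rule nn_integral_cong) (auto split: split_indicator)
    also have "\<dots> = (\<integral>\<^sup>+a. f x * indicator {x \<bullet> e - 1..x \<bullet> e} a \<partial>lborel)" by (simp add: mult.commute)
    also have "\<dots> = f x" by (subst nn_integral_cmult_indicator) auto
    finally show "(\<integral>\<^sup>+a. indicator {0..1} (x \<bullet> e - a) * f x \<partial>lborel) = f x" .
  qed
  finally show ?thesis .
qed

text \<open>Reduces null sets of the space to null sets of lines in one direction; in this way the
  zero sets of the symbol are found to be negligible.\<close>

lemma AE_lborel_lines:
  fixes P :: "'a::euclidean_space \<Rightarrow> bool"
  assumes meas: "{x. \<not> P x} \<in> sets borel" and e: "e \<bullet> e = 1"
    and P: "\<And>x. AE a in lborel. P (x + a *\<^sub>R e)"
  shows "AE x in lborel. P x"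
proof -
  note [measurable] = meas
  have "(\<integral>\<^sup>+x. indicator {x. \<not> P x} x \<partial>lborel) =
     (\<integral>\<^sup>+x. indicator {0..1} (x \<bullet> e) * (\<integral>\<^sup>+a. indicator {x. \<not> P x} (x + a *\<^sub>R e) \<partial>lborel) \<partial>lborel)"
    by (rule nn_integral_lborel_lines[OF _ e, symmetric]) measurable
  also have "\<dots> = (\<integral>\<^sup>+x. 0 \<partial>(lborel :: 'a measure))"
  proof (rule nn_integral_cong)
    fix x :: 'a
    have "(\<integral>\<^sup>+a. indicator {x. \<not> P x} (x + a *\<^sub>R e) \<partial>lborel) = (\<integral>\<^sup>+a. 0 \<partial>(lborel :: real measure))"
      using P[of x] by (intro nn_integral_cong_AE) auto
    then show "indicator {0..1} (x \<bullet> e) * (\<integral>\<^sup>+a. indicator {x. \<not> P x} (x + a *\<^sub>R e) \<partial>lborel) = (0 :: ennreal)" by simp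
  qed
  finally have "emeasure lborel {x. \<not> P x} = 0" using meas by simp
  then show ?thesis using meas by (subst AE_iff_measurable[of "{x. \<not> P x}"]) auto
qed

text \<open>In \<open>?F\<close> the slab weight depends on x alone, in \<open>?G\<close> the
  function does. For fixed a, translation by \<open>a *\<^sub>R e\<close> carries one into the
  other, and integrating the weight of \<open>?G\<close> over a gives 1. Integrability along lines
  is claimed only inside the slab because the weight vanishes elsewhere.\<close>

lemma
  fixes f :: "'a::euclidean_space \<Rightarrow> complex"
  assumes f: "integrable lborel f" and e: "e \<bullet> e = 1"
  shows AE_integrable_lborel_lines: "AE x in lborel. x \<bullet> e \<in> {0..1} \<longrightarrow> integrable lborel (\<lambda>a. f (x + a *\<^sub>R e))"
    and integral_lborel_lines: "(LINT x|lborel. indicator {0..1} (x \<bullet> e) *\<^sub>R (LINT a|lborel. f (x + a *\<^sub>R e))) = (LINT x|lborel. f x)"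
proof -
  have [measurable]: "f \<in> borel_measurable borel" using f by auto
  let ?F = "\<lambda>(x, a). indicator {0..1} (x \<bullet> e) *\<^sub>R f (x + a *\<^sub>R e)"
  let ?G = "\<lambda>(x, a). indicator {0..1} (x \<bullet> e - a) *\<^sub>R f x"
  have fin: "(\<integral>\<^sup>+x. norm (f x) \<partial>lborel) < \<infinity>" using f by (simp add: integrable_iff_bounded)
  have F: "integrable (lborel \<Otimes>\<^sub>M lborel) ?F"
  proof (rule integrableI_bounded)
    have "(\<integral>\<^sup>+p. norm (?F p) \<partial>(lborel \<Otimes>\<^sub>M lborel)) = (\<integral>\<^sup>+x. (\<integral>\<^sup>+a. norm (?F (x, a)) \<partial>lborel) \<partial>lborel)"
      by (rule lborel.nn_integral_fst[symmetric]) measurable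
    also have "\<dots> = (\<integral>\<^sup>+x. indicator {0..1} (x \<bullet> e) * (\<integral>\<^sup>+a. norm (f (x + a *\<^sub>R e)) \<partial>lborel) \<partial>lborel)"
      by (intro nn_integral_cong) (auto split: split_indicator)
    also have "\<dots> = (\<integral>\<^sup>+x. norm (f x) \<partial>lborel)"
      by (rule nn_integral_lborel_lines[OF _ e]) measurable
    finally show "(\<integral>\<^sup>+p. norm (?F p) \<partial>(lborel \<Otimes>\<^sub>M lborel)) < \<infinity>" using fin by simp
  qed measurable
  have G: "integrable (lborel \<Otimes>\<^sub>M lborel) ?G"
  proof (rule integrableI_bounded)
    have "(\<integral>\<^sup>+p. norm (?G p) \<partial>(lborel \<Otimes>\<^sub>M lborel)) = (\<integral>\<^sup>+x. (\<integral>\<^sup>+a. norm (?G (x, a)) \<partial>lborel) \<partial>lborel)"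
      by (rule lborel.nn_integral_fst[symmetric]) measurable
    also have "\<dots> = (\<integral>\<^sup>+x. norm (f x) \<partial>lborel)"
    proof (rule nn_integral_cong)
      fix x :: 'a
      have "(\<integral>\<^sup>+a. norm (?G (x, a)) \<partial>lborel) = (\<integral>\<^sup>+a. ennreal (norm (f x)) * indicator {x \<bullet> e - 1..x \<bullet> e} a \<partial>lborel)"
        by (rule nn_integral_cong) (auto split: split_indicator)
      also have "\<dots> = norm (f x)" by (subst nn_integral_cmult_indicator) auto
      finally show "(\<integral>\<^sup>+a. norm (?G (x, a)) \<partial>lborel) = norm (f x)" .
    qed
    finally show "(\<integral>\<^sup>+p. norm (?G p) \<partial>(lborel \<Otimes>\<^sub>M lborel)) < \<infinity>" using fin by simp
  qed measurable
  show "AE x in lborel. x \<bullet> e \<in> {0..1} \<longrightarrow> integrable lborel (\<lambda>a. f (x + a *\<^sub>R e))"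
    using lborel_pair.AE_integrable_fst'[OF F] by eventually_elim auto
  have "(LINT x|lborel. indicator {0..1} (x \<bullet> e) *\<^sub>R (LINT a|lborel. f (x + a *\<^sub>R e)))
      = (LINT x|lborel. LINT a|lborel. ?F (x, a))" by simp
  also have "\<dots> = (LINT a|lborel. LINT x|lborel. ?F (x, a))"
    using lborel_pair.Fubini_integral[of "\<lambda>x a. ?F (x, a)"] F by simp
  also have "\<dots> = (LINT a|lborel. LINT x|lborel. ?G (x, a))"
  proof (rule Bochner_Integration.integral_cong[OF refl])
    fix a :: real
    have "(LINT x|lborel. indicator {0..1} ((x + a *\<^sub>R e) \<bullet> e - a) *\<^sub>R f (x + a *\<^sub>R e)) = (LINT x|lborel. indicator {0..1} (x \<bullet> e - a) *\<^sub>R f x)"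
      by (rule integral_lborel_translate[where f = "\<lambda>x. indicator {0..1} (x \<bullet> e - a) *\<^sub>R f x"]) measurable
    then show "(LINT x|lborel. ?F (x, a)) = (LINT x|lborel. ?G (x, a))"
      by (simp add: inner_add_left e)
  qed
  also have "\<dots> = (LINT x|lborel. LINT a|lborel. ?G (x, a))"
    using lborel_pair.Fubini_integral[of "\<lambda>x a. ?G (x, a)"] G by simp
  also have "\<dots> = (LINT x|lborel. f x)"
  proof (rule Bochner_Integration.integral_cong[OF refl])
    fix x :: 'a
    have "(LINT a|lborel. ?G (x, a)) = (LINT a|lborel. indicator {x \<bullet> e - 1..x \<bullet> e} a *\<^sub>R f x)"
      by (rule Bochner_Integration.integral_cong) (auto split: split_indicator)
    also have "\<dots> = f x" by (subst integral_scaleR_left) auto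
    finally show "(LINT a|lborel. ?G (x, a)) = f x" .
  qed
  finally show "(LINT x|lborel. indicator {0..1} (x \<bullet> e) *\<^sub>R (LINT a|lborel. f (x + a *\<^sub>R e))) = (LINT x|lborel. f x)" .
qed

lemma integral_lborel_eqI_lines:
  fixes f g :: "'a::euclidean_space \<Rightarrow> complex"
  assumes "integrable lborel f" "integrable lborel g" "e \<bullet> e = 1"
    and "AE x in lborel. (LINT a|lborel. f (x + a *\<^sub>R e)) = (LINT a|lborel. g (x + a *\<^sub>R e))"
  shows "(LINT x|lborel. f x) = (LINT x|lborel. g x)"
proof -
  have [measurable]: "f \<in> borel_measurable borel" "g \<in> borel_measurable borel" using assms(1,2) by auto
  show ?thesis
    unfolding integral_lborel_lines[OF assms(1,3), symmetric] integral_lborel_lines[OF assms(2,3), symmetric]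
    by (rule integral_cong_AE) (use assms(4) in \<open>auto elim: eventually_mono\<close>)
qed

lemma integral_lborel_prod_Basis:
  fixes f :: "'a::euclidean_space \<Rightarrow> real \<Rightarrow> complex"
  assumes f: "\<And>b. b \<in> Basis \<Longrightarrow> integrable lborel (f b)"
  shows "(LINT x|lborel. (\<Prod>b\<in>Basis. f b (x \<bullet> b))) = (\<Prod>b\<in>Basis. LINT t|lborel. f b t)"
    and "integrable lborel (\<lambda>x. \<Prod>b\<in>Basis. f b (x \<bullet> b))"
proof -
  interpret product_sigma_finite "\<lambda>b::'a. lborel :: real measure" by standard
  have [measurable]: "f b \<in> borel_measurable borel" if "b \<in> Basis" for b using f[OF that] by auto
  have eq: "(\<Sum>a\<in>Basis. g a *\<^sub>R a) \<bullet> b = g b" if "b \<in> Basis" for b :: 'a and g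
    using that by simp
  have int: "integrable (\<Pi>\<^sub>M b\<in>Basis. lborel) (\<lambda>g. \<Prod>b\<in>Basis. f b (g b))"
    using product_integrable_prod[of "Basis :: 'a set" f] f by simp
  show "integrable lborel (\<lambda>x. \<Prod>b\<in>Basis. f b (x \<bullet> b))"
    by (subst lborel_eq, subst integrable_distr_eq) (auto simp: int eq cong: prod.cong)
  show "(LINT x|lborel. (\<Prod>b\<in>Basis. f b (x \<bullet> b))) = (\<Prod>b\<in>Basis. LINT t|lborel. f b t)"
    using product_integral_prod[of "Basis :: 'a set" f] f
    by (subst lborel_eq, subst integral_distr) (auto simp: eq cong: prod.cong)
qed

text \<open>Each 1 + (x \<bullet> b)^2 is at most 1 + x \<bullet> x, so the function is dominated by
  a product of one-dimensional integrable functions.\<close>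

lemma integrable_inverse_power_one_plus_inner:
  "integrable lborel (\<lambda>x::'a::euclidean_space. 1 / (1 + x \<bullet> x) ^ DIM('a))"
proof (rule Bochner_Integration.integrable_bound)
  let ?f = "\<lambda>(b::'a) (t::real). complex_of_real (inverse (1 + t\<^sup>2))"
  show "integrable lborel (\<lambda>x::'a. \<Prod>b\<in>Basis. ?f b (x \<bullet> b))"
    by (rule integral_lborel_prod_Basis) (intro integrable_of_real integrable_inverse_one_plus_square)
  show "AE x in lborel. norm (1 / (1 + x \<bullet> x) ^ DIM('a)) \<le> norm (\<Prod>b\<in>Basis. ?f b ((x::'a) \<bullet> b))"
  proof (rule AE_I2)
    fix x :: 'a
    have pos: "1 + x \<bullet> x > 0" using inner_ge_zero[of x] by linarith
    have "(\<Prod>b\<in>Basis. 1 + (x \<bullet> b)\<^sup>2) \<le> (\<Prod>b\<in>(Basis::'a set). 1 + x \<bullet> x)"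
    proof (intro prod_mono conjI)
      fix b :: 'a assume b: "b \<in> Basis"
      have "(x \<bullet> b)\<^sup>2 \<le> (norm x)\<^sup>2"
        using Basis_le_norm[OF b, of x] by (metis abs_ge_zero power2_abs power_mono)
      then show "1 + (x \<bullet> b)\<^sup>2 \<le> 1 + x \<bullet> x" by (simp add: power2_norm_eq_inner)
    qed (auto intro: add_nonneg_nonneg)
    also have "\<dots> = (1 + x \<bullet> x) ^ DIM('a)" by simp
    finally have le: "(\<Prod>b\<in>Basis. 1 + (x \<bullet> b)\<^sup>2) \<le> (1 + x \<bullet> x) ^ DIM('a)" .
    have "(\<Prod>b\<in>Basis. 1 + (x \<bullet> b)\<^sup>2) > 0" by (intro prod_pos) (auto intro: add_pos_nonneg)
    moreover have "norm (\<Prod>b\<in>Basis. ?f b (x \<bullet> b)) = 1 / (\<Prod>b\<in>Basis. 1 + (x \<bullet> b)\<^sup>2)"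
    proof -
      have "norm (?f b (x \<bullet> b)) = inverse (1 + (x \<bullet> b)\<^sup>2)" for b
        unfolding norm_of_real by (intro abs_of_nonneg) (simp add: add_nonneg_nonneg)
      then show ?thesis
        unfolding prod_norm[symmetric] by (simp add: prod_inversef[symmetric] divide_inverse)
    qed
    ultimately show "norm (1 / (1 + x \<bullet> x) ^ DIM('a)) \<le> norm (\<Prod>b\<in>Basis. ?f b (x \<bullet> b))"
      using pos le by (simp add: frac_le)
  qed
qed simp


lemma lborel_integral_affine:
  fixes f :: "'a::euclidean_space \<Rightarrow> complex"
  assumes c: "c \<noteq> 0" and [measurable]: "f \<in> borel_measurable borel"
  shows "(LINT x|lborel. f x) = \<bar>c\<bar> ^ DIM('a) *\<^sub>R (LINT x|lborel. f (t + c *\<^sub>R x))"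
  by (subst lborel_affine[OF c, of t], subst integral_density) (auto simp: integral_distr)

lemma continuous_imp_borel_measurable_pair:
  fixes k :: "'a::second_countable_topology \<times> 'b::second_countable_topology \<Rightarrow> 'c::topological_space"
  assumes "continuous_on UNIV k" "sets M1 = sets borel" "sets M2 = sets borel"
  shows "k \<in> borel_measurable (M1 \<Otimes>\<^sub>M M2)"
proof -
  have "sets (M1 \<Otimes>\<^sub>M M2) = sets (borel :: ('a \<times> 'b) measure)"
    unfolding sets_pair_measure_cong[OF assms(2,3)] borel_prod ..
  then show ?thesis
    by (subst measurable_cong_sets[OF _ refl]) (auto intro: borel_measurable_continuous_onI[OF assms(1)])
qed

lemma integrable_product_bounded:
  fixes f :: "'a \<Rightarrow> complex" and g :: "'b \<Rightarrow> complex" and k :: "'a \<Rightarrow> 'b \<Rightarrow> complex"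
  assumes "sigma_finite_measure M1" "sigma_finite_measure M2"
    and f: "integrable M1 f" and g: "integrable M2 g"
    and k[measurable]: "(\<lambda>(x, y). k x y) \<in> borel_measurable (M1 \<Otimes>\<^sub>M M2)"
    and bound: "\<And>x y. norm (k x y) \<le> 1"
  shows "integrable (M1 \<Otimes>\<^sub>M M2) (\<lambda>(x, y). f x * g y * k x y)"
proof -
  interpret M1: sigma_finite_measure M1 by fact
  interpret M2: sigma_finite_measure M2 by fact
  have [measurable]: "f \<in> borel_measurable M1" "g \<in> borel_measurable M2" using f g by auto
  show ?thesis
  proof (rule integrableI_bounded)
    show "(\<lambda>(x, y). f x * g y * k x y) \<in> borel_measurable (M1 \<Otimes>\<^sub>M M2)"
      using k by (auto simp: case_prod_beta intro!: borel_measurable_times)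
    have "(\<integral>\<^sup>+p. norm (case p of (x, y) \<Rightarrow> f x * g y * k x y) \<partial>(M1 \<Otimes>\<^sub>M M2)) \<le>
          (\<integral>\<^sup>+p. ennreal (norm (f (fst p))) * ennreal (norm (g (snd p))) \<partial>(M1 \<Otimes>\<^sub>M M2))"
      using bound by (intro nn_integral_mono)
        (auto simp: norm_mult ennreal_mult[symmetric] intro!: ennreal_leI mult_left_le mult_nonneg_nonneg)
    also have "\<dots> = (\<integral>\<^sup>+x. (\<integral>\<^sup>+y. ennreal (norm (f x)) * ennreal (norm (g y)) \<partial>M2) \<partial>M1)"
      by (subst M2.nn_integral_fst[symmetric]) auto
    also have "\<dots> = (\<integral>\<^sup>+x. norm (f x) \<partial>M1) * (\<integral>\<^sup>+y. norm (g y) \<partial>M2)"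
      by (simp add: nn_integral_cmult nn_integral_multc)
    also have "\<dots> < \<infinity>"
      using f g by (simp add: integrable_iff_bounded ennreal_mult_less_top)
    finally show "(\<integral>\<^sup>+p. norm (case p of (x, y) \<Rightarrow> f x * g y * k x y) \<partial>(M1 \<Otimes>\<^sub>M M2)) < \<infinity>" .
  qed
qed

text \<open>The pattern of every interchange below: two integrable factors coupled by a continuous
  kernel of modulus at most 1, such as a character.\<close>

lemma Fubini_product_bounded:
  fixes f :: "'a \<Rightarrow> complex" and g :: "'b \<Rightarrow> complex" and k :: "'a \<Rightarrow> 'b \<Rightarrow> complex"
  assumes "sigma_finite_measure M1" "sigma_finite_measure M2"
    and f: "integrable M1 f" and g: "integrable M2 g"
    and k: "(\<lambda>(x, y). k x y) \<in> borel_measurable (M1 \<Otimes>\<^sub>M M2)"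
    and bound: "\<And>x y. norm (k x y) \<le> 1"
  shows "(LINT x|M1. f x * (LINT y|M2. g y * k x y)) = (LINT y|M2. g y * (LINT x|M1. f x * k x y))"
proof -
  interpret M1: sigma_finite_measure M1 by fact
  interpret M2: sigma_finite_measure M2 by fact
  interpret pair_sigma_finite M1 M2 ..
  note int = integrable_product_bounded[OF assms]
  have "(LINT x|M1. f x * (LINT y|M2. g y * k x y)) = (LINT x|M1. LINT y|M2. f x * g y * k x y)"
    by (simp add: mult.assoc)
  also have "\<dots> = (LINT y|M2. LINT x|M1. f x * g y * k x y)"
    using Fubini_integral[OF int] by simp
  also have "\<dots> = (LINT y|M2. g y * (LINT x|M1. f x * k x y))"
    by (simp add: mult.assoc mult.left_commute[of _ "g _"])
  finally show ?thesis .
qed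

subsection \<open>Rapidly decreasing functions and their Fourier integrals\<close>

text \<open>The bounds are required almost everywhere only, because the quotient by the symbol can
  be controlled only off a null set.\<close>

definition rapidly_decreasing :: "(real^'n \<Rightarrow> complex) \<Rightarrow> bool" where
  "rapidly_decreasing G \<longleftrightarrow> G \<in> borel_measurable borel \<and>
     (\<forall>N. \<exists>C. AE \<xi> in lborel. norm (G \<xi>) * (1 + \<xi> \<bullet> \<xi>) ^ N \<le> C)"

text \<open>The inverse Fourier transform without its factor (2 pi)^(-n); that factor is later put
  into the spectrum.\<close>

definition fourier_integral :: "(real^'n \<Rightarrow> complex) \<Rightarrow> real^'n \<Rightarrow> complex" where
  "fourier_integral G x = (LINT \<xi>|lborel. G \<xi> * cis (x \<bullet> \<xi>))"

lemma one_plus_inner_power_pos [simp]: "0 < (1 + \<xi> \<bullet> (\<xi>::'a::real_inner)) ^ N"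
  by (intro zero_less_power add_pos_nonneg) auto

lemma rapidly_decreasing_measurable: "rapidly_decreasing G \<Longrightarrow> G \<in> borel_measurable borel"
  by (simp add: rapidly_decreasing_def)

lemma rapidly_decreasing_mult:
  assumes G: "rapidly_decreasing G" and p[measurable]: "p \<in> borel_measurable borel"
    and bound: "\<And>\<xi>. norm (p \<xi>) \<le> K * (1 + \<xi> \<bullet> \<xi>) ^ M"
  shows "rapidly_decreasing (\<lambda>\<xi>. G \<xi> * p \<xi>)"
  unfolding rapidly_decreasing_def
proof (intro conjI allI)
  have [measurable]: "G \<in> borel_measurable borel" using G by (rule rapidly_decreasing_measurable)
  show "(\<lambda>\<xi>. G \<xi> * p \<xi>) \<in> borel_measurable borel" by measurable
  have K: "K \<ge> 0"
    using bound[of 0] norm_ge_zero[of "p 0"] by (simp del: norm_ge_zero)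
  fix N
  obtain C where C: "AE \<xi> in lborel. norm (G \<xi>) * (1 + \<xi> \<bullet> \<xi>) ^ (N + M) \<le> C"
    using G unfolding rapidly_decreasing_def by blast
  have "AE \<xi> in lborel. norm (G \<xi> * p \<xi>) * (1 + \<xi> \<bullet> \<xi>) ^ N \<le> K * C"
    using C
  proof eventually_elim
    case (elim \<xi>)
    have "norm (G \<xi> * p \<xi>) * (1 + \<xi> \<bullet> \<xi>) ^ N \<le> norm (G \<xi>) * (K * (1 + \<xi> \<bullet> \<xi>) ^ M) * (1 + \<xi> \<bullet> \<xi>) ^ N"
      unfolding norm_mult by (intro mult_right_mono mult_left_mono bound) auto
    also have "\<dots> = K * (norm (G \<xi>) * (1 + \<xi> \<bullet> \<xi>) ^ (N + M))" by (simp add: power_add mult_ac)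
    also have "\<dots> \<le> K * C" using elim K by (rule mult_left_mono)
    finally show ?case .
  qed
  then show "\<exists>C. AE \<xi> in lborel. norm (G \<xi> * p \<xi>) * (1 + \<xi> \<bullet> \<xi>) ^ N \<le> C" by blast
qed

lemma rapidly_decreasing_integrable:
  assumes "rapidly_decreasing (G :: real^'n \<Rightarrow> complex)"
  shows "integrable lborel G"
proof -
  have [measurable]: "G \<in> borel_measurable borel" using assms by (rule rapidly_decreasing_measurable)
  obtain C where C: "AE \<xi> in lborel. norm (G \<xi>) * (1 + \<xi> \<bullet> \<xi>) ^ DIM(real^'n) \<le> C"
    using assms unfolding rapidly_decreasing_def by blast
  show ?thesis
  proof (rule Bochner_Integration.integrable_bound)
    show "integrable lborel (\<lambda>\<xi>::real^'n. C * (1 / (1 + \<xi> \<bullet> \<xi>) ^ DIM(real^'n)))"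
      by (intro integrable_mult_right integrable_inverse_power_one_plus_inner)
    show "AE \<xi> in lborel. norm (G \<xi>) \<le> norm (C * (1 / (1 + \<xi> \<bullet> \<xi>) ^ DIM(real^'n)))"
      using C
    proof eventually_elim
      case (elim \<xi>)
      then have "norm (G \<xi>) \<le> C * (1 / (1 + \<xi> \<bullet> \<xi>) ^ DIM(real^'n))"
        using one_plus_inner_power_pos[of \<xi> "DIM(real^'n)"] by (simp add: pos_le_divide_eq)
      then show ?case unfolding real_norm_def by linarith
    qed
  qed simp
qed

lemma integrable_mult_cis:
  fixes G :: "'a::euclidean_space \<Rightarrow> complex"
  assumes "integrable lborel G"
  shows "integrable lborel (\<lambda>\<xi>. G \<xi> * cis (x \<bullet> \<xi>))"
proof (rule Bochner_Integration.integrable_bound[OF assms])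
  have [measurable]: "G \<in> borel_measurable borel" using assms by auto
  have [measurable]: "(\<lambda>\<xi>. cis (x \<bullet> \<xi>)) \<in> borel_measurable borel"
    by (intro borel_measurable_continuous_onI continuous_intros)
  show "(\<lambda>\<xi>. G \<xi> * cis (x \<bullet> \<xi>)) \<in> borel_measurable lborel" by simp
qed (simp add: norm_mult)

text \<open>A Cauchy-Schwarz bound brought into the polynomial weights in which rapid decrease is
  measured.\<close>

lemma abs_inner_le: "\<bar>h \<bullet> \<xi>\<bar> \<le> norm h * (1 + \<xi> \<bullet> (\<xi>::'a::real_inner))"
proof -
  have "\<bar>h \<bullet> \<xi>\<bar> \<le> norm h * norm \<xi>" by (rule Cauchy_Schwarz_ineq2)
  also have "norm \<xi> \<le> 1 + (norm \<xi>)\<^sup>2"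
    using sum_squares_bound[of "norm \<xi>" 1] norm_ge_zero[of \<xi>] by (simp del: norm_ge_zero)
  then have "norm h * norm \<xi> \<le> norm h * (1 + \<xi> \<bullet> \<xi>)"
    by (intro mult_left_mono) (auto simp: power2_norm_eq_inner)
  finally show ?thesis .
qed

lemma norm_cis_remainder: "norm (cis t - 1 - \<i> * of_real t) \<le> t\<^sup>2"
proof -
  have "norm (iexp t - (\<Sum>k\<le>1. (\<i> * t)^k / fact k)) \<le> \<bar>t\<bar> ^ Suc 1 / fact (Suc 1)"
    by (rule iexp_approx1)
  then have "2 * norm (cis t - 1 - \<i> * of_real t) \<le> t\<^sup>2"
    by (simp add: cis_conv_exp power2_eq_square algebra_simps)
  then show ?thesis using norm_ge_zero[of "cis t - 1 - \<i> * of_real t"] by linarith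
qed

lemma has_derivative_fourier_integral:
  fixes G :: "real^'n \<Rightarrow> complex"
  assumes G: "rapidly_decreasing G"
  shows "(fourier_integral G has_derivative
           (\<lambda>h. LINT \<xi>|lborel. G \<xi> * (\<i> * of_real (h \<bullet> \<xi>)) * cis (x \<bullet> \<xi>))) (at x)"
proof -
  have [measurable]: "G \<in> borel_measurable borel" using G by (rule rapidly_decreasing_measurable)
  have G1: "rapidly_decreasing (\<lambda>\<xi>. G \<xi> * (\<i> * of_real (h \<bullet> \<xi>)))" for h :: "real^'n"
    by (rule rapidly_decreasing_mult[OF G, where M=1 and K="norm h"])
       (auto simp: norm_mult intro!: abs_inner_le)
  have Gm: "integrable lborel (\<lambda>\<xi>. norm (G \<xi> * of_real ((1 + \<xi> \<bullet> \<xi>) ^ M)))" for M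
  proof (intro integrable_norm rapidly_decreasing_integrable rapidly_decreasing_mult[OF G, where M=M and K=1])
    show "norm (complex_of_real ((1 + \<xi> \<bullet> \<xi>) ^ M)) \<le> 1 * (1 + \<xi> \<bullet> \<xi>) ^ M" for \<xi> :: "real^'n"
      unfolding norm_of_real using one_plus_inner_power_pos[of \<xi> M] by simp
  qed measurable
  show ?thesis
    unfolding fourier_integral_def
  proof (rule has_derivative_integral[where B = "\<lambda>\<xi>. norm (G \<xi> * of_real ((1 + \<xi> \<bullet> \<xi>) ^ 1))"
        and K = "\<lambda>\<xi>. norm (G \<xi> * of_real ((1 + \<xi> \<bullet> \<xi>) ^ 2))"])
    show "integrable lborel (\<lambda>y. G y * cis ((x + h) \<bullet> y))" for h
      by (intro integrable_mult_cis rapidly_decreasing_integrable G)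
    show "integrable lborel (\<lambda>y. G y * (\<i> * of_real (h \<bullet> y)) * cis (x \<bullet> y))" for h
      by (intro integrable_mult_cis rapidly_decreasing_integrable G1)
    show "linear (\<lambda>h. G y * (\<i> * complex_of_real (h \<bullet> y)) * cis (x \<bullet> y))" for y
      by (rule linearI) (auto simp: inner_add_left algebra_simps, simp add: scaleR_conv_of_real[where 'a = complex])
    show "AE y in lborel. norm (G y * (\<i> * of_real (h \<bullet> y)) * cis (x \<bullet> y)) \<le> norm h * norm (G y * of_real ((1 + y \<bullet> y) ^ 1))" for h
    proof (rule AE_I2)
      fix y :: "real^'n"
      have "norm (G y) * \<bar>h \<bullet> y\<bar> \<le> norm (G y) * (norm h * (1 + y \<bullet> y))"
        by (intro mult_left_mono abs_inner_le) auto
      then show "norm (G y * (\<i> * of_real (h \<bullet> y)) * cis (x \<bullet> y)) \<le> norm h * norm (G y * of_real ((1 + y \<bullet> y) ^ 1))"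
        by (simp add: norm_mult mult_ac del: of_real_add)
    qed
    show "AE y in lborel. norm (G y * cis ((x + h) \<bullet> y) - G y * cis (x \<bullet> y) - G y * (\<i> * of_real (h \<bullet> y)) * cis (x \<bullet> y))
       \<le> (norm h)\<^sup>2 * norm (G y * of_real ((1 + y \<bullet> y)\<^sup>2))" for h
    proof (rule AE_I2)
      fix y :: "real^'n"
      have "G y * cis ((x + h) \<bullet> y) - G y * cis (x \<bullet> y) - G y * (\<i> * of_real (h \<bullet> y)) * cis (x \<bullet> y)
         = G y * cis (x \<bullet> y) * (cis (h \<bullet> y) - 1 - \<i> * of_real (h \<bullet> y))"
        by (simp add: inner_add_left cis_mult[symmetric] algebra_simps)
      also have "norm \<dots> = norm (G y) * norm (cis (h \<bullet> y) - 1 - \<i> * of_real (h \<bullet> y))"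
        by (simp add: norm_mult)
      also have "\<dots> \<le> norm (G y) * (h \<bullet> y)\<^sup>2"
        by (intro mult_left_mono norm_cis_remainder) auto
      also have "(h \<bullet> y)\<^sup>2 \<le> (norm h * (1 + y \<bullet> y))\<^sup>2"
        using abs_inner_le[of h y] by (intro power2_le_iff_abs_le[THEN iffD2]) auto
      then have "norm (G y) * (h \<bullet> y)\<^sup>2 \<le> norm (G y) * (norm h * (1 + y \<bullet> y))\<^sup>2"
        by (rule mult_left_mono) auto
      also have "\<dots> = (norm h)\<^sup>2 * norm (G y * of_real ((1 + y \<bullet> y)\<^sup>2))"
        by (simp add: norm_mult power_mult_distrib mult_ac del: of_real_add of_real_power)
      finally show "norm (G y * cis ((x + h) \<bullet> y) - G y * cis (x \<bullet> y) - G y * (\<i> * of_real (h \<bullet> y)) * cis (x \<bullet> y))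
       \<le> (norm h)\<^sup>2 * norm (G y * of_real ((1 + y \<bullet> y)\<^sup>2))" .
    qed
  qed (use Gm[of 1] Gm[of 2] in simp_all)
qed

text \<open>A partial derivative multiplies the spectrum by a linear function, which keeps it
  rapidly decreasing, so the induction must range over all such spectra.\<close>

lemma C_k_fourier_integral:
  fixes G :: "real^'n \<Rightarrow> complex"
  assumes "rapidly_decreasing G"
  shows "C_k k (fourier_integral G)"
  using assms
proof (induction k arbitrary: G)
  case 0
  have "isCont (fourier_integral G) x" for x
    by (rule has_derivative_continuous[OF has_derivative_fourier_integral[OF 0]])
  then show ?case by (simp add: continuous_on_eq_continuous_at)
next
  case (Suc k)
  have [measurable]: "G \<in> borel_measurable borel" using Suc.prems by (rule rapidly_decreasing_measurable)
  have "frechet_derivative (fourier_integral G) (at x) (axis i 1)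
      = fourier_integral (\<lambda>\<xi>. G \<xi> * (\<i> * of_real (axis i 1 \<bullet> \<xi>))) x" for i x
    unfolding frechet_derivative_at[OF has_derivative_fourier_integral[OF Suc.prems, of x], symmetric]
      fourier_integral_def ..
  moreover have "rapidly_decreasing (\<lambda>\<xi>. G \<xi> * (\<i> * of_real (axis i 1 \<bullet> \<xi>)))" for i :: 'n
    by (rule rapidly_decreasing_mult[OF Suc.prems, where M=1 and K="norm (axis i 1 :: real^'n)"])
       (auto simp: norm_mult intro!: order_trans[OF abs_inner_le])
  ultimately show ?case
    using Suc.IH has_derivative_fourier_integral[OF Suc.prems]
    by (simp only: C_k.simps differentiable_def) blast
qed

lemma fourier_integral_in_C_infinity: "rapidly_decreasing G \<Longrightarrow> fourier_integral G \<in> C_infinity"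
  by (simp add: C_infinity_def C_k_fourier_integral)

subsection \<open>Fourier inversion\<close>

definition gaussian :: "'a::euclidean_space \<Rightarrow> real" where
  "gaussian x = exp (- (x \<bullet> x) / 2)"

lemma continuous_on_gaussian: "continuous_on A gaussian"
  unfolding gaussian_def by (intro continuous_intros) auto

lemma gaussian_measurable [measurable]: "gaussian \<in> borel_measurable borel"
  by (intro borel_measurable_continuous_onI continuous_on_gaussian)

text \<open>Read off from the characteristic function of the standard normal distribution.\<close>

lemma gaussian_real_fourier:
  "integrable lborel (\<lambda>t::real. complex_of_real (exp (- t\<^sup>2 / 2)) * cis (s * t))"
  "(LINT t|lborel. complex_of_real (exp (- t\<^sup>2 / 2)) * cis (s * t)) = of_real (sqrt (2 * pi) * exp (- s\<^sup>2 / 2))"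
proof -
  have eq: "complex_of_real (exp (- t\<^sup>2 / 2)) * cis (s * t) =
      of_real (sqrt (2 * pi)) * (std_normal_density t *\<^sub>R iexp (s * t))" for t :: real
    by (simp add: std_normal_density_def cis_conv_exp scaleR_conv_of_real)
  have int: "integrable lborel (\<lambda>t. std_normal_density t *\<^sub>R iexp (s * t))"
  proof (rule Bochner_Integration.integrable_bound)
    show "integrable lborel std_normal_density" by simp
  qed (auto simp: norm_mult)
  show "integrable lborel (\<lambda>t::real. complex_of_real (exp (- t\<^sup>2 / 2)) * cis (s * t))"
    unfolding eq by (intro integrable_mult_right int)
  have "(LINT t|lborel. std_normal_density t *\<^sub>R iexp (s * t)) = char std_normal_distribution s"
    unfolding char_def by (subst integral_density) auto
  then show "(LINT t|lborel. complex_of_real (exp (- t\<^sup>2 / 2)) * cis (s * t)) = of_real (sqrt (2 * pi) * exp (- s\<^sup>2 / 2))"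
    unfolding eq integral_mult_right_zero by (simp only: char_std_normal_distribution of_real_mult)
qed

lemma cis_sum: "cis (\<Sum>i\<in>A. f i) = (\<Prod>i\<in>A. cis (f i))"
  by (induction A rule: infinite_finite_induct) (auto simp: cis_mult[symmetric])

lemma gaussian_fourier:
  fixes z :: "'a::euclidean_space"
  shows "integrable lborel (\<lambda>\<xi>. complex_of_real (gaussian \<xi>) * cis (z \<bullet> \<xi>))"
    and "(LINT \<xi>|lborel. complex_of_real (gaussian \<xi>) * cis (z \<bullet> \<xi>)) = of_real (sqrt (2 * pi) ^ DIM('a) * gaussian z)"
proof -
  have gprod: "gaussian x = (\<Prod>b\<in>Basis. exp (- (x \<bullet> b)\<^sup>2 / 2))" for x :: 'a
  proof -
    have "- (x \<bullet> x) / 2 = (\<Sum>b\<in>Basis. - (x \<bullet> b)\<^sup>2 / 2)"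
      by (subst euclidean_inner) (simp add: power2_eq_square sum_negf sum_divide_distrib)
    then show ?thesis unfolding gaussian_def by (simp add: exp_sum)
  qed
  have eq: "complex_of_real (gaussian \<xi>) * cis (z \<bullet> \<xi>) =
     (\<Prod>b\<in>Basis. complex_of_real (exp (- (\<xi> \<bullet> b)\<^sup>2 / 2)) * cis ((z \<bullet> b) * (\<xi> \<bullet> b)))" for \<xi>
    unfolding gprod prod.distrib by (subst euclidean_inner) (simp add: cis_sum)
  show "integrable lborel (\<lambda>\<xi>. complex_of_real (gaussian \<xi>) * cis (z \<bullet> \<xi>))"
    unfolding eq by (rule integral_lborel_prod_Basis(2)) (rule gaussian_real_fourier)
  have "(LINT \<xi>|lborel. complex_of_real (gaussian \<xi>) * cis (z \<bullet> \<xi>)) =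
     (\<Prod>b\<in>Basis. LINT t|lborel. complex_of_real (exp (- t\<^sup>2 / 2)) * cis ((z \<bullet> b) * t))"
    unfolding eq by (rule integral_lborel_prod_Basis(1)) (rule gaussian_real_fourier)
  also have "\<dots> = of_real (sqrt (2 * pi) ^ DIM('a) * gaussian z)"
    unfolding gaussian_real_fourier(2) gprod by (simp add: prod.distrib)
  finally show "(LINT \<xi>|lborel. complex_of_real (gaussian \<xi>) * cis (z \<bullet> \<xi>)) = of_real (sqrt (2 * pi) ^ DIM('a) * gaussian z)" .
qed

text \<open>Gaussian summability. Damping \<open>What\<close> by a dilated Gaussian makes Fubini
  applicable and moves the Fourier integral onto the Gaussian. As the dilation tends to 0, dominated
  convergence gives the Fourier integral of \<open>What\<close> on one side and, after the
  substitution y = x + e k s, a multiple of w x on the other.\<close>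

theorem fourier_inversion:
  fixes w :: "real^'n \<Rightarrow> complex"
  assumes cont: "continuous_on UNIV w" and int: "integrable lborel w" and bound: "\<And>x. norm (w x) \<le> B"
    and What: "\<And>\<xi>. What \<xi> = (LINT x|lborel. w x * cis (- (x \<bullet> \<xi>)))" and int_hat: "integrable lborel What"
  shows "fourier_integral What x = of_real ((2 * pi) ^ CARD('n)) * w x"
proof -
  define e :: "nat \<Rightarrow> real" where "e = (\<lambda>k. 1 / real (Suc k))"
  have e0: "e k > 0" for k by (simp add: e_def)
  have elim: "e \<longlonglongrightarrow> 0" unfolding e_def by real_asymp
  define d where "d = DIM(real^'n)"
  have [measurable]: "w \<in> borel_measurable borel" "What \<in> borel_measurable borel"
    using int int_hat by auto
  have [measurable]: "(\<lambda>\<xi>. cis (x \<bullet> \<xi>)) \<in> borel_measurable borel" for x :: "real^'n"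
    by (intro borel_measurable_continuous_onI continuous_intros)
  have gl: "(\<lambda>k. gaussian (e k *\<^sub>R y)) \<longlonglongrightarrow> 1" for y :: "real^'n"
  proof -
    have "(\<lambda>k. gaussian (e k *\<^sub>R y)) \<longlonglongrightarrow> gaussian (0 *\<^sub>R y)"
      using continuous_on_gaussian[of UNIV]
      by (intro isCont_tendsto_compose[where g = gaussian] tendsto_intros elim) (auto simp: continuous_on_eq_continuous_at)
    then show ?thesis by (simp add: gaussian_def)
  qed
  have gle: "gaussian y \<le> 1" "gaussian y \<ge> 0" for y :: "real^'n"
    by (auto simp: gaussian_def)
  have scaled: "integrable lborel (\<lambda>\<xi>::real^'n. complex_of_real (gaussian (e k *\<^sub>R \<xi>)))"
    "(LINT \<xi>|lborel. complex_of_real (gaussian (e k *\<^sub>R \<xi>)) * cis (z \<bullet> \<xi>)) = of_real ((sqrt (2 * pi) / e k) ^ d * gaussian (z /\<^sub>R e k))"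
    for k and z :: "real^'n"
  proof -
    have meas: "(\<lambda>\<xi>. complex_of_real (gaussian \<xi>) * cis ((z /\<^sub>R e k) \<bullet> \<xi>)) \<in> borel_measurable borel" by measurable
    have nz: "e k \<noteq> 0" using e0[of k] by simp
    have inv: "(z /\<^sub>R e k) \<bullet> (0 + e k *\<^sub>R \<xi>) = z \<bullet> \<xi>" for \<xi>
      using e0[of k] by simp
    have "complex_of_real (sqrt (2 * pi) ^ d * gaussian (z /\<^sub>R e k)) =
      \<bar>e k\<bar> ^ d *\<^sub>R (LINT \<xi>|lborel. complex_of_real (gaussian (0 + e k *\<^sub>R \<xi>)) * cis (z \<bullet> \<xi>))"
      using lborel_integral_affine[OF nz meas, of 0]
      unfolding gaussian_fourier inv d_def .
    then show "(LINT \<xi>|lborel. complex_of_real (gaussian (e k *\<^sub>R \<xi>)) * cis (z \<bullet> \<xi>)) = of_real ((sqrt (2 * pi) / e k) ^ d * gaussian (z /\<^sub>R e k))"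
      using e0[of k] by (simp add: scaleR_conv_of_real field_simps power_divide)
    have "integrable (density (distr lborel borel (\<lambda>x::real^'n. 0 + e k *\<^sub>R x)) (\<lambda>_. ennreal (\<bar>e k\<bar> ^ DIM(real^'n))))
         (\<lambda>\<xi>. complex_of_real (gaussian \<xi>))"
      using gaussian_fourier(1)[of "0::real^'n"] lborel_affine[of "e k" "0::real^'n"] e0[of k] by simp
    then have "integrable lborel (\<lambda>\<xi>::real^'n. e k ^ d *\<^sub>R complex_of_real (gaussian (e k *\<^sub>R \<xi>)))"
      using e0[of k] by (subst (asm) integrable_density) (auto simp: integrable_distr_eq d_def)
    from integrable_scaleR_right[OF this, of "inverse (e k ^ d)"]
    show "integrable lborel (\<lambda>\<xi>::real^'n. complex_of_real (gaussian (e k *\<^sub>R \<xi>)))"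
      using e0[of k] by simp
  qed
  define I where "I = (\<lambda>k. LINT \<xi>|lborel. What \<xi> * cis (x \<bullet> \<xi>) * of_real (gaussian (e k *\<^sub>R \<xi>)))"
  have lim1: "I \<longlonglongrightarrow> fourier_integral What x"
    unfolding I_def fourier_integral_def
  proof (rule integral_dominated_convergence[where w = "\<lambda>\<xi>. norm (What \<xi>)"])
    show "AE \<xi> in lborel. (\<lambda>k. What \<xi> * cis (x \<bullet> \<xi>) * of_real (gaussian (e k *\<^sub>R \<xi>))) \<longlonglongrightarrow> What \<xi> * cis (x \<bullet> \<xi>)"
    proof (rule AE_I2)
      fix \<xi> :: "real^'n"
      have "(\<lambda>k. What \<xi> * cis (x \<bullet> \<xi>) * of_real (gaussian (e k *\<^sub>R \<xi>))) \<longlonglongrightarrow> What \<xi> * cis (x \<bullet> \<xi>) * of_real 1"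
        by (intro tendsto_intros gl)
      then show "(\<lambda>k. What \<xi> * cis (x \<bullet> \<xi>) * of_real (gaussian (e k *\<^sub>R \<xi>))) \<longlonglongrightarrow> What \<xi> * cis (x \<bullet> \<xi>)" by simp
    qed
  qed (use int_hat gle in \<open>auto simp: norm_mult intro!: mult_left_le\<close>)
  have I_eq: "I k = of_real (sqrt (2 * pi) ^ d) * (LINT s|lborel. w (x + e k *\<^sub>R s) * of_real (gaussian s))" for k
  proof -
    have "I k = (LINT \<xi>|lborel. of_real (gaussian (e k *\<^sub>R \<xi>)) * (LINT y|lborel. w y * cis ((x - y) \<bullet> \<xi>)))"
      unfolding I_def
    proof (rule Bochner_Integration.integral_cong[OF refl])
      fix \<xi> :: "real^'n"
      have "What \<xi> * cis (x \<bullet> \<xi>) = (LINT y|lborel. w y * cis (- (y \<bullet> \<xi>)) * cis (x \<bullet> \<xi>))"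
        unfolding What by simp
      also have "\<dots> = (LINT y|lborel. w y * cis ((x - y) \<bullet> \<xi>))"
        by (simp add: mult.assoc cis_mult inner_diff_left)
      finally show "What \<xi> * cis (x \<bullet> \<xi>) * of_real (gaussian (e k *\<^sub>R \<xi>)) = of_real (gaussian (e k *\<^sub>R \<xi>)) * (LINT y|lborel. w y * cis ((x - y) \<bullet> \<xi>))"
        by simp
    qed
    also have "\<dots> = (LINT y|lborel. w y * (LINT \<xi>|lborel. of_real (gaussian (e k *\<^sub>R \<xi>)) * cis ((x - y) \<bullet> \<xi>)))"
    proof (rule Fubini_product_bounded)
      show "(\<lambda>(\<xi>, y). cis ((x - y) \<bullet> \<xi>)) \<in> borel_measurable (lborel \<Otimes>\<^sub>M lborel)"
        by (rule continuous_imp_borel_measurable_pair) (auto simp: case_prod_beta intro!: continuous_intros)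
    qed (use int scaled in \<open>auto intro: lborel.sigma_finite_measure_axioms\<close>)
    also have "\<dots> = (LINT y|lborel. w y * of_real ((sqrt (2 * pi) / e k) ^ d * gaussian ((x - y) /\<^sub>R e k)))"
      by (simp only: scaled)
    also have "\<dots> = e k ^ d *\<^sub>R (LINT s|lborel. w (x + e k *\<^sub>R s) * of_real ((sqrt (2 * pi) / e k) ^ d * gaussian s))"
    proof -
      have "(\<lambda>y. w y * of_real ((sqrt (2 * pi) / e k) ^ d * gaussian ((x - y) /\<^sub>R e k))) \<in> borel_measurable borel"
        by measurable
      from lborel_integral_affine[OF _ this, of "e k" x] e0[of k]
      show ?thesis by (simp add: d_def gaussian_def)
    qed
    also have "\<dots> = e k ^ d *\<^sub>R (LINT s|lborel. of_real ((sqrt (2 * pi) / e k) ^ d) * (w (x + e k *\<^sub>R s) * of_real (gaussian s)))"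
      by (simp add: mult_ac)
    also have "\<dots> = e k ^ d *\<^sub>R (of_real ((sqrt (2 * pi) / e k) ^ d) * (LINT s|lborel. w (x + e k *\<^sub>R s) * of_real (gaussian s)))"
      by (subst integral_mult_right_zero) simp
    also have "\<dots> = of_real (sqrt (2 * pi) ^ d) * (LINT s|lborel. w (x + e k *\<^sub>R s) * of_real (gaussian s))"
      using e0[of k] by (simp add: scaleR_conv_of_real power_divide)
    finally show ?thesis .
  qed
  have "(\<lambda>k. LINT s|lborel. w (x + e k *\<^sub>R s) * complex_of_real (gaussian s)) \<longlonglongrightarrow> (LINT s|lborel. w x * of_real (gaussian (s :: real^'n)))"
  proof (rule integral_dominated_convergence[where w = "\<lambda>s::real^'n. B * gaussian s"])
    have "integrable lborel (\<lambda>s::real^'n. norm (complex_of_real (gaussian s)))"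
      using gaussian_fourier(1)[of "0::real^'n"] by (intro integrable_norm) simp
    then show "integrable lborel (\<lambda>s::real^'n. B * gaussian s)"
      using gle by simp
    show "AE s in lborel. (\<lambda>k. w (x + e k *\<^sub>R s) * complex_of_real (gaussian s)) \<longlonglongrightarrow> w x * of_real (gaussian s)"
    proof (rule AE_I2)
      fix s :: "real^'n"
      have "(\<lambda>k. w (x + e k *\<^sub>R s)) \<longlonglongrightarrow> w (x + 0 *\<^sub>R s)"
        using cont by (intro isCont_tendsto_compose[where g = w] tendsto_intros elim) (auto simp: continuous_on_eq_continuous_at)
      from tendsto_mult_right[OF this, of "of_real (gaussian s)"]
      show "(\<lambda>k. w (x + e k *\<^sub>R s) * complex_of_real (gaussian s)) \<longlonglongrightarrow> w x * of_real (gaussian s)"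
        by simp
    qed
    show "AE s in lborel. norm (w (x + e k *\<^sub>R s) * complex_of_real (gaussian s)) \<le> B * gaussian s" for k
      using bound gle by (auto simp: norm_mult intro!: mult_right_mono)
  qed measurable
  then have "I \<longlonglongrightarrow> of_real (sqrt (2 * pi) ^ d) * (LINT s|lborel. w x * of_real (gaussian (s::real^'n)))"
    unfolding ext[of I, OF I_eq] by (rule tendsto_mult_left)
  then have "fourier_integral What x = of_real (sqrt (2 * pi) ^ d) * (LINT s|lborel. w x * of_real (gaussian (s::real^'n)))"
    by (rule LIMSEQ_unique[OF lim1])
  \<comment> \<open>The factor \<open>sqrt (2 * pi) ^ d\<close> occurs twice: once from the
    transform of the Gaussian and once, here, as its mass.\<close>
  also have "(LINT s|lborel. w x * of_real (gaussian (s::real^'n))) = w x * of_real (sqrt (2 * pi) ^ d)"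
    using gaussian_fourier(2)[of "0::real^'n"] by (simp add: d_def gaussian_def)
  also have "of_real (sqrt (2 * pi) ^ d) * (w x * of_real (sqrt (2 * pi) ^ d)) = of_real ((2 * pi) ^ CARD('n)) * w x"
  proof -
    have "sqrt (2 * pi) ^ d * sqrt (2 * pi) ^ d = (2 * pi) ^ CARD('n)"
      unfolding power_mult_distrib[symmetric] by (simp add: d_def)
    from this[symmetric] show ?thesis by (simp only: of_real_mult mult_ac)
  qed
  finally show ?thesis .
qed


subsection \<open>The Bessel-type function of the sphere\<close>

text \<open>\<open>sphere_moment n k\<close> is the mean of \<open>\<omega>\<^sub>i\<^bsup>2k\<^esup>\<close> over the unit sphere of \<open>\<real>\<^bsup>n\<^esup>\<close>, so that \<open>bessel n (\<bar>\<xi>\<bar>\<^sup>2)\<close> is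
  the mean of \<open>exp (- \<i> \<langle>\<omega>, \<xi>\<rangle>)\<close>.\<close>

fun sphere_moment :: "nat \<Rightarrow> nat \<Rightarrow> real" where
  "sphere_moment n 0 = 1"
| "sphere_moment n (Suc k) = sphere_moment n k * (2 * real k + 1) / (2 * real k + real n)"

definition bessel_coeff :: "nat \<Rightarrow> nat \<Rightarrow> complex" where
  "bessel_coeff n k = of_real ((- 1) ^ k * sphere_moment n k / fact (2 * k))"

text \<open>Up to a constant, \<open>bessel n (t\<^sup>2)\<close> is J(t) / t^(n/2 - 1) with J the
  Bessel function of order n/2 - 1. Taking the square as variable makes the symbol an entire
  function of \<zeta> \<cdot> \<zeta>.\<close>

definition bessel :: "nat \<Rightarrow> complex \<Rightarrow> complex" where
  "bessel n z = (\<Sum>k. bessel_coeff n k * z ^ k)"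

definition bessel' :: "nat \<Rightarrow> complex \<Rightarrow> complex" where
  "bessel' n z = (\<Sum>k. diffs (bessel_coeff n) k * z ^ k)"

definition bessel'' :: "nat \<Rightarrow> complex \<Rightarrow> complex" where
  "bessel'' n z = (\<Sum>k. diffs (diffs (bessel_coeff n)) k * z ^ k)"

lemma sphere_moment_bounds:
  assumes "n \<ge> 1" shows "0 \<le> sphere_moment n k \<and> sphere_moment n k \<le> 1"
proof (induction k)
  case (Suc k)
  have "(2 * real k + 1) / (2 * real k + real n) \<le> 1" using assms by (simp add: divide_le_eq)
  moreover have "(2 * real k + 1) / (2 * real k + real n) \<ge> 0" by simp
  ultimately have "sphere_moment n k * ((2 * real k + 1) / (2 * real k + real n)) \<le> 1 * 1"
    using Suc by (intro mult_mono) auto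
  then show ?case using Suc by simp
qed simp

lemma summable_bessel:
  assumes "n \<ge> 1" shows "summable (\<lambda>k. bessel_coeff n k * z ^ k)"
proof (rule summable_comparison_test)
  show "summable (\<lambda>k. norm z ^ k /\<^sub>R fact k)" by (rule summable_exp_generic)
  show "\<exists>N. \<forall>k\<ge>N. norm (bessel_coeff n k * z ^ k) \<le> norm z ^ k /\<^sub>R fact k"
  proof (intro exI allI impI)
    fix k
    have "norm (bessel_coeff n k) = \<bar>sphere_moment n k\<bar> / fact (2 * k)"
      by (simp add: bessel_coeff_def norm_mult norm_divide norm_power)
    also have "\<dots> \<le> 1 / fact k"
      using sphere_moment_bounds[OF assms, of k] by (intro frac_le) (auto intro: fact_mono)
    finally have "norm (bessel_coeff n k) * norm z ^ k \<le> 1 / fact k * norm z ^ k"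
      by (rule mult_right_mono) simp
    then show "norm (bessel_coeff n k * z ^ k) \<le> norm z ^ k /\<^sub>R fact k"
      by (simp add: norm_mult norm_power divide_inverse)
  qed
qed

lemma summable_bessel':
  assumes "n \<ge> 1" shows "summable (\<lambda>k. diffs (bessel_coeff n) k * z ^ k)"
  by (rule termdiff_converges_all[OF summable_bessel[OF assms]])

lemma summable_bessel'':
  assumes "n \<ge> 1" shows "summable (\<lambda>k. diffs (diffs (bessel_coeff n)) k * z ^ k)"
  by (rule termdiff_converges_all[OF summable_bessel'[OF assms]])

lemma DERIV_bessel: "n \<ge> 1 \<Longrightarrow> (bessel n has_field_derivative bessel' n z) (at z)"
  unfolding bessel_def [abs_def] bessel'_def
  by (rule termdiffs_strong_converges_everywhere) (rule summable_bessel)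

lemma DERIV_bessel': "n \<ge> 1 \<Longrightarrow> (bessel' n has_field_derivative bessel'' n z) (at z)"
  unfolding bessel'_def [abs_def] bessel''_def
  by (rule termdiffs_strong_converges_everywhere) (rule summable_bessel')

lemma bessel_0 [simp]: "bessel n 0 = 1"
  unfolding bessel_def by (subst powser_zero) (simp add: bessel_coeff_def)

lemma bessel'_0: "n \<ge> 1 \<Longrightarrow> bessel' n 0 = - 1 / (2 * of_nat n)"
  unfolding bessel'_def by (subst powser_zero) (simp add: bessel_coeff_def diffs_def)

text \<open>Bessel's equation in the squared variable. Compared coefficient by coefficient, it is
  the recursion of \<open>sphere_moment\<close>.\<close>

lemma bessel_ode:
  assumes n: "n \<ge> 1"
  shows "4 * z * bessel'' n z + 2 * of_nat n * bessel' n z + bessel n z = 0"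
proof -
  let ?c = "bessel_coeff n"
  \<comment> \<open>The series of \<open>bessel''\<close> is reindexed so that multiplication by z
    produces the same powers z^k as in the other two series.\<close>
  have "(\<lambda>k. of_nat k * diffs ?c k * z ^ (k - Suc 0)) sums bessel'' n z"
    unfolding bessel''_def by (rule diffs_equiv[OF summable_bessel''[OF n]])
  then have "(\<lambda>k. 4 * (z * (of_nat k * diffs ?c k * z ^ (k - Suc 0)))) sums (4 * (z * bessel'' n z))"
    by (intro sums_mult)
  also have "(\<lambda>k. 4 * (z * (of_nat k * diffs ?c k * z ^ (k - Suc 0)))) = (\<lambda>k. 4 * (of_nat k * diffs ?c k * z ^ k))"
  proof
    show "4 * (z * (of_nat k * diffs ?c k * z ^ (k - Suc 0))) = 4 * (of_nat k * diffs ?c k * z ^ k)" for k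
      by (cases k) (auto simp: algebra_simps)
  qed
  finally have s2: "(\<lambda>k. 4 * (of_nat k * diffs ?c k * z ^ k)) sums (4 * (z * bessel'' n z))" .
  have s1: "(\<lambda>k. 2 * of_nat n * (diffs ?c k * z ^ k)) sums (2 * of_nat n * bessel' n z)"
    unfolding bessel'_def by (intro sums_mult summable_sums summable_bessel'[OF n])
  have s0: "(\<lambda>k. ?c k * z ^ k) sums bessel n z"
    unfolding bessel_def by (intro summable_sums summable_bessel[OF n])
  have coeff: "4 * (of_nat k * diffs ?c k) + 2 * of_nat n * diffs ?c k + ?c k = 0" for k
  proof -
    have "4 * (real k * (real (Suc k) * ((- 1) ^ Suc k * sphere_moment n (Suc k) / fact (2 * Suc k))))
       + 2 * real n * (real (Suc k) * ((- 1) ^ Suc k * sphere_moment n (Suc k) / fact (2 * Suc k)))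
       + (- 1) ^ k * sphere_moment n k / fact (2 * k) = 0"
    proof -
      define F where "F = (fact (2 * k) :: real)"
      have F: "F > 0" by (simp add: F_def)
      have f2: "(fact (2 * Suc k) :: real) = (2 * real k + 2) * (2 * real k + 1) * F"
        by (simp add: F_def algebra_simps)
      define S where "S = sphere_moment n k"
      have d: "2 * real k + real n > 0" using n by simp
      have d2: "2 * real k + 1 > 0" "real k + 1 > 0" by auto
      have "real (Suc k) * (sphere_moment n (Suc k) / fact (2 * Suc k)) * (4 * real k + 2 * real n) = S / F"
      proof -
        have "real (Suc k) * (sphere_moment n (Suc k) / fact (2 * Suc k)) * (4 * real k + 2 * real n)
          = (real k + 1) * (S * (2 * real k + 1) / (2 * real k + real n) / ((2 * (real k + 1)) * (2 * real k + 1) * F)) * (2 * (2 * real k + real n))"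
          unfolding f2 by (simp add: S_def algebra_simps)
        also have "\<dots> = S / F" using d d2 F by (simp add: divide_simps) (simp add: algebra_simps)
        finally show ?thesis .
      qed
      note eq = this
      define T where "T = sphere_moment n (Suc k) / fact (2 * Suc k)"
      define e where "e = (- 1 :: real) ^ k"
      have r: "(- 1) ^ Suc k * sphere_moment n (Suc k) / fact (2 * Suc k) = - (e * T)"
        by (simp add: T_def e_def del: sphere_moment.simps fact_Suc)
      have S: "real (Suc k) * T * (4 * real k + 2 * real n) = S / F" using eq unfolding T_def .
      have r': "(- 1) ^ k * sphere_moment n k / fact (2 * k) = e * (S / F)"
        by (simp add: S_def F_def e_def)
      show ?thesis
        unfolding r r' S[symmetric] by (simp add: algebra_simps)
    qed
    then have "complex_of_real (4 * (real k * (real (Suc k) * ((- 1) ^ Suc k * sphere_moment n (Suc k) / fact (2 * Suc k))))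
       + 2 * real n * (real (Suc k) * ((- 1) ^ Suc k * sphere_moment n (Suc k) / fact (2 * Suc k)))
       + (- 1) ^ k * sphere_moment n k / fact (2 * k)) = 0" by (simp only: of_real_0)
    then show ?thesis unfolding bessel_coeff_def diffs_def of_real_add of_real_mult of_real_of_nat_eq of_real_numeral .
  qed
  have "(\<lambda>k. 4 * (of_nat k * diffs ?c k * z ^ k) + 2 * of_nat n * (diffs ?c k * z ^ k) + ?c k * z ^ k) sums
    (4 * (z * bessel'' n z) + 2 * of_nat n * bessel' n z + bessel n z)"
    by (intro sums_add s2 s1 s0)
  moreover have "4 * (of_nat k * diffs ?c k * z ^ k) + 2 * of_nat n * (diffs ?c k * z ^ k) + ?c k * z ^ k = 0" for k
  proof -
    have "4 * (of_nat k * diffs ?c k * z ^ k) + 2 * of_nat n * (diffs ?c k * z ^ k) + ?c k * z ^ k =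
       (4 * (of_nat k * diffs ?c k) + 2 * of_nat n * diffs ?c k + ?c k) * z ^ k" by (simp add: algebra_simps)
    then show ?thesis using coeff[of k] by simp
  qed
  ultimately have "(\<lambda>k. 0) sums (4 * (z * bessel'' n z) + 2 * of_nat n * bessel' n z + bessel n z)" by simp
  from sums_unique2[OF this sums_zero] show ?thesis by (simp only: mult.assoc)
qed

lemma bessel_holomorphic: "n \<ge> 1 \<Longrightarrow> bessel n holomorphic_on A"
  using DERIV_bessel[of n] by (auto simp: holomorphic_on_def field_differentiable_def intro: has_field_derivative_at_within)

lemma bessel'_holomorphic: "n \<ge> 1 \<Longrightarrow> bessel' n holomorphic_on A"
  using DERIV_bessel'[of n] by (auto simp: holomorphic_on_def field_differentiable_def intro: has_field_derivative_at_within)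

text \<open>The equation differentiated m times. Its leading coefficient 4 z is nonzero off the
  origin, so there two consecutive vanishing derivatives force the next one to vanish.\<close>

lemma higher_deriv_bessel_ode:
  assumes n: "n \<ge> 1"
  shows "4 * z * (deriv ^^ (m + 2)) (bessel n) z + (4 * of_nat m + 2 * of_nat n) * (deriv ^^ (m + 1)) (bessel n) z
    + (deriv ^^ m) (bessel n) z = 0"
proof (induction m arbitrary: z)
  case 0
  have 1: "deriv (bessel n) = bessel' n" using DERIV_imp_deriv[OF DERIV_bessel[OF n]] by auto
  have 2: "deriv (bessel' n) = bessel'' n" using DERIV_imp_deriv[OF DERIV_bessel'[OF n]] by auto
  show ?case using bessel_ode[OF n, of z] by (simp add: 1 2 numeral_2_eq_2)
next
  case (Suc m)
  define D where "D = (\<lambda>j. (deriv ^^ j) (bessel n))"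
  have D: "(D j has_field_derivative D (Suc j) z) (at z)" for j z
    unfolding D_def funpow.simps o_def
    by (rule holomorphic_derivI[where S = UNIV])
       (auto intro!: holomorphic_higher_deriv bessel_holomorphic n)
  have "((\<lambda>z. 4 * z * D (m + 2) z + (4 * of_nat m + 2 * of_nat n) * D (m + 1) z + D m z) has_field_derivative
     4 * D (m + 2) z + 4 * z * D (Suc (m + 2)) z + (4 * of_nat m + 2 * of_nat n) * D (Suc (m + 1)) z + D (Suc m) z) (at z)"
    by (auto intro!: derivative_eq_intros D)
  note deriv = this
  have "(\<lambda>z. 4 * z * D (m + 2) z + (4 * of_nat m + 2 * of_nat n) * D (m + 1) z + D m z) = (\<lambda>z. 0)"
    using Suc.IH by (auto simp: D_def)
  from DERIV_unique[OF deriv[unfolded this] DERIV_const]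
  have "4 * D (m + 2) z + 4 * z * D (Suc (m + 2)) z + (4 * of_nat m + 2 * of_nat n) * D (Suc (m + 1)) z + D (Suc m) z = 0" .
  then show ?case by (simp add: D_def algebra_simps del: funpow.simps)
qed

text \<open>At a common zero of the function and its derivative all derivatives would vanish, so
  \<open>bessel n\<close> would be identically 0, against its value 1 at the origin.\<close>

lemma bessel_zeros_simple:
  assumes n: "n \<ge> 1" and z: "z \<noteq> 0" "bessel n z = 0"
  shows "bessel' n z \<noteq> 0"
proof
  assume z': "bessel' n z = 0"
  have "(deriv ^^ m) (bessel n) z = 0 \<and> (deriv ^^ (m + 1)) (bessel n) z = 0" for m
  proof (induction m)
    case 0
    then show ?case using z z' DERIV_imp_deriv[OF DERIV_bessel[OF n]] by simp
  next
    case (Suc m)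
    then show ?case using higher_deriv_bessel_ode[OF n, of z m] z by simp
  qed
  then have "bessel n 0 = 0"
    by (intro holomorphic_fun_eq_0_on_connected[OF bessel_holomorphic[OF n] open_UNIV connected_UNIV]) auto
  then show False by simp
qed


subsection \<open>The uniform probability measure on the unit sphere\<close>

text \<open>The same radial projection of a ball as in \<open>surface_measure\<close>, normalised to
  total mass 1, so that the two are compared by a mere dilation.\<close>

definition sphere_prob :: "(real^'n) measure" where
  "sphere_prob = distr (uniform_measure lborel (ball 0 1)) borel sgn"

lemma sgn_measurable [measurable]: "(sgn :: 'a::euclidean_space \<Rightarrow> 'a) \<in> borel_measurable borel"
proof -
  have "(\<lambda>x::'a. x /\<^sub>R norm x) \<in> borel_measurable borel" by measurable
  then show ?thesis by (simp add: sgn_div_norm[abs_def])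
qed

lemma sets_sphere_prob [simp, measurable_cong]: "sets sphere_prob = sets borel"
  by (simp add: sphere_prob_def)

lemma emeasure_unit_ball:
  "emeasure lborel (ball (0::real^'n) 1) = ennreal (unit_ball_vol (real CARD('n)))"
  by (subst emeasure_ball) auto

lemma unit_ball_vol_gt_0: "unit_ball_vol (real CARD('n::finite)) > 0"
  by (rule unit_ball_vol_pos) simp

lemma unit_ball_vol_neq_0: "unit_ball_vol (real CARD('n::finite)) \<noteq> 0"
  using unit_ball_vol_gt_0[where 'n = 'n] by (rule less_imp_neq[symmetric])

lemma pred_mem_ball [measurable]:
  assumes [measurable]: "f \<in> borel_measurable M"
  shows "Measurable.pred M (\<lambda>x. f x \<in> ball (a::'a::euclidean_space) r)"
  unfolding mem_ball dist_norm by measurable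

lemma pred_mem_sphere [measurable]:
  assumes [measurable]: "f \<in> borel_measurable M"
  shows "Measurable.pred M (\<lambda>x. f x \<in> sphere (a::'a::euclidean_space) r)"
  unfolding mem_sphere dist_norm by measurable

lemma uniform_unit_ball:
  "uniform_measure lborel (ball (0::real^'n) 1) =
     density lborel (\<lambda>x. ennreal (indicator (ball 0 1) x / unit_ball_vol (real CARD('n))))"
  unfolding uniform_measure_def emeasure_unit_ball
proof (rule density_cong)
  show "AE x in lborel. indicator (ball (0::real^'n) 1) x / ennreal (unit_ball_vol (real CARD('n))) =
      ennreal (indicator (ball 0 1) x / unit_ball_vol (real CARD('n)))"
    using unit_ball_vol_gt_0[where 'n='n]
    by (intro AE_I2) (auto simp: divide_ennreal[symmetric] split: split_indicator)
qed (use unit_ball_vol_gt_0[where 'n='n] in auto)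

lemma prob_space_sphere_prob: "prob_space (sphere_prob :: (real^'n) measure)"
proof -
  have "prob_space (uniform_measure lborel (ball (0::real^'n) 1))"
    by (rule prob_space_uniform_measure)
      (use unit_ball_vol_gt_0[where 'n='n] in \<open>simp_all only: emeasure_unit_ball ennreal_eq_0_iff not_le ennreal_neq_top infinity_ennreal_def not_False_eq_True\<close>)
  then show ?thesis unfolding sphere_prob_def
    by (rule prob_space.prob_space_distr) (simp add: measurable_cong_sets[OF sets_uniform_measure refl])
qed

lemma integral_sphere_prob:
  fixes g :: "real^'n \<Rightarrow> complex"
  assumes [measurable]: "g \<in> borel_measurable borel"
  shows "(LINT \<omega>|sphere_prob. g \<omega>) =
    (LINT x|lborel. indicator (ball 0 1) x *\<^sub>R g (sgn x)) / of_real (unit_ball_vol (real CARD('n)))"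
proof -
  let ?V = "unit_ball_vol (real CARD('n))"
  have V: "?V > 0" by (rule unit_ball_vol_gt_0)
  have "(LINT \<omega>|sphere_prob. g \<omega>) = (LINT x|uniform_measure lborel (ball 0 1). g (sgn x))"
    unfolding sphere_prob_def
    by (rule integral_distr) (auto simp: measurable_cong_sets[OF sets_uniform_measure refl])
  also have "\<dots> = (LINT x|lborel. (indicator (ball 0 1) x / ?V) *\<^sub>R g (sgn x))"
    unfolding uniform_unit_ball using V by (intro integral_density) auto
  also have "\<dots> = (LINT x|lborel. (1 / ?V) *\<^sub>R (indicator (ball 0 1) x *\<^sub>R g (sgn x)))"
    by simp
  also have "\<dots> = (1 / ?V) *\<^sub>R (LINT x|lborel. indicator (ball 0 1) x *\<^sub>R g (sgn x))"
    by (rule integral_scaleR_right)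
  finally show ?thesis by (simp add: scaleR_conv_of_real)
qed

lemma AE_lborel_neq_0: "AE x in lborel. x \<noteq> (0::'a::euclidean_space)"
  by (rule AE_lborel_singleton)

lemma AE_sphere_prob: "AE \<omega> in (sphere_prob :: (real^'n) measure). norm \<omega> = 1"
proof -
  have "AE x in uniform_measure lborel (ball (0::real^'n) 1). norm (sgn x) = 1"
  proof (rule AE_uniform_measureI)
    show "AE x in lborel. x \<in> ball (0::real^'n) 1 \<longrightarrow> norm (sgn x) = 1"
      using AE_lborel_neq_0 by eventually_elim (simp add: norm_sgn)
  qed simp
  then show ?thesis
    unfolding sphere_prob_def
    by (subst AE_distr_iff) (auto simp: measurable_cong_sets[OF sets_uniform_measure refl])
qed

lemma integral_surface_measure:
  fixes g :: "real^'n \<Rightarrow> complex"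
  assumes s: "s > 0" and [measurable]: "g \<in> borel_measurable borel"
  shows "(LINT y|surface_measure 0 s. g y) =
    of_real (real CARD('n) / s * s ^ CARD('n)) * (LINT x|lborel. indicator (ball 0 1) x *\<^sub>R g (s *\<^sub>R sgn x))"
proof -
  let ?c = "real CARD('n) / s"
  have c: "?c > 0" using s by simp
  have P: "(\<lambda>y::real^'n. 0 + (s / norm (y - 0)) *\<^sub>R (y - 0)) = (\<lambda>y. s *\<^sub>R sgn y)"
    by (rule ext) (simp add: sgn_div_norm divide_inverse)
  have dens: "density lborel (\<lambda>y::real^'n. ennreal ?c * indicator (ball 0 s) y) = density lborel (\<lambda>y. ennreal (?c * indicator (ball 0 s) y))"
    using c by (intro density_cong) (auto split: split_indicator)
  have "(LINT y|surface_measure 0 s. g y) = (LINT y|lborel. (?c * indicator (ball 0 s) y) *\<^sub>R g (s *\<^sub>R sgn y))"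
    unfolding surface_measure_def P dens
  proof (subst integral_distr)
    show "(LINT x|density lborel (\<lambda>y. ennreal (?c * indicator (ball 0 s) y)). g (s *\<^sub>R sgn x)) =
      (LINT y|lborel. (?c * indicator (ball 0 s) y) *\<^sub>R g (s *\<^sub>R sgn y))"
    proof (rule integral_density)
      show "AE y in lborel. 0 \<le> ?c * indicator (ball (0::real^'n) s) y"
        using c by (intro AE_I2 mult_nonneg_nonneg) (simp_all add: less_imp_le)
    qed measurable
  qed measurable
  also have "\<dots> = (LINT y|lborel. of_real ?c * (indicator (ball 0 s) y *\<^sub>R g (s *\<^sub>R sgn y)))"
    by (simp only: scaleR_conv_of_real of_real_mult mult.assoc)
  also have "\<dots> = of_real ?c * (LINT y|lborel. indicator (ball 0 s) y *\<^sub>R g (s *\<^sub>R sgn y))"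
    by (rule integral_mult_right_zero)
  also have "(LINT y|lborel. indicator (ball 0 s) y *\<^sub>R g (s *\<^sub>R sgn y)) = s ^ CARD('n) *\<^sub>R (LINT x|lborel. indicator (ball 0 1) x *\<^sub>R g (s *\<^sub>R sgn x))"
  proof -
    have "(\<lambda>y. indicator (ball 0 s) y *\<^sub>R g (s *\<^sub>R sgn y)) \<in> borel_measurable borel" by measurable
    from lborel_integral_affine[OF _ this, of s 0] s
    have "(LINT y|lborel. indicator (ball 0 s) y *\<^sub>R g (s *\<^sub>R sgn y)) =
       s ^ CARD('n) *\<^sub>R (LINT y|lborel. indicator (ball 0 s) (s *\<^sub>R y) *\<^sub>R g (s *\<^sub>R sgn (s *\<^sub>R y)))" by simp
    also have "(\<lambda>y. indicator (ball 0 s) (s *\<^sub>R y) *\<^sub>R g (s *\<^sub>R sgn (s *\<^sub>R y))) = (\<lambda>x. indicator (ball 0 1) x *\<^sub>R g (s *\<^sub>R sgn x))"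
      using s by (intro ext) (simp add: sgn_scaleR indicator_def)
    finally show ?thesis .
  qed
  finally show ?thesis by (simp only: scaleR_conv_of_real of_real_mult mult.assoc of_real_power)
qed

text \<open>The number \<open>?k * ?V\<close> is both the total surface area and the factor between
  the two integrals, hence it cancels. From here on only \<open>sphere_prob\<close> is
  needed.\<close>

lemma sphere_delta_eq:
  fixes u :: "real^'n \<Rightarrow> complex"
  assumes s: "s > 0" and [measurable]: "u \<in> borel_measurable borel"
  shows "sphere_delta s u = (LINT \<omega>|sphere_prob. u (s *\<^sub>R \<omega>))"
proof -
  let ?V = "unit_ball_vol (real CARD('n))"
  let ?k = "real CARD('n) / s * s ^ CARD('n)"
  have V: "?V > 0" by (rule unit_ball_vol_gt_0)
  have k: "?k > 0" using s by simp
  \<comment> \<open>The radial projection leaves the centre 0 off the sphere, so the indicator of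
    the sphere equals 1 only almost everywhere.\<close>
  have AE1: "(LINT x|lborel. indicator (ball 0 1) x *\<^sub>R (indicator (sphere 0 s) (s *\<^sub>R sgn x) *\<^sub>R h (s *\<^sub>R sgn x))) =
     (LINT x|lborel. indicator (ball 0 1) x *\<^sub>R h (s *\<^sub>R sgn x))"
    if [measurable]: "h \<in> borel_measurable borel" for h :: "real^'n \<Rightarrow> complex"
  proof (rule integral_cong_AE)
    show "AE x in lborel. indicator (ball 0 1) x *\<^sub>R (indicator (sphere 0 s) (s *\<^sub>R sgn x) *\<^sub>R h (s *\<^sub>R sgn x)) =
      indicator (ball 0 1) x *\<^sub>R h (s *\<^sub>R sgn x)"
      using AE_lborel_neq_0 by eventually_elim (use s in \<open>simp add: norm_sgn indicator_def\<close>)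
  qed measurable
  have vol: "(LINT x|lborel. indicator (ball (0::real^'n) 1) x *\<^sub>R (1::complex)) = of_real ?V"
    using V by (subst integral_scaleR_left) (auto simp: measure_def emeasure_unit_ball scaleR_conv_of_real)
  have "complex_of_real (measure (surface_measure 0 s) (sphere (0::real^'n) s)) =
    (LINT y|surface_measure 0 s. indicator (sphere (0::real^'n) s) y *\<^sub>R 1)"
  proof -
    have "emeasure (surface_measure 0 s) (sphere (0::real^'n) s) < \<infinity>"
    proof -
      have "emeasure (surface_measure 0 s) (sphere (0::real^'n) s) \<le> emeasure (surface_measure 0 s) (space (surface_measure (0::real^'n) s))"
        by (rule emeasure_mono) (auto simp: surface_measure_def)
      also have "\<dots> = (\<integral>\<^sup>+y. ennreal (real CARD('n) / s) * indicator (ball (0::real^'n) s) y \<partial>lborel)"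
        unfolding surface_measure_def by (subst emeasure_distr) (auto simp: emeasure_density)
      also have "\<dots> < \<infinity>"
        using emeasure_lborel_ball_finite[of "0::real^'n" s]
        by (subst nn_integral_cmult_indicator) (auto simp: ennreal_mult_less_top)
      finally show ?thesis .
    qed
    then show ?thesis
      by (subst integral_scaleR_left)
         (auto simp: surface_measure_def scaleR_conv_of_real intro!: integrable_real_indicator)
  qed
  also have "\<dots> = of_real ?k * of_real ?V"
  proof -
    have ms: "(\<lambda>y::real^'n. indicator (sphere 0 s) y *\<^sub>R (1::complex)) \<in> borel_measurable borel" by measurable
    show ?thesis unfolding integral_surface_measure[OF s ms] AE1[OF borel_measurable_const] vol ..
  qed
  finally have m: "measure (surface_measure 0 s) (sphere (0::real^'n) s) = ?k * ?V"
    by (simp only: of_real_mult[symmetric] of_real_eq_iff)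
  have "(LINT y:sphere 0 s|surface_measure 0 s. u y) = of_real ?k * (LINT x|lborel. indicator (ball 0 1) x *\<^sub>R u (s *\<^sub>R sgn x))"
  proof -
    have ms: "(\<lambda>y. indicator (sphere 0 s) y *\<^sub>R u y) \<in> borel_measurable borel" by measurable
    show ?thesis
      unfolding set_lebesgue_integral_def integral_surface_measure[OF s ms] AE1[OF assms(2)] ..
  qed
  also have "(LINT x|lborel. indicator (ball 0 1) x *\<^sub>R u (s *\<^sub>R sgn x)) = of_real ?V * (LINT \<omega>|sphere_prob. u (s *\<^sub>R \<omega>))"
    using unit_ball_vol_neq_0[where 'n='n] by (subst integral_sphere_prob) auto
  finally have eq: "(LINT y:sphere 0 s|surface_measure 0 s. u y) = of_real ?k * (of_real ?V * (LINT \<omega>|sphere_prob. u (s *\<^sub>R \<omega>)))" .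
  have cancel: "(1 / (a * b)) *\<^sub>R (of_real a * (of_real b * z)) = z" if "a \<noteq> 0" "b \<noteq> 0" for a b :: real and z :: complex
    using that by (simp add: scaleR_conv_of_real)
  show ?thesis
    unfolding sphere_delta_def spherical_mean_def m eq
    by (rule cancel) (use k V in \<open>simp_all only: less_imp_neq[symmetric] not_False_eq_True\<close>)
qed

text \<open>For a unit vector e, the reflection in the hyperplane orthogonal to e. Reflections take
  the place of rotations: a single one carries a given vector to any other vector of the same
  norm.\<close>

definition reflection :: "'a::real_inner \<Rightarrow> 'a \<Rightarrow> 'a" where
  "reflection e x = x - (2 * (x \<bullet> e)) *\<^sub>R e"

lemma reflection_measurable [measurable]: "reflection (e::'a::euclidean_space) \<in> borel_measurable borel"
  unfolding reflection_def[abs_def] by measurable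

lemma reflection_inner_commute: "reflection e x \<bullet> y = x \<bullet> reflection e y"
  by (simp add: reflection_def inner_diff_left inner_diff_right inner_commute)

lemma reflection_scaleR: "reflection e (c *\<^sub>R x) = c *\<^sub>R reflection e x"
  by (simp add: reflection_def algebra_simps)

lemma reflection_invol: "e \<bullet> e = 1 \<Longrightarrow> reflection e (reflection e x) = x"
  by (simp add: reflection_def inner_diff_left algebra_simps)

lemma norm_reflection: "e \<bullet> e = 1 \<Longrightarrow> norm (reflection e x) = norm x"
  unfolding norm_eq_sqrt_inner reflection_inner_commute by (simp add: reflection_invol)

text \<open>A line parallel to e is mapped to itself by a \<mapsto> - 2 (x \<bullet> e) - a, which
  preserves Lebesgue measure on the line; disintegration along these lines gives the claim.\<close>

lemma lborel_distr_reflection: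
  fixes e :: "'a::euclidean_space"
  assumes e: "e \<bullet> e = 1"
  shows "distr lborel borel (reflection e) = lborel"
proof (rule measure_eqI)
  fix A assume "A \<in> sets (distr lborel borel (reflection e))"
  then have [measurable]: "A \<in> sets borel" by simp
  have "emeasure (distr lborel borel (reflection e)) A = (\<integral>\<^sup>+x. indicator A x \<partial>distr lborel borel (reflection e))"
    by simp
  also have "\<dots> = (\<integral>\<^sup>+x. indicator A (reflection e x) \<partial>lborel)"
    by (rule nn_integral_distr) measurable
  also have "\<dots> = (\<integral>\<^sup>+x. indicator {0..1} (x \<bullet> e) * (\<integral>\<^sup>+a. indicator A (reflection e (x + a *\<^sub>R e)) \<partial>lborel) \<partial>lborel)"
    by (rule nn_integral_lborel_lines[OF _ e, symmetric]) measurable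
  also have "\<dots> = (\<integral>\<^sup>+x. indicator {0..1} (x \<bullet> e) * (\<integral>\<^sup>+a. indicator A (x + a *\<^sub>R e) \<partial>lborel) \<partial>lborel)"
  proof (rule nn_integral_cong)
    fix x :: 'a
    have line: "x + (- 2 * (x \<bullet> e) + (- 1) * a) *\<^sub>R e = reflection e (x + a *\<^sub>R e)" for a
    proof -
      have "reflection e (x + a *\<^sub>R e) = x + (a - 2 * (x \<bullet> e + a)) *\<^sub>R e"
        by (simp only: reflection_def inner_add_left inner_scaleR_left e mult_1_right scaleR_left_diff_distrib add_diff_eq)
      moreover have "a - 2 * (x \<bullet> e + a) = - 2 * (x \<bullet> e) + (- 1) * a" by simp
      ultimately show ?thesis by (simp only:)
    qed
    have "(\<integral>\<^sup>+a. indicator A (x + a *\<^sub>R e) \<partial>lborel) = (\<integral>\<^sup>+a. indicator A (x + (- 2 * (x \<bullet> e) + (- 1) * a) *\<^sub>R e) \<partial>lborel)"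
      by (subst nn_integral_real_affine[where c = "-1" and t = "- 2 * (x \<bullet> e)"]) auto
    then have "(\<integral>\<^sup>+a. indicator A (x + a *\<^sub>R e) \<partial>lborel) = (\<integral>\<^sup>+a. indicator A (reflection e (x + a *\<^sub>R e)) \<partial>lborel)"
      unfolding line .
    then show "indicator {0..1} (x \<bullet> e) * (\<integral>\<^sup>+a. indicator A (reflection e (x + a *\<^sub>R e)) \<partial>lborel) =
       indicator {0..1} (x \<bullet> e) * (\<integral>\<^sup>+a. indicator A (x + a *\<^sub>R e) \<partial>lborel)" by simp
  qed
  also have "\<dots> = (\<integral>\<^sup>+x. indicator A x \<partial>lborel)"
    by (rule nn_integral_lborel_lines[OF _ e]) measurable
  finally show "emeasure (distr lborel borel (reflection e)) A = emeasure lborel A" by simp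
qed simp

lemma integral_sphere_prob_reflection:
  fixes g :: "real^'n \<Rightarrow> complex"
  assumes e: "e \<bullet> e = 1" and [measurable]: "g \<in> borel_measurable borel"
  shows "(LINT \<omega>|sphere_prob. g (reflection e \<omega>)) = (LINT \<omega>|sphere_prob. g \<omega>)"
proof -
  have sf: "reflection e (sgn x) = sgn (reflection e x)" for x
    unfolding sgn_div_norm norm_reflection[OF e] by (rule reflection_scaleR)
  have "(LINT x|lborel. indicator (ball 0 1) x *\<^sub>R g (reflection e (sgn x))) =
      (LINT x|lborel. indicator (ball 0 1) (reflection e x) *\<^sub>R g (sgn (reflection e x)))"
    by (simp add: sf indicator_def norm_reflection[OF e])
  also have "\<dots> = (LINT x|distr lborel borel (reflection e). indicator (ball 0 1) x *\<^sub>R g (sgn x))"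
    by (rule integral_distr[symmetric]) measurable
  finally show ?thesis
    by (simp add: integral_sphere_prob lborel_distr_reflection[OF e])
qed

text \<open>Reflecting along the difference of x and \<open>norm x *\<^sub>R e\<close> exchanges
  these two vectors of equal norm, and \<open>sphere_prob\<close> is invariant under it.\<close>

lemma integral_sphere_prob_inner:
  fixes g :: "real \<Rightarrow> complex" and e x :: "real^'n"
  assumes [measurable]: "g \<in> borel_measurable borel" and e: "norm e = 1"
  shows "(LINT \<omega>|sphere_prob. g (\<omega> \<bullet> x)) = (LINT \<omega>|sphere_prob. g (norm x * (\<omega> \<bullet> e)))"
proof (cases "x = norm x *\<^sub>R e")
  case True
  have "\<omega> \<bullet> x = norm x * (\<omega> \<bullet> e)" for \<omega>
    using arg_cong[OF True, of "\<lambda>y. \<omega> \<bullet> y"] by simp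
  then show ?thesis by simp
next
  case False
  define y where "y = norm x *\<^sub>R e"
  define v where "v = sgn (x - y)"
  have xy: "x \<noteq> y" using False by (simp add: y_def)
  have v: "v \<bullet> v = 1" using xy by (simp add: v_def norm_sgn flip: power2_norm_eq_inner)
  have yy: "y \<bullet> y = x \<bullet> x" using e by (simp add: y_def flip: power2_norm_eq_inner)
  have "2 * (x \<bullet> (x - y)) = (x - y) \<bullet> (x - y)"
    using yy by (simp add: inner_diff_left inner_diff_right inner_commute)
  also have "\<dots> = (norm (x - y))\<^sup>2" by (simp add: power2_norm_eq_inner)
  finally have xv: "x \<bullet> (x - y) = (norm (x - y))\<^sup>2 / 2" by simp
  have "2 * (x \<bullet> v) = norm (x - y)"
    using xy unfolding v_def sgn_div_norm inner_scaleR_right xv by (simp add: power2_eq_square)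
  then have "(2 * (x \<bullet> v)) *\<^sub>R v = x - y"
    using xy unfolding v_def sgn_div_norm by (simp only:) simp
  then have refl: "reflection v x = y" by (simp add: reflection_def)
  have "(LINT \<omega>|sphere_prob. g (\<omega> \<bullet> x)) = (LINT \<omega>|sphere_prob. g (reflection v \<omega> \<bullet> x))"
    by (rule integral_sphere_prob_reflection[OF v, symmetric]) measurable
  then show ?thesis by (simp add: reflection_inner_commute refl y_def)
qed

section \<open>Moments of the unit sphere and the mean of the exponential\<close>

definition axis_moment :: "'n::finite \<Rightarrow> nat \<Rightarrow> complex" where
  "axis_moment i k = (LINT \<omega>|(sphere_prob :: (real^'n) measure). of_real ((\<omega> $ i) ^ k))"

lemma integrable_sphere_prob_bounded:
  fixes g :: "real^'n \<Rightarrow> complex"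
  assumes "g \<in> borel_measurable borel" and "\<And>\<omega>. norm \<omega> = 1 \<Longrightarrow> norm (g \<omega>) \<le> B"
  shows "integrable sphere_prob g"
proof -
  interpret prob_space "sphere_prob :: (real^'n) measure" by (rule prob_space_sphere_prob)
  show ?thesis
    using AE_sphere_prob assms by (intro integrable_const_bound[where B = B]) (auto elim: eventually_mono simp: measurable_cong_sets[OF sets_sphere_prob refl])
qed

lemma axis_moment_0: "axis_moment (i::'n::finite) 0 = 1"
proof -
  interpret prob_space "sphere_prob :: (real^'n) measure" by (rule prob_space_sphere_prob)
  show ?thesis unfolding axis_moment_def using prob_space by simp
qed

lemma moment_inner:
  fixes x :: "real^'n" and i :: 'n
  shows "(LINT \<omega>|sphere_prob. of_real ((\<omega> \<bullet> x) ^ k)) = of_real (norm x ^ k) * axis_moment i k"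
proof -
  have "(LINT \<omega>|sphere_prob. of_real ((\<omega> \<bullet> x) ^ k)) = (LINT \<omega>|sphere_prob. complex_of_real ((norm x * (\<omega> \<bullet> axis i 1)) ^ k))"
    by (rule integral_sphere_prob_inner[where g = "\<lambda>t. of_real (t ^ k)"]) auto
  then show ?thesis
    unfolding axis_moment_def by (simp add: inner_axis power_mult_distrib)
qed

lemma axis_moment_odd:
  assumes "odd k" shows "axis_moment i k = 0"
proof -
  have "axis_moment i k = (LINT \<omega>|sphere_prob. of_real ((\<omega> \<bullet> (- axis i 1)) ^ k))"
    using moment_inner[where x = "- axis i 1" and k = k and i = i] by simp
  also have "\<dots> = - axis_moment i k"
    using assms unfolding axis_moment_def by (simp add: inner_axis)
  finally show ?thesis by simp
qed

lemma coeff_2_one_plus_square_power: 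
  "coeff ([:1, 0, 1:] ^ m) 0 = (1::complex) \<and> coeff ([:1, 0, 1:] ^ m) 1 = (0::complex) \<and> coeff ([:1, 0, 1:] ^ m) 2 = (of_nat m :: complex)"
  by (induction m) (auto simp: numeral_2_eq_2 coeff_pCons split: nat.split)

text \<open>Both sides of \<open>E (\<omega>\<^sub>i + b \<omega>\<^sub>j)\<^bsup>2k+2\<^esup> = (1 + b\<^sup>2)\<^bsup>k+1\<^esup> E \<omega>\<^sub>i\<^bsup>2k+2\<^esup>\<close>
  are polynomials in \<open>b\<close>; compare the coefficients of \<open>b\<^sup>2\<close>.\<close>

lemma mixed_moment:
  assumes ij: "i \<noteq> (j::'n::finite)"
  shows "of_nat (2 * k + 1) * (LINT \<omega>|(sphere_prob :: (real^'n) measure). of_real ((\<omega> $ i) ^ (2 * k) * (\<omega> $ j) ^ 2)) = axis_moment i (2 * k + 2)"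
proof -
  define p where "p = 2 * k + 2"
  define M where "M = (\<lambda>l. LINT \<omega>|(sphere_prob :: (real^'n) measure). complex_of_real ((\<omega> $ j) ^ l * (\<omega> $ i) ^ (p - l)))"
  define P where "P = (\<Sum>l\<le>p. monom (of_nat (p choose l) * M l) l)"
  have int: "integrable sphere_prob (\<lambda>\<omega>::real^'n. complex_of_real ((\<omega> $ j) ^ l * (\<omega> $ i) ^ m))" for l m
  proof (rule integrable_sphere_prob_bounded[where B = 1])
    fix \<omega> :: "real^'n" assume w: "norm \<omega> = 1"
    have "\<bar>\<omega> $ a\<bar> \<le> 1" for a using component_le_norm_cart[of \<omega> a] w by simp
    then have "\<bar>\<omega> $ j\<bar> ^ l * \<bar>\<omega> $ i\<bar> ^ m \<le> 1 * 1" by (intro mult_mono power_le_one) auto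
    then show "norm (complex_of_real ((\<omega> $ j) ^ l * (\<omega> $ i) ^ m)) \<le> 1"
      unfolding norm_of_real by (simp add: abs_mult power_abs)
  qed measurable
  have real_eq: "poly P (of_real b) = poly (smult (axis_moment i p) ([:1, 0, 1:] ^ (k + 1))) (of_real b)" for b :: real
  proof -
    define x :: "real^'n" where "x = axis i 1 + b *\<^sub>R axis j 1"
    have "norm x ^ p = (x \<bullet> x) ^ (k + 1)"
      by (simp add: p_def power2_norm_eq_inner[symmetric] power_mult[symmetric] del: power_Suc)
    also have "x \<bullet> x = 1 + b\<^sup>2"
      using ij by (simp add: x_def inner_add_left inner_add_right inner_axis_axis power2_eq_square)
    finally have nx: "norm x ^ p = (1 + b\<^sup>2) ^ (k + 1)" .
    have "(LINT \<omega>|sphere_prob. complex_of_real ((\<omega> \<bullet> x) ^ p)) = (LINT \<omega>|sphere_prob. (\<Sum>l\<le>p. of_nat (p choose l) * of_real b ^ l * complex_of_real ((\<omega> $ j) ^ l * (\<omega> $ i) ^ (p - l))))"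
    proof (rule Bochner_Integration.integral_cong[OF refl])
      fix \<omega> :: "real^'n"
      have "\<omega> \<bullet> x = b * \<omega> $ j + \<omega> $ i" by (simp add: x_def inner_add_right inner_axis)
      then show "complex_of_real ((\<omega> \<bullet> x) ^ p) = (\<Sum>l\<le>p. of_nat (p choose l) * of_real b ^ l * complex_of_real ((\<omega> $ j) ^ l * (\<omega> $ i) ^ (p - l)))"
        by (simp add: binomial_ring power_mult_distrib mult_ac)
    qed
    also have "\<dots> = (\<Sum>l\<le>p. of_nat (p choose l) * of_real b ^ l * M l)"
      unfolding M_def by (subst Bochner_Integration.integral_sum) (auto intro!: int integrable_mult_right simp del: of_real_mult of_real_power)
    also have "\<dots> = poly P (of_real b)"
      unfolding P_def by (simp add: poly_sum poly_monom mult_ac)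
    finally have "poly P (of_real b) = of_real (norm x ^ p) * axis_moment i p"
      using moment_inner[of x p i] by simp
    moreover have "poly [:1, 0, 1:] (of_real b) = complex_of_real (1 + b\<^sup>2)"
      by (simp add: power2_eq_square)
    ultimately show ?thesis unfolding nx poly_smult poly_power by (simp only: of_real_power mult.commute)
  qed
  have "P = smult (axis_moment i p) ([:1, 0, 1:] ^ (k + 1))"
  proof (rule ccontr)
    assume "P \<noteq> smult (axis_moment i p) ([:1, 0, 1:] ^ (k + 1))"
    then have "finite {z. poly (P - smult (axis_moment i p) ([:1, 0, 1:] ^ (k + 1))) z = 0}"
      by (intro poly_roots_finite) simp
    moreover have "range complex_of_real \<subseteq> {z. poly (P - smult (axis_moment i p) ([:1, 0, 1:] ^ (k + 1))) z = 0}"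
      using real_eq by (auto simp: poly_diff)
    moreover have "infinite (range complex_of_real)"
      by (simp add: finite_image_iff inj_on_def infinite_UNIV_char_0)
    ultimately show False using finite_subset by blast
  qed
  then have "coeff P 2 = axis_moment i p * of_nat (k + 1)"
    using coeff_2_one_plus_square_power[of "k + 1"] by (simp del: power_Suc)
  moreover have "coeff P 2 = of_nat (p choose 2) * M 2"
  proof -
    have "2 \<le> p" by (simp add: p_def)
    then show ?thesis unfolding P_def coeff_sum coeff_monom by (simp add: sum.delta)
  qed
  \<comment> \<open>The factor k + 1 also occurs as the coefficient of b^2 in (1 + b^2)^(k + 1);
    cancelling it leaves 2 k + 1.\<close>
  moreover have "p choose 2 = (k + 1) * (2 * k + 1)" unfolding p_def choose_two by simp
  ultimately have "of_nat (k + 1) * (of_nat (2 * k + 1) * M 2) = of_nat (k + 1) * axis_moment i p"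
    by (simp only: of_nat_mult mult_ac)
  then have "of_nat (2 * k + 1) * M 2 = axis_moment i p"
  proof -
    have "of_nat (k + 1) \<noteq> (0::complex)" unfolding of_nat_eq_0_iff by simp
    from mult_left_cancel[THEN iffD1, OF this]
      \<open>of_nat (k + 1) * (of_nat (2 * k + 1) * M 2) = of_nat (k + 1) * axis_moment i p\<close>
    show ?thesis .
  qed
  then show ?thesis by (simp add: M_def p_def mult.commute)
qed

text \<open>Inserting 1 = sum of the squared coordinates into the moment of order 2 k gives the pure
  moment of order 2 k + 2 and n - 1 mixed ones. Expressed through the pure one by
  \<open>mixed_moment\<close>, they yield the recursion of \<open>sphere_moment\<close>.\<close>

lemma axis_moment_even:
  assumes "CARD('n) \<ge> 2"
  shows "axis_moment (i::'n::finite) (2 * k) = of_real (sphere_moment CARD('n) k)"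
proof (induction k)
  case 0
  then show ?case by (simp add: axis_moment_0)
next
  case (Suc k)
  let ?S = "sphere_prob :: (real^'n) measure"
  have int: "integrable ?S (\<lambda>\<omega>. complex_of_real ((\<omega> $ i) ^ l * (\<omega> $ j) ^ m))" for l m and j
  proof (rule integrable_sphere_prob_bounded[where B = 1])
    fix \<omega> :: "real^'n" assume w: "norm \<omega> = 1"
    have "\<bar>\<omega> $ a\<bar> \<le> 1" for a using component_le_norm_cart[of \<omega> a] w by simp
    then have "\<bar>\<omega> $ i\<bar> ^ l * \<bar>\<omega> $ j\<bar> ^ m \<le> 1 * 1" by (intro mult_mono power_le_one) auto
    then show "norm (complex_of_real ((\<omega> $ i) ^ l * (\<omega> $ j) ^ m)) \<le> 1"
      unfolding norm_of_real by (simp add: abs_mult power_abs)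
  qed measurable
  have "axis_moment i (2 * k) = (LINT \<omega>|?S. (\<Sum>j\<in>UNIV. complex_of_real ((\<omega> $ i) ^ (2 * k) * (\<omega> $ j) ^ 2)))"
    unfolding axis_moment_def
  proof (rule integral_cong_AE)
    show "AE \<omega> in ?S. complex_of_real ((\<omega> $ i) ^ (2 * k)) = (\<Sum>j\<in>UNIV. complex_of_real ((\<omega> $ i) ^ (2 * k) * (\<omega> $ j) ^ 2))"
      using AE_sphere_prob
    proof eventually_elim
      case (elim \<omega>)
      have "(\<Sum>j\<in>UNIV. (\<omega> $ j) ^ 2) = (norm \<omega>)\<^sup>2"
        unfolding norm_eq_sqrt_inner by (simp add: inner_vec_def power2_eq_square sum_nonneg)
      then have "(\<Sum>j\<in>UNIV. (\<omega> $ i) ^ (2 * k) * (\<omega> $ j) ^ 2) = (\<omega> $ i) ^ (2 * k)"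
        using elim by (simp add: sum_distrib_left[symmetric])
      then show ?case by (simp only: of_real_sum[symmetric])
    qed
  qed measurable
  also have "\<dots> = (\<Sum>j\<in>UNIV. LINT \<omega>|?S. complex_of_real ((\<omega> $ i) ^ (2 * k) * (\<omega> $ j) ^ 2))"
    by (rule Bochner_Integration.integral_sum) (rule int)
  also have "\<dots> = (LINT \<omega>|?S. complex_of_real ((\<omega> $ i) ^ (2 * k) * (\<omega> $ i) ^ 2))
      + (\<Sum>j\<in>UNIV - {i}. LINT \<omega>|?S. complex_of_real ((\<omega> $ i) ^ (2 * k) * (\<omega> $ j) ^ 2))"
    by (rule sum.remove) auto
  also have "(LINT \<omega>|?S. complex_of_real ((\<omega> $ i) ^ (2 * k) * (\<omega> $ i) ^ 2)) = axis_moment i (2 * k + 2)"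
    unfolding axis_moment_def power_add ..
  also have "(\<Sum>j\<in>UNIV - {i}. LINT \<omega>|?S. complex_of_real ((\<omega> $ i) ^ (2 * k) * (\<omega> $ j) ^ 2))
      = (\<Sum>j\<in>UNIV - {i}. axis_moment i (2 * k + 2) / of_nat (2 * k + 1))"
  proof (rule sum.cong[OF refl])
    fix j assume "j \<in> UNIV - {i}"
    then have "i \<noteq> j" by auto
    have "of_nat (2 * k + 1) \<noteq> (0::complex)" unfolding of_nat_eq_0_iff by simp
    then show "(LINT \<omega>|?S. complex_of_real ((\<omega> $ i) ^ (2 * k) * (\<omega> $ j) ^ 2)) = axis_moment i (2 * k + 2) / of_nat (2 * k + 1)"
      unfolding mixed_moment[OF \<open>i \<noteq> j\<close>, of k, symmetric] by simp
  qed
  also have "\<dots> = of_nat (CARD('n) - 1) * (axis_moment i (2 * k + 2) / of_nat (2 * k + 1))"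
    by (simp add: card_Diff_singleton)
  finally have "axis_moment i (2 * k) = axis_moment i (2 * k + 2) * (1 + of_nat (CARD('n) - 1) / of_nat (2 * k + 1))"
    by (simp add: algebra_simps)
  also have "1 + of_nat (CARD('n) - 1) / of_nat (2 * k + 1) = complex_of_real ((2 * real k + real CARD('n)) / (2 * real k + 1))"
  proof -
    have "1 + real (CARD('n) - 1) / real (2 * k + 1) = (2 * real k + real CARD('n)) / (2 * real k + 1)"
      using assms by (simp add: of_nat_diff divide_simps)
    then have "complex_of_real (1 + real (CARD('n) - 1) / real (2 * k + 1)) = complex_of_real ((2 * real k + real CARD('n)) / (2 * real k + 1))"
      by (rule arg_cong)
    then show ?thesis by (simp only: of_real_add of_real_1 of_real_divide of_real_of_nat_eq)
  qed
  finally have eq: "of_real (sphere_moment CARD('n) k) = axis_moment i (2 * k + 2) * complex_of_real ((2 * real k + real CARD('n)) / (2 * real k + 1))"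
    unfolding Suc .
  define q where "q = (2 * real k + real CARD('n)) / (2 * real k + 1)"
  have q: "q > 0" using assms by (simp add: q_def)
  have "sphere_moment CARD('n) (Suc k) = sphere_moment CARD('n) k / q"
    by (simp add: q_def)
  then have "of_real (sphere_moment CARD('n) (Suc k)) = of_real (sphere_moment CARD('n) k) / complex_of_real q" by simp
  also have "\<dots> = axis_moment i (2 * k + 2)" using eq q by (simp add: q_def[symmetric])
  finally show ?case by simp
qed

text \<open>The exponential series is integrated term by term and the odd moments drop out. Allowing
  complex t is what later gives the growth of \<open>bessel\<close> off the real axis.\<close>

theorem sphere_prob_exp:
  assumes n: "CARD('n) \<ge> 2"
  shows "(LINT \<omega>|(sphere_prob :: (real^'n) measure). exp (- \<i> * of_real (\<omega> $ i) * t)) = bessel CARD('n) (t\<^sup>2)"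
proof -
  let ?S = "sphere_prob :: (real^'n) measure"
  interpret prob_space ?S by (rule prob_space_sphere_prob)
  define f where "f = (\<lambda>k (\<omega>::real^'n). (- \<i> * of_real (\<omega> $ i) * t) ^ k /\<^sub>R fact k)"
  have bound: "norm (f k \<omega>) \<le> norm t ^ k /\<^sub>R fact k" if "norm \<omega> = 1" for k \<omega>
  proof -
    have "\<bar>\<omega> $ i\<bar> \<le> 1" using component_le_norm_cart[of \<omega> i] that by simp
    then have "norm (- \<i> * of_real (\<omega> $ i) * t) \<le> norm t" by (simp add: norm_mult mult_left_le_one_le)
    then have "norm (- \<i> * of_real (\<omega> $ i) * t) ^ k \<le> norm t ^ k" by (intro power_mono) auto
    moreover have "norm (f k \<omega>) = norm (- \<i> * of_real (\<omega> $ i) * t) ^ k /\<^sub>R fact k"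
      unfolding f_def norm_scaleR norm_power by simp
    ultimately show ?thesis by (simp add: mult_left_mono del: mult_minus_left)
  qed
  have fint: "integrable ?S (f k)" for k
    by (rule integrable_sphere_prob_bounded[OF _ bound]) (auto simp: f_def)
  have sums: "(\<lambda>k. LINT \<omega>|?S. f k \<omega>) sums (LINT \<omega>|?S. (\<Sum>k. f k \<omega>))"
  proof (rule sums_integral[OF fint])
    show "AE \<omega> in ?S. summable (\<lambda>k. norm (f k \<omega>))"
      unfolding f_def by (intro AE_I2 summable_norm_exp)
    show "summable (\<lambda>k. LINT \<omega>|?S. norm (f k \<omega>))"
    proof (rule summable_comparison_test)
      show "summable (\<lambda>k. norm t ^ k /\<^sub>R fact k)" by (rule summable_exp_generic)
      show "\<exists>N. \<forall>k\<ge>N. norm (LINT \<omega>|?S. norm (f k \<omega>)) \<le> norm t ^ k /\<^sub>R fact k"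
      proof (intro exI allI impI)
        fix k
        have "(LINT \<omega>|?S. norm (f k \<omega>)) \<le> (LINT \<omega>|?S. norm t ^ k /\<^sub>R fact k)"
          using AE_sphere_prob bound by (intro integral_mono_AE integrable_norm fint) (auto elim: eventually_mono)
        then show "norm (LINT \<omega>|?S. norm (f k \<omega>)) \<le> norm t ^ k /\<^sub>R fact k" using prob_space by simp
      qed
    qed
  qed
  have "(LINT \<omega>|?S. (\<Sum>k. f k \<omega>)) = (LINT \<omega>|?S. exp (- \<i> * of_real (\<omega> $ i) * t))"
    by (simp add: f_def exp_def)
  moreover have "(LINT \<omega>|?S. f k \<omega>) = (- \<i> * t) ^ k / fact k * axis_moment i k" for k
  proof -
    have "- \<i> * of_real (\<omega> $ i) * t = (- \<i> * t) * of_real (\<omega> $ i)" for \<omega> :: "real^'n" by simp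
    then have "f k \<omega> = (- \<i> * t) ^ k / fact k * of_real ((\<omega> $ i) ^ k)" for \<omega>
      unfolding f_def by (simp only: power_mult_distrib) (simp add: scaleR_conv_of_real divide_inverse)
    then show ?thesis unfolding axis_moment_def by simp
  qed
  ultimately have s1: "(\<lambda>k. (- \<i> * t) ^ k / fact k * axis_moment i k) sums (LINT \<omega>|?S. exp (- \<i> * of_real (\<omega> $ i) * t))"
    using sums by simp
  have s2: "(\<lambda>k. (- \<i> * t) ^ (2 * k) / fact (2 * k) * axis_moment i (2 * k)) sums (LINT \<omega>|?S. exp (- \<i> * of_real (\<omega> $ i) * t))"
  proof (rule sums_mono_reindex[THEN iffD2, OF _ _ s1])
    show "strict_mono (\<lambda>k::nat. 2 * k)" by (simp add: strict_mono_def)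
    fix k assume "k \<notin> range (\<lambda>k::nat. 2 * k)"
    then have "odd k" by (auto elim: evenE)
    then show "(- \<i> * t) ^ k / fact k * axis_moment i k = 0" by (simp add: axis_moment_odd)
  qed
  have "(- \<i> * t) ^ (2 * k) / fact (2 * k) * axis_moment i (2 * k) = bessel_coeff CARD('n) k * (t\<^sup>2) ^ k" for k
  proof -
    have "(- \<i> * t) ^ (2 * k) = (- 1) ^ k * (t\<^sup>2) ^ k"
      unfolding power_mult using power_minus[of "t\<^sup>2" k] by (simp add: power_mult_distrib)
    then show ?thesis unfolding axis_moment_even[OF n] bessel_coeff_def by simp
  qed
  from sums_unique[OF s2[unfolded this]] show ?thesis unfolding bessel_def .
qed


subsection \<open>Lower and upper bounds for the symbol\<close>

text \<open>Where |f| lies below the threshold, |f'| is at least d / 2, and a short Taylor step to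
  the right lifts |f| above it.\<close>

lemma large_value_nearby:
  fixes f f' f'' :: "real \<Rightarrow> real"
  assumes f: "\<And>x. (f has_real_derivative f' x) (at x)" and f': "\<And>x. (f' has_real_derivative f'' x) (at x)"
    and K: "\<And>x. x \<ge> 1 \<Longrightarrow> \<bar>f'' x\<bar> \<le> K" "K \<ge> 1" and d: "0 < d" "d \<le> 1"
    and x: "x \<ge> 1" and large: "d \<le> \<bar>f x\<bar> + \<bar>f' x\<bar>"
  shows "\<exists>y. x \<le> y \<and> y \<le> x + 1 \<and> d\<^sup>2 / (64 * K) \<le> \<bar>f y\<bar>"
proof (cases "d\<^sup>2 / (64 * K) \<le> \<bar>f x\<bar>")
  case True
  then show ?thesis by (intro exI[of _ x]) auto
next
  case False
  \<comment> \<open>With this step the linear gain d e / 2 = d^2 / (8 K) exceeds the curvature loss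
    K e^2 / 2 = d^2 / (32 K) by six times the threshold.\<close>
  define e where "e = d / (4 * K)"
  have e: "0 < e" "e \<le> 1" using d K by (auto simp: e_def divide_le_eq)
  have "d\<^sup>2 / (64 * K) \<le> d / 2"
  proof -
    have "d\<^sup>2 \<le> d * 1" unfolding power2_eq_square using d by (intro mult_left_mono) auto
    also have "d * 1 \<le> d / 2 * (64 * K)" using d K by simp
    finally show ?thesis using K by (subst pos_divide_le_eq) auto
  qed
  then have f'x: "\<bar>f' x\<bar> \<ge> d / 2" using large False by linarith
  obtain t where t: "x < t" "t < x + e" "f (x + e) = f x + f' x * (x + e - x) + f'' t / 2 * (x + e - x) ^ 2"
  proof -
    define D where "D = (\<lambda>m::nat. if m = 0 then f else if m = 1 then f' else f'')"
    have "\<exists>t>x. t < x + e \<and> f (x + e) = (\<Sum>m<2. D m x / fact m * (x + e - x) ^ m) + D 2 t / fact 2 * (x + e - x) ^ 2"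
    proof (rule Taylor_up[where a = x and b = "x + e"])
      show "\<forall>m t. m < 2 \<and> x \<le> t \<and> t \<le> x + e \<longrightarrow> (D m has_real_derivative D (Suc m) t) (at t)"
        using f f' by (auto simp: D_def less_2_cases_iff)
    qed (use e in \<open>auto simp: D_def\<close>)
    then obtain t where t: "x < t" "t < x + e" "f (x + e) = (\<Sum>m<2. D m x / fact m * (x + e - x) ^ m) + D 2 t / fact 2 * (x + e - x) ^ 2"
      by blast
    show ?thesis
      by (rule that[OF t(1,2)]) (use t(3) in \<open>simp add: D_def numeral_2_eq_2\<close>)
  qed
  have "\<bar>f'' t / 2 * e\<^sup>2\<bar> \<le> K / 2 * e\<^sup>2"
    using K(1)[of t] t x by (simp add: abs_mult mult_right_mono)
  moreover have "\<bar>f' x * e\<bar> \<ge> d / 2 * e" using f'x e by (simp add: abs_mult mult_right_mono)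
  moreover have "f (x + e) = f x + f' x * e + f'' t / 2 * e\<^sup>2" using t(3) by simp
  ultimately have "\<bar>f (x + e)\<bar> \<ge> d / 2 * e - K / 2 * e\<^sup>2 - \<bar>f x\<bar>" by linarith
  also have "d / 2 * e - K / 2 * e\<^sup>2 = 6 * (d\<^sup>2 / (64 * K))"
    using K by (simp add: e_def power2_eq_square divide_simps)
  finally have "\<bar>f (x + e)\<bar> \<ge> 6 * (d\<^sup>2 / (64 * K)) - \<bar>f x\<bar>" .
  moreover have "d\<^sup>2 / (64 * K) \<ge> 0" using K by simp
  ultimately have "d\<^sup>2 / (64 * K) \<le> \<bar>f (x + e)\<bar>" using False by linarith
  then show ?thesis using e by (intro exI[of _ "x + e"]) auto
qed

text \<open>Real parts suffice: a lower bound for them is one for the norm, and on the real axis the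
  equation has real coefficients and passes to real parts.\<close>

definition bessel_re :: "nat \<Rightarrow> real \<Rightarrow> real" where "bessel_re n x = Re (bessel n (of_real x))"
definition bessel_re' :: "nat \<Rightarrow> real \<Rightarrow> real" where "bessel_re' n x = Re (bessel' n (of_real x))"
definition bessel_re'' :: "nat \<Rightarrow> real \<Rightarrow> real" where "bessel_re'' n x = Re (bessel'' n (of_real x))"

lemma has_real_derivative_Re:
  assumes "(f has_field_derivative D) (at (complex_of_real x))"
  shows "((\<lambda>x. Re (f (of_real x))) has_real_derivative Re D) (at x)"
proof -
  have "((\<lambda>x. complex_of_real x) has_vector_derivative 1) (at x)"
    by (auto intro!: derivative_eq_intros)
  from field_vector_diff_chain_at[OF this assms]
  have "((\<lambda>x. f (of_real x)) has_vector_derivative D) (at x)" by (simp add: o_def)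
  then have "((\<lambda>x. Re (f (of_real x))) has_vector_derivative Re D) (at x)"
    by (rule bounded_linear.has_vector_derivative[OF bounded_linear_Re])
  then show ?thesis by (simp add: has_real_derivative_iff_has_vector_derivative)
qed

section \<open>Sonine's energy and estimates on the positive axis\<close>

context
  fixes n :: nat
  assumes n: "n \<ge> 2"
begin

lemma bessel_re_deriv: "(bessel_re n has_real_derivative bessel_re' n x) (at x)"
  unfolding bessel_re_def[abs_def] bessel_re'_def
  by (rule has_real_derivative_Re) (rule DERIV_bessel, use n in simp)

lemma bessel_re'_deriv: "(bessel_re' n has_real_derivative bessel_re'' n x) (at x)"
  unfolding bessel_re'_def[abs_def] bessel_re''_def
  by (rule has_real_derivative_Re) (rule DERIV_bessel', use n in simp)

lemma bessel_re_ode: "4 * x * bessel_re'' n x = - 2 * real n * bessel_re' n x - bessel_re n x"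
proof -
  have "Re (4 * of_real x * bessel'' n (of_real x) + 2 * of_nat n * bessel' n (of_real x) + bessel n (of_real x)) = 0"
    using bessel_ode[of n "of_real x"] n by simp
  then show ?thesis unfolding bessel_re_def bessel_re'_def bessel_re''_def by simp
qed

text \<open>Sonine's energy: decreasing, but at most like a power.\<close>

definition energy :: "real \<Rightarrow> real" where
  "energy x = (bessel_re n x)\<^sup>2 + 4 * x * (bessel_re' n x)\<^sup>2"

lemma energy_deriv: "(energy has_real_derivative - 4 * (real n - 1) * (bessel_re' n x)\<^sup>2) (at x)"
proof -
  have "(energy has_real_derivative 2 * bessel_re n x * bessel_re' n x + (4 * (bessel_re' n x)\<^sup>2 + 4 * x * (2 * bessel_re' n x * bessel_re'' n x))) (at x)"
    unfolding energy_def[abs_def]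
    by (auto intro!: derivative_eq_intros bessel_re_deriv bessel_re'_deriv)
  moreover have "2 * bessel_re n x * bessel_re' n x + (4 * (bessel_re' n x)\<^sup>2 + 4 * x * (2 * bessel_re' n x * bessel_re'' n x)) =
     2 * bessel_re n x * bessel_re' n x + 4 * (bessel_re' n x)\<^sup>2 + 2 * bessel_re' n x * (4 * x * bessel_re'' n x)"
    by simp
  moreover have "\<dots> = - 4 * (real n - 1) * (bessel_re' n x)\<^sup>2"
    unfolding bessel_re_ode by (simp add: power2_eq_square algebra_simps)
  ultimately show ?thesis by (simp only:)
qed

lemma energy_le_1: "x \<ge> 0 \<Longrightarrow> energy x \<le> 1"
proof -
  assume x: "x \<ge> 0"
  have "energy x \<le> energy 0"
    by (rule DERIV_nonpos_imp_nonincreasing[OF x])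
       (use energy_deriv n in \<open>auto intro!: exI mult_nonpos_nonneg\<close>)
  then show "energy x \<le> 1" by (simp add: energy_def bessel_re_def)
qed

text \<open>Multiplied by x^(n - 1) the energy becomes nondecreasing on x \<ge> 0: the terms with
  the squared derivative cancel and (n - 1) x^(n - 2) B^2 remains. So it decays at most like x^(-(n
  - 1)).\<close>

lemma energy_lower: "\<exists>c>0. \<forall>x\<ge>1. c / x ^ n \<le> energy x"
proof -
  define F where "F = (\<lambda>x. x ^ (n - 1) * energy x)"
  have n1: "real (n - 1) = real n - 1" "n - 1 = Suc (n - 2)" using n by auto
  have F: "(F has_real_derivative (real n - 1) * x ^ (n - 2) * (bessel_re n x)\<^sup>2) (at x)" for x
  proof -
    have "(F has_real_derivative x ^ (n - 1) * (- 4 * (real n - 1) * (bessel_re' n x)\<^sup>2) + real (n - 1) * x ^ (n - 1 - 1) * energy x) (at x)"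
      unfolding F_def by (auto intro!: derivative_eq_intros energy_deriv)
    moreover have "x ^ (n - 1) * (- 4 * (real n - 1) * (bessel_re' n x)\<^sup>2) + real (n - 1) * x ^ (n - 1 - 1) * energy x
       = (real n - 1) * x ^ (n - 2) * (bessel_re n x)\<^sup>2"
    proof -
      have "x ^ (n - 1) = x * x ^ (n - 2)" "x ^ (n - 1 - 1) = x ^ (n - 2)"
        using n by (simp_all add: power_eq_if numeral_2_eq_2)
      then show ?thesis unfolding energy_def n1(1) by (simp only:) (simp add: algebra_simps)
    qed
    ultimately show ?thesis by (simp only:)
  qed
  \<comment> \<open>F vanishes at 0, so monotonicity is started at a point \<delta> in (0, 1] near
    0, where \<open>bessel_re n\<close> is still positive.\<close>
  have "isCont (bessel_re n) 0" using bessel_re_deriv by (rule DERIV_isCont)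
  then have "((bessel_re n) \<longlongrightarrow> 1) (at 0)" by (simp add: isCont_def bessel_re_def)
  then have "eventually (\<lambda>x. bessel_re n x > 0) (at 0)" by (rule order_tendstoD) simp
  then obtain r where r: "r > 0" "\<And>x. x \<noteq> 0 \<Longrightarrow> dist x 0 < r \<Longrightarrow> bessel_re n x > 0"
    unfolding eventually_at by blast
  define \<delta> where "\<delta> = min (r / 2) 1"
  have \<delta>: "0 < \<delta>" "\<delta> \<le> 1" "bessel_re n \<delta> > 0" using r by (auto simp: \<delta>_def)
  define c where "c = F \<delta>"
  have c: "c > 0" unfolding c_def F_def energy_def using \<delta>
    by (intro mult_pos_pos add_pos_nonneg) auto
  have "c / x ^ n \<le> energy x" if x: "x \<ge> 1" for x
  proof -
    have "F \<delta> \<le> F x"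
    proof (rule DERIV_nonneg_imp_nondecreasing[of \<delta> x])
      show "\<delta> \<le> x" using \<delta> x by simp
      fix y assume "\<delta> \<le> y"
      then have "0 \<le> (real n - 1) * y ^ (n - 2) * (bessel_re n y)\<^sup>2" using \<delta> n by (intro mult_nonneg_nonneg) auto
      then show "\<exists>z. (F has_real_derivative z) (at y) \<and> 0 \<le> z" using F by blast
    qed
    then have "c \<le> x ^ (n - 1) * energy x" by (simp add: c_def F_def)
    moreover have "energy x \<ge> 0" using x by (simp add: energy_def)
    moreover have "x ^ (n - 1) \<le> x ^ n" using x by (intro power_increasing) auto
    ultimately have "c \<le> x ^ n * energy x" using mult_right_mono[of "x ^ (n - 1)" "x ^ n" "energy x"] by linarith
    then show ?thesis using x by (simp add: divide_le_eq mult.commute)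
  qed
  then show ?thesis using c by blast
qed

text \<open>The energy is at most 1, which bounds B and B'; the equation, with leading coefficient 4
  x \<ge> 4, then bounds the second derivative.\<close>

lemma bessel_re_bounds:
  assumes x: "x \<ge> 1"
  shows "\<bar>bessel_re n x\<bar> \<le> 1" "\<bar>bessel_re' n x\<bar> \<le> 1" "\<bar>bessel_re'' n x\<bar> \<le> real n"
proof -
  have E: "(bessel_re n x)\<^sup>2 + 4 * x * (bessel_re' n x)\<^sup>2 \<le> 1"
    using energy_le_1[of x] x by (simp add: energy_def)
  have p: "4 * x * (bessel_re' n x)\<^sup>2 \<ge> 1 * (bessel_re' n x)\<^sup>2" using x by (intro mult_right_mono) auto
  have "(bessel_re n x)\<^sup>2 \<le> 1" using E p zero_le_power2[of "bessel_re' n x"] by linarith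
  then show a: "\<bar>bessel_re n x\<bar> \<le> 1" by (simp add: abs_square_le_1)
  have "(bessel_re' n x)\<^sup>2 \<le> 1" using E p zero_le_power2[of "bessel_re n x"] by linarith
  then show b: "\<bar>bessel_re' n x\<bar> \<le> 1" by (simp add: abs_square_le_1)
  have "4 * x * \<bar>bessel_re'' n x\<bar> = \<bar>4 * x * bessel_re'' n x\<bar>" using x by (simp add: abs_mult)
  also have "\<dots> \<le> 2 * real n * \<bar>bessel_re' n x\<bar> + \<bar>bessel_re n x\<bar>"
  proof -
    have "\<bar>2 * real n * bessel_re' n x\<bar> = 2 * real n * \<bar>bessel_re' n x\<bar>" by (simp add: abs_mult)
    then show ?thesis unfolding bessel_re_ode by linarith
  qed
  also have "\<dots> \<le> 2 * real n * 1 + 1" using a b by (intro add_mono mult_left_mono) auto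
  also have "\<dots> \<le> 4 * real n" using n by simp
  finally have "4 * x * \<bar>bessel_re'' n x\<bar> \<le> 4 * real n" .
  moreover have "4 * 1 * \<bar>bessel_re'' n x\<bar> \<le> 4 * x * \<bar>bessel_re'' n x\<bar>" using x by (intro mult_right_mono) auto
  ultimately show "\<bar>bessel_re'' n x\<bar> \<le> real n" by simp
qed

text \<open>As both absolute values are at most 1, they dominate their squares, so the energy bounds
  them from below; its factor 4 x costs one more power of x.\<close>

lemma bessel_re_jet_lower: "\<exists>c>0. c \<le> 1 \<and> (\<forall>x\<ge>1. c / x ^ (n + 1) \<le> \<bar>bessel_re n x\<bar> + \<bar>bessel_re' n x\<bar>)"
proof -
  obtain c where c: "c > 0" "\<And>x. x \<ge> 1 \<Longrightarrow> c / x ^ n \<le> energy x" using energy_lower by blast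
  define c' where "c' = min 1 (c / 4)"
  have c': "c' > 0" "c' \<le> 1" "c' \<le> c / 4" using c by (auto simp: c'_def)
  have "c' / x ^ (n + 1) \<le> \<bar>bessel_re n x\<bar> + \<bar>bessel_re' n x\<bar>" if x: "x \<ge> 1" for x
  proof -
    let ?a = "\<bar>bessel_re n x\<bar>" and ?b = "\<bar>bessel_re' n x\<bar>"
    note b = bessel_re_bounds[OF x]
    have sq: "y\<^sup>2 \<le> \<bar>y\<bar>" if "\<bar>y\<bar> \<le> 1" for y :: real
    proof -
      have "\<bar>y\<bar> * \<bar>y\<bar> \<le> \<bar>y\<bar> * 1" using that by (intro mult_left_mono) auto
      then show ?thesis by (simp add: power2_eq_square)
    qed
    have "(bessel_re n x)\<^sup>2 \<le> ?a" "(bessel_re' n x)\<^sup>2 \<le> ?b"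
      by (rule sq, rule b)+
    then have "energy x \<le> ?a + 4 * x * ?b"
      unfolding energy_def using x by (intro add_mono mult_left_mono) auto
    also have "\<dots> \<le> 4 * x * ?a + 4 * x * ?b" using x by (intro add_right_mono) (simp add: mult_le_cancel_right1)
    finally have "c / x ^ n \<le> 4 * x * (?a + ?b)" using c(2)[OF x] by (simp add: algebra_simps)
    then have "c / 4 / x ^ (n + 1) \<le> ?a + ?b" using x by (simp add: field_simps)
    moreover have "c' / x ^ (n + 1) \<le> c / 4 / x ^ (n + 1)" using c' x by (intro divide_right_mono) auto
    ultimately show ?thesis by linarith
  qed
  then show ?thesis using c' by blast
qed

end


text \<open>What division by \<phi>(\<zeta> \<cdot> \<zeta>) requires, collected so that both values
  of l are treated at once. Growth is stated at squares because the exponential type refers to the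
  square root of the argument. The factor \<open>1 + norm w\<close> accommodates the radial
  derivative.\<close>

locale slowly_decreasing_symbol =
  fixes \<phi> \<phi>' :: "complex \<Rightarrow> complex"
  assumes deriv: "\<And>s. (\<phi> has_field_derivative \<phi>' s) (at s)"
    and simple: "\<And>s. \<phi> s = 0 \<Longrightarrow> \<phi>' s \<noteq> 0"
    and slow: "\<exists>\<kappa>>0. \<exists>A\<ge>0. \<exists>M. \<forall>s\<ge>0. \<exists>t. s \<le> t \<and> t \<le> s + A \<and> \<kappa> / (1 + s) ^ M \<le> norm (\<phi> (of_real t))"
    and growth: "\<exists>C\<ge>0. \<exists>A\<ge>0. \<forall>w. norm (\<phi> (w\<^sup>2)) \<le> C * (1 + norm w) * exp (A * \<bar>Im w\<bar>)"

lemma ex_lower_boundI: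
  assumes "\<kappa> > (0::real)" "A \<ge> (0::real)" "\<And>s. s \<ge> (0::real) \<Longrightarrow> \<exists>t. s \<le> t \<and> t \<le> s + A \<and> \<kappa> / (1 + s) ^ M \<le> f t"
  shows "\<exists>\<kappa>>0. \<exists>A\<ge>0. \<exists>M. \<forall>s\<ge>0. \<exists>t. s \<le> t \<and> t \<le> s + A \<and> \<kappa> / (1 + s) ^ M \<le> f t"
  using assms by blast

lemma rescale_lower_bound:
  fixes f :: "real \<Rightarrow> real"
  assumes f: "\<exists>\<kappa>>0. \<exists>M. \<forall>x\<ge>1. \<exists>y. x \<le> y \<and> y \<le> x + 1 \<and> \<kappa> / x ^ M \<le> \<bar>f y\<bar>" and r: "r > 0"
  shows "\<exists>\<kappa>>0. \<exists>A\<ge>0. \<exists>M. \<forall>s\<ge>0. \<exists>t. s \<le> t \<and> t \<le> s + A \<and> \<kappa> / (1 + s) ^ M \<le> \<bar>f (r\<^sup>2 * t)\<bar>"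
proof -
  obtain \<kappa> M where k: "\<kappa> > 0" and f: "\<And>x. x \<ge> 1 \<Longrightarrow> \<exists>y. x \<le> y \<and> y \<le> x + 1 \<and> \<kappa> / x ^ M \<le> \<bar>f y\<bar>"
    using f by blast
  have r2: "r\<^sup>2 > 0" using r by simp
  show ?thesis
  proof (rule ex_lower_boundI[where \<kappa> = "\<kappa> / (1 + r\<^sup>2) ^ M" and A = "2 / r\<^sup>2" and M = M])
    show "\<kappa> / (1 + r\<^sup>2) ^ M > 0" using k by (intro divide_pos_pos zero_less_power add_pos_nonneg) auto
    show "2 / r\<^sup>2 \<ge> 0" by simp
    fix s :: real assume s: "s \<ge> 0"
    \<comment> \<open>The shift by 1 enters the range x \<ge> 1 and the window adds another 1, so y
      / r^2 lies within 2 / r^2 of s.\<close>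
    have x1: "1 + r\<^sup>2 * s \<ge> 1" using s by simp
    obtain y where y: "1 + r\<^sup>2 * s \<le> y" "y \<le> 1 + r\<^sup>2 * s + 1" "\<kappa> / (1 + r\<^sup>2 * s) ^ M \<le> \<bar>f y\<bar>"
      using f[OF x1] by blast
    have "1 + r\<^sup>2 * s \<le> (1 + r\<^sup>2) * (1 + s)" using s by (simp add: algebra_simps)
    then have "(1 + r\<^sup>2 * s) ^ M \<le> ((1 + r\<^sup>2) * (1 + s)) ^ M" using x1 by (intro power_mono) auto
    then have "\<kappa> / ((1 + r\<^sup>2) * (1 + s)) ^ M \<le> \<kappa> / (1 + r\<^sup>2 * s) ^ M"
      using k x1 s r2 by (intro divide_left_mono mult_pos_pos zero_less_power add_pos_nonneg) auto
    then have lower: "\<kappa> / (1 + r\<^sup>2) ^ M / (1 + s) ^ M \<le> \<bar>f (r\<^sup>2 * (y / r\<^sup>2))\<bar>"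
      using y(3) r2 by (simp add: power_mult_distrib)
    show "\<exists>t. s \<le> t \<and> t \<le> s + 2 / r\<^sup>2 \<and> \<kappa> / (1 + r\<^sup>2) ^ M / (1 + s) ^ M \<le> \<bar>f (r\<^sup>2 * t)\<bar>"
    proof (intro exI[of _ "y / r\<^sup>2"] conjI lower)
      show "s \<le> y / r\<^sup>2" using y(1) r2 by (subst pos_le_divide_eq) (auto simp: mult.commute)
      have "(s + 2 / r\<^sup>2) * r\<^sup>2 = r\<^sup>2 * s + 2" using r2 by (simp add: field_simps)
      then have "y \<le> (s + 2 / r\<^sup>2) * r\<^sup>2" using y(2) by linarith
      then show "y / r\<^sup>2 \<le> s + 2 / r\<^sup>2" using r2 by (simp only: pos_divide_le_eq)
    qed
  qed
qed

lemma power_lower_bound_nearby: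
  fixes f f' f'' :: "real \<Rightarrow> real"
  assumes f: "\<And>x. (f has_real_derivative f' x) (at x)" and f': "\<And>x. (f' has_real_derivative f'' x) (at x)"
    and K: "\<And>x. x \<ge> 1 \<Longrightarrow> \<bar>f'' x\<bar> \<le> K" "K \<ge> 1" and c: "c > 0" "c \<le> 1"
    and large: "\<And>x. x \<ge> 1 \<Longrightarrow> c / x ^ m \<le> \<bar>f x\<bar> + \<bar>f' x\<bar>"
  shows "\<exists>\<kappa>>0. \<exists>M. \<forall>x\<ge>1. \<exists>y. x \<le> y \<and> y \<le> x + 1 \<and> \<kappa> / x ^ M \<le> \<bar>f y\<bar>"
proof -
  have pos: "c\<^sup>2 / (64 * K) > 0" using c K by (intro divide_pos_pos) auto
  have main: "\<exists>y. x \<le> y \<and> y \<le> x + 1 \<and> c\<^sup>2 / (64 * K) / x ^ (m * 2) \<le> \<bar>f y\<bar>" if x: "x \<ge> 1" for x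
  proof -
    have "c / x ^ m \<le> c / 1" using x c by (intro divide_left_mono) auto
    then have le1: "c / x ^ m \<le> 1" using c by linarith
    have gt0: "0 < c / x ^ m" using x c by simp
    have "\<exists>y. x \<le> y \<and> y \<le> x + 1 \<and> (c / x ^ m)\<^sup>2 / (64 * K) \<le> \<bar>f y\<bar>"
      by (rule large_value_nearby[OF f f' K gt0 le1 x large[OF x]])
    then show ?thesis by (simp add: power_divide power_mult mult.commute)
  qed
  show ?thesis
    by (rule exI[of _ "c\<^sup>2 / (64 * K)"], rule conjI[OF pos], rule exI[of _ "m * 2"]) (use main in blast)
qed

lemma bessel_re_lower:
  assumes n: "n \<ge> 2"
  shows "\<exists>\<kappa>>0. \<exists>M. \<forall>x\<ge>1. \<exists>y. x \<le> y \<and> y \<le> x + 1 \<and> \<kappa> / x ^ M \<le> \<bar>bessel_re n y\<bar>"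
proof -
  obtain c where c: "c > 0" "c \<le> 1" "\<And>x. x \<ge> 1 \<Longrightarrow> c / x ^ (n + 1) \<le> \<bar>bessel_re n x\<bar> + \<bar>bessel_re' n x\<bar>"
    using bessel_re_jet_lower[OF n] by blast
  show ?thesis
    by (rule power_lower_bound_nearby[OF bessel_re_deriv[OF n] bessel_re'_deriv[OF n] bessel_re_bounds(3)[OF n] _ c])
       (use n in auto)
qed

text \<open>Put f(y) = 2 y B'(y), the derivative symbol up to a factor. The equation gives f' = (2 -
  n) B' - B / 2, so B and B' are controlled by f and f' for x \<ge> 1, and the lower bound for |B| +
  |B'| transfers to |f| + |f'|.\<close>

lemma bessel_re'_lower:
  assumes n: "n \<ge> 2"
  shows "\<exists>\<kappa>>0. \<exists>M. \<forall>x\<ge>1. \<exists>y. x \<le> y \<and> y \<le> x + 1 \<and> \<kappa> / x ^ M \<le> \<bar>2 * y * bessel_re' n y\<bar>"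
proof -
  obtain c where c: "c > 0" "c \<le> 1" "\<And>x. x \<ge> 1 \<Longrightarrow> c / x ^ (n + 1) \<le> \<bar>bessel_re n x\<bar> + \<bar>bessel_re' n x\<bar>"
    using bessel_re_jet_lower[OF n] by blast
  have d1: "((\<lambda>y. 2 * y * bessel_re' n y) has_real_derivative (2 - real n) * bessel_re' n x - bessel_re n x / 2) (at x)" for x
  proof -
    have "((\<lambda>y. 2 * y * bessel_re' n y) has_real_derivative 2 * bessel_re' n x + 2 * x * bessel_re'' n x) (at x)"
      by (auto intro!: derivative_eq_intros bessel_re'_deriv[OF n])
    moreover have "2 * bessel_re' n x + 2 * x * bessel_re'' n x = (2 - real n) * bessel_re' n x - bessel_re n x / 2"
      using bessel_re_ode[OF n, of x] by (simp add: algebra_simps)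
    ultimately show ?thesis by (simp only:)
  qed
  have d2: "((\<lambda>x. (2 - real n) * bessel_re' n x - bessel_re n x / 2) has_real_derivative
      (2 - real n) * bessel_re'' n x - bessel_re' n x / 2) (at x)" for x
    by (auto intro!: derivative_eq_intros bessel_re'_deriv[OF n] bessel_re_deriv[OF n])
  have K: "\<bar>(2 - real n) * bessel_re'' n x - bessel_re' n x / 2\<bar> \<le> real n * real n + 1" if x: "x \<ge> 1" for x
  proof -
    have "\<bar>2 - real n\<bar> * \<bar>bessel_re'' n x\<bar> \<le> real n * real n"
      using n bessel_re_bounds(3)[OF n x] by (intro mult_mono) auto
    then have "\<bar>(2 - real n) * bessel_re'' n x\<bar> \<le> real n * real n" by (simp only: abs_mult)
    then show ?thesis using bessel_re_bounds(2)[OF n x] by linarith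
  qed
  have large: "c / (real n + 2) / x ^ (n + 1) \<le> \<bar>2 * x * bessel_re' n x\<bar> + \<bar>(2 - real n) * bessel_re' n x - bessel_re n x / 2\<bar>"
    if x: "x \<ge> 1" for x
  proof -
    define a b X Y where "a = bessel_re n x" "b = bessel_re' n x" "X = 2 * x * b" "Y = (2 - real n) * b - a / 2"
    have "2 * \<bar>b\<bar> \<le> 2 * x * \<bar>b\<bar>" using x by (intro mult_right_mono) auto
    also have "\<dots> = \<bar>X\<bar>" using x by (simp add: a_b_X_Y_def abs_mult)
    finally have b: "2 * \<bar>b\<bar> \<le> \<bar>X\<bar>" .
    have "a = 2 * (2 - real n) * b - 2 * Y" by (simp add: a_b_X_Y_def)
    then have "\<bar>a\<bar> \<le> \<bar>2 * (2 - real n) * b\<bar> + 2 * \<bar>Y\<bar>" by linarith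
    also have "\<bar>2 * (2 - real n) * b\<bar> = (real n - 2) * (2 * \<bar>b\<bar>)" using n by (simp add: abs_mult)
    also have "\<dots> \<le> (real n - 2) * \<bar>X\<bar>" using b n by (intro mult_left_mono) auto
    finally have "\<bar>a\<bar> + \<bar>b\<bar> \<le> (real n - 2) * \<bar>X\<bar> + \<bar>X\<bar> + 2 * \<bar>Y\<bar>" using b by linarith
    also have "\<dots> \<le> (real n + 2) * (\<bar>X\<bar> + \<bar>Y\<bar>)" using n by (simp add: algebra_simps)
    finally have "c / x ^ (n + 1) \<le> (real n + 2) * (\<bar>X\<bar> + \<bar>Y\<bar>)"
      using c(3)[OF x] by (simp add: a_b_X_Y_def)
    then have "c / x ^ (n + 1) / (real n + 2) \<le> \<bar>X\<bar> + \<bar>Y\<bar>"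
      by (subst pos_divide_le_eq) (auto simp: mult.commute)
    then show ?thesis by (simp add: a_b_X_Y_def mult.commute)
  qed
  show ?thesis
    by (rule power_lower_bound_nearby[OF d1 d2 K _ _ _ large]) (use c n in \<open>auto simp: divide_le_eq\<close>)
qed

text \<open>Every exponential in \<open>sphere_prob_exp\<close> has norm at most exp |Im w|, and
  therefore so does their mean.\<close>

lemma norm_bessel_square_le:
  assumes "CARD('n::finite) \<ge> 2"
  shows "norm (bessel CARD('n) (w\<^sup>2)) \<le> exp \<bar>Im w\<bar>"
proof -
  interpret prob_space "sphere_prob :: (real^'n) measure" by (rule prob_space_sphere_prob)
  obtain i :: 'n where True by blast
  have bound: "norm (exp (- \<i> * of_real (\<omega> $ i) * w)) \<le> exp \<bar>Im w\<bar>" if "norm \<omega> = 1" for \<omega> :: "real^'n"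
  proof -
    have "\<bar>\<omega> $ i\<bar> \<le> 1" using component_le_norm_cart[of \<omega> i] that by simp
    then have "\<bar>\<omega> $ i * Im w\<bar> \<le> 1 * \<bar>Im w\<bar>" unfolding abs_mult by (rule mult_right_mono) simp
    then show ?thesis by simp
  qed
  have int: "integrable sphere_prob (\<lambda>\<omega>::real^'n. exp (- \<i> * of_real (\<omega> $ i) * w))"
    by (rule integrable_sphere_prob_bounded[OF _ bound]) (auto intro!: borel_measurable_continuous_onI continuous_intros)
  have "norm (bessel CARD('n) (w\<^sup>2)) \<le> (LINT \<omega>|(sphere_prob :: (real^'n) measure). norm (exp (- \<i> * of_real (\<omega> $ i) * w)))"
    unfolding sphere_prob_exp[OF assms, of i, symmetric] by (rule integral_norm_bound)
  also have "\<dots> \<le> (LINT \<omega>|(sphere_prob :: (real^'n) measure). exp \<bar>Im w\<bar>)"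
    using AE_sphere_prob bound by (intro integral_mono_AE integrable_norm int) (auto elim: eventually_mono)
  also have "\<dots> = exp \<bar>Im w\<bar>" using prob_space by simp
  finally show ?thesis .
qed

text \<open>The left side is the derivative of w \<mapsto> bessel(w^2). Cauchy's inequality on the
  unit circle about w applies, and |Im| grows there by at most 1.\<close>

lemma norm_bessel'_square_le:
  assumes "CARD('n::finite) \<ge> 2"
  shows "norm (2 * w * bessel' CARD('n) (w\<^sup>2)) \<le> exp (\<bar>Im w\<bar> + 1)"
proof -
  let ?\<Phi> = "\<lambda>w. bessel CARD('n) (w\<^sup>2)"
  have d: "(?\<Phi> has_field_derivative bessel' CARD('n) (w\<^sup>2) * (2 * w)) (at w)" for w
    by (rule DERIV_chain2[where f = "bessel CARD('n)" and g = "\<lambda>w. w\<^sup>2", OF DERIV_bessel])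
       (use assms in \<open>auto intro!: derivative_eq_intros\<close>)
  have hol: "?\<Phi> holomorphic_on A" for A
    using d by (auto simp: holomorphic_on_def field_differentiable_def intro: has_field_derivative_at_within)
  have "norm ((deriv ^^ 1) ?\<Phi> w) \<le> fact 1 * exp (\<bar>Im w\<bar> + 1) / 1 ^ 1"
  proof (rule Cauchy_inequality)
    fix z assume "norm (w - z) = 1"
    then have "\<bar>Im z\<bar> \<le> \<bar>Im w\<bar> + 1" using abs_Im_le_cmod[of "w - z"] by simp
    then show "norm (?\<Phi> z) \<le> exp (\<bar>Im w\<bar> + 1)"
      using norm_bessel_square_le[OF assms, of z] by (meson exp_le_cancel_iff order_trans)
  qed (auto intro!: hol holomorphic_on_imp_continuous_on)
  then show ?thesis using DERIV_imp_deriv[OF d, of w] by (simp add: mult.commute mult.left_commute)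
qed

section \<open>The symbols of the two distributions\<close>

theorem bessel_symbol:
  assumes n: "CARD('n::finite) \<ge> 2" and r: "r > 0"
  shows "slowly_decreasing_symbol (\<lambda>s. bessel CARD('n) (of_real (r\<^sup>2) * s))
    (\<lambda>s. bessel' CARD('n) (of_real (r\<^sup>2) * s) * of_real (r\<^sup>2))"
proof
  show "((\<lambda>s. bessel CARD('n) (of_real (r\<^sup>2) * s)) has_field_derivative bessel' CARD('n) (of_real (r\<^sup>2) * s) * of_real (r\<^sup>2)) (at s)" for s
    by (rule DERIV_chain2[where f = "bessel CARD('n)" and g = "\<lambda>s. of_real (r\<^sup>2) * s", OF DERIV_bessel])
       (use n in \<open>auto intro!: derivative_eq_intros\<close>)
  show "bessel' CARD('n) (of_real (r\<^sup>2) * s) * of_real (r\<^sup>2) \<noteq> 0" if "bessel CARD('n) (of_real (r\<^sup>2) * s) = 0" for s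
    using bessel_zeros_simple[of "CARD('n)" "of_real (r\<^sup>2) * s"] that n r by (cases "s = 0") auto
  obtain \<kappa> A M where *: "\<kappa> > 0" "A \<ge> 0" "\<And>s. s \<ge> 0 \<Longrightarrow> \<exists>t. s \<le> t \<and> t \<le> s + A \<and> \<kappa> / (1 + s) ^ M \<le> \<bar>bessel_re CARD('n) (r\<^sup>2 * t)\<bar>"
    using rescale_lower_bound[OF bessel_re_lower[OF n] r] by blast
  have le: "\<bar>bessel_re CARD('n) (r\<^sup>2 * t)\<bar> \<le> norm (bessel CARD('n) (of_real (r\<^sup>2) * of_real t))" for t
    using abs_Re_le_cmod[of "bessel CARD('n) (of_real (r\<^sup>2) * of_real t)"] by (simp add: bessel_re_def)
  show "\<exists>\<kappa>>0. \<exists>A\<ge>0. \<exists>M. \<forall>s\<ge>0. \<exists>t. s \<le> t \<and> t \<le> s + A \<and> \<kappa> / (1 + s) ^ M \<le> norm (bessel CARD('n) (of_real (r\<^sup>2) * of_real t))"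
    using * le by (meson order_trans)
  have "norm (bessel CARD('n) (of_real (r\<^sup>2) * w\<^sup>2)) \<le> 1 * (1 + norm w) * exp (r * \<bar>Im w\<bar>)" for w
  proof -
    have "norm (bessel CARD('n) (of_real (r\<^sup>2) * w\<^sup>2)) \<le> exp (r * \<bar>Im w\<bar>)"
      using norm_bessel_square_le[OF n, of "of_real r * w"] r by (simp add: power_mult_distrib abs_mult)
    also have "\<dots> \<le> (1 * (1 + norm w)) * exp (r * \<bar>Im w\<bar>)"
      by (simp add: mult_le_cancel_right1)
    finally show ?thesis .
  qed
  then show "\<exists>C\<ge>0. \<exists>A\<ge>0. \<forall>w. norm (bessel CARD('n) (of_real (r\<^sup>2) * w\<^sup>2)) \<le> C * (1 + norm w) * exp (A * \<bar>Im w\<bar>)"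
    using r by (intro exI[of _ 1] exI[of _ r] conjI allI) auto
qed

text \<open>The zeros are of two kinds. At s = 0 the derivative is 2 r \<open>bessel' n 0\<close> =
  - r / n. At a zero of \<open>bessel'\<close> off the origin \<open>bessel\<close> does not vanish,
  so by the equation \<open>bessel''\<close> does not vanish either.\<close>

theorem bessel_deriv_symbol:
  assumes n: "CARD('n::finite) \<ge> 2" and r: "r > 0"
  shows "slowly_decreasing_symbol (\<lambda>s. 2 * of_real r * s * bessel' CARD('n) (of_real (r\<^sup>2) * s))
    (\<lambda>s. 2 * of_real r * bessel' CARD('n) (of_real (r\<^sup>2) * s) + 2 * of_real r * s * (bessel'' CARD('n) (of_real (r\<^sup>2) * s) * of_real (r\<^sup>2)))"
proof
  have n1: "CARD('n) \<ge> 1" using n by simp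
  have d: "((\<lambda>s. bessel' CARD('n) (of_real (r\<^sup>2) * s)) has_field_derivative bessel'' CARD('n) (of_real (r\<^sup>2) * s) * of_real (r\<^sup>2)) (at s)" for s
    by (rule DERIV_chain2[where f = "bessel' CARD('n)" and g = "\<lambda>s. of_real (r\<^sup>2) * s", OF DERIV_bessel'[OF n1]])
       (auto intro!: derivative_eq_intros)
  show "((\<lambda>s. 2 * of_real r * s * bessel' CARD('n) (of_real (r\<^sup>2) * s)) has_field_derivative
     2 * of_real r * bessel' CARD('n) (of_real (r\<^sup>2) * s) + 2 * of_real r * s * (bessel'' CARD('n) (of_real (r\<^sup>2) * s) * of_real (r\<^sup>2))) (at s)" for s
    by (rule DERIV_cong[OF DERIV_mult[OF _ d]]) (auto intro!: derivative_eq_intros)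
  show "2 * of_real r * bessel' CARD('n) (of_real (r\<^sup>2) * s) + 2 * of_real r * s * (bessel'' CARD('n) (of_real (r\<^sup>2) * s) * of_real (r\<^sup>2)) \<noteq> 0"
    if 0: "2 * of_real r * s * bessel' CARD('n) (of_real (r\<^sup>2) * s) = 0" for s
  proof (cases "s = 0")
    case True
    then show ?thesis using r n1 by (simp add: bessel'_0)
  next
    case False
    define \<sigma> where "\<sigma> = of_real (r\<^sup>2) * s"
    have s: "\<sigma> \<noteq> 0" "bessel' CARD('n) \<sigma> = 0" using False 0 r by (auto simp: \<sigma>_def)
    then have "bessel CARD('n) \<sigma> \<noteq> 0" using bessel_zeros_simple[OF n1, of \<sigma>] by blast
    then have "bessel'' CARD('n) \<sigma> \<noteq> 0" using bessel_ode[OF n1, of \<sigma>] s by auto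
    then show ?thesis using s False r unfolding \<sigma>_def[symmetric] by simp
  qed
  obtain \<kappa> A M where *: "\<kappa> > 0" "A \<ge> 0" "\<And>s. s \<ge> 0 \<Longrightarrow> \<exists>t. s \<le> t \<and> t \<le> s + A \<and> \<kappa> / (1 + s) ^ M \<le> \<bar>2 * (r\<^sup>2 * t) * bessel_re' CARD('n) (r\<^sup>2 * t)\<bar>"
    using rescale_lower_bound[OF bessel_re'_lower[OF n] r] by blast
  have le: "\<bar>2 * (r\<^sup>2 * t) * bessel_re' CARD('n) (r\<^sup>2 * t)\<bar> / r \<le> norm (2 * of_real r * of_real t * bessel' CARD('n) (of_real (r\<^sup>2) * of_real t))" for t
  proof -
    have "\<bar>2 * (r\<^sup>2 * t) * bessel_re' CARD('n) (r\<^sup>2 * t)\<bar> / r = \<bar>2 * r * t\<bar> * \<bar>bessel_re' CARD('n) (r\<^sup>2 * t)\<bar>"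
      using r by (simp add: abs_mult power2_eq_square)
    also have "\<dots> \<le> \<bar>2 * r * t\<bar> * norm (bessel' CARD('n) (of_real (r\<^sup>2) * of_real t))"
      using abs_Re_le_cmod[of "bessel' CARD('n) (of_real (r\<^sup>2) * of_real t)"]
      by (intro mult_left_mono) (auto simp: bessel_re'_def)
    also have "\<dots> = norm (2 * of_real r * of_real t * bessel' CARD('n) (of_real (r\<^sup>2) * of_real t))"
      by (simp add: norm_mult abs_mult)
    finally show ?thesis .
  qed
  show "\<exists>\<kappa>>0. \<exists>A\<ge>0. \<exists>M. \<forall>s\<ge>0. \<exists>t. s \<le> t \<and> t \<le> s + A \<and> \<kappa> / (1 + s) ^ M \<le> norm (2 * of_real r * of_real t * bessel' CARD('n) (of_real (r\<^sup>2) * of_real t))"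
  proof (rule ex_lower_boundI[where \<kappa> = "\<kappa> / r" and A = A and M = M])
    show "\<kappa> / r > 0" using * r by simp
    fix s :: real assume "s \<ge> 0"
    then obtain t where t: "s \<le> t" "t \<le> s + A" "\<kappa> / (1 + s) ^ M \<le> \<bar>2 * (r\<^sup>2 * t) * bessel_re' CARD('n) (r\<^sup>2 * t)\<bar>"
      using * by blast
    then have "\<kappa> / (1 + s) ^ M / r \<le> \<bar>2 * (r\<^sup>2 * t) * bessel_re' CARD('n) (r\<^sup>2 * t)\<bar> / r"
      using r by (intro divide_right_mono) auto
    then show "\<exists>t. s \<le> t \<and> t \<le> s + A \<and> \<kappa> / r / (1 + s) ^ M \<le> norm (2 * of_real r * of_real t * bessel' CARD('n) (of_real (r\<^sup>2) * of_real t))"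
      using t le[of t] by (intro exI[of _ t]) (auto simp: divide_divide_eq_left' mult.commute)
  qed (rule *)
  have "norm (2 * of_real r * w\<^sup>2 * bessel' CARD('n) (of_real (r\<^sup>2) * w\<^sup>2)) \<le> exp 1 * (1 + norm w) * exp (r * \<bar>Im w\<bar>)" for w
  proof -
    \<comment> \<open>One factor w is split off; the rest is the derivative of v \<mapsto>
      bessel(v^2) at v = r w. This w is the origin of the factor \<open>1 + norm w\<close> in the
      growth condition.\<close>
    have "2 * of_real r * w\<^sup>2 * bessel' CARD('n) (of_real (r\<^sup>2) * w\<^sup>2) = w * (2 * (of_real r * w) * bessel' CARD('n) ((of_real r * w)\<^sup>2))"
      by (simp add: power2_eq_square mult_ac)
    also have "norm \<dots> \<le> norm w * exp (\<bar>Im (of_real r * w)\<bar> + 1)"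
      unfolding norm_mult[of w] by (intro mult_left_mono norm_bessel'_square_le[OF n]) auto
    also have "\<dots> = exp 1 * norm w * exp (r * \<bar>Im w\<bar>)" using r by (simp add: exp_add abs_mult)
    also have "\<dots> \<le> exp 1 * (1 + norm w) * exp (r * \<bar>Im w\<bar>)" by (intro mult_right_mono mult_left_mono) auto
    finally show ?thesis .
  qed
  then show "\<exists>C\<ge>0. \<exists>A\<ge>0. \<forall>w. norm (2 * of_real r * w\<^sup>2 * bessel' CARD('n) (of_real (r\<^sup>2) * w\<^sup>2)) \<le> C * (1 + norm w) * exp (A * \<bar>Im w\<bar>)"
    using r by (intro exI[of _ "exp 1"] exI[of _ r] conjI allI) auto
qed


subsection \<open>Entire functions given by integrals\<close>

lemma norm_exp_remainder: "norm (exp z - 1 - z) \<le> exp (norm z) * (norm z)\<^sup>2" for z :: complex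
proof -
  have "norm (exp z - (\<Sum>k\<le>1. z ^ k / fact k)) \<le> exp \<bar>Re z\<bar> * norm z ^ Suc 1 / fact 1"
    by (rule Taylor_exp)
  also have "\<dots> \<le> exp (norm z) * (norm z)\<^sup>2"
    using abs_Re_le_cmod[of z] by (simp add: numeral_2_eq_2 mult_right_mono)
  finally show ?thesis by (simp add: algebra_simps)
qed

text \<open>The frequencies X are bounded where f is nonzero, so all remainders are uniform for
  bounded z. The measure is left general because the result is applied to Lebesgue measure and to
  \<open>sphere_prob\<close>.\<close>

lemma holomorphic_exp_integral:
  fixes f :: "'a \<Rightarrow> complex" and X :: "'a \<Rightarrow> real"
  assumes f: "integrable M f" and X[measurable]: "X \<in> borel_measurable M"
    and bound: "AE y in M. f y \<noteq> 0 \<longrightarrow> \<bar>X y\<bar> \<le> R" and R: "R \<ge> 0"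
  shows "(\<lambda>z. LINT y|M. f y * exp (- \<i> * of_real (X y) * z)) holomorphic_on UNIV"
    and "integrable M (\<lambda>y. f y * exp (- \<i> * of_real (X y) * z))"
proof -
  have [measurable]: "f \<in> borel_measurable M" using f by auto
  have nexp: "norm (exp (- \<i> * of_real (X y) * z)) \<le> exp (R * norm z)" if "\<bar>X y\<bar> \<le> R" for y z
  proof -
    have "Re (- \<i> * of_real (X y) * z) \<le> norm (- \<i> * of_real (X y) * z)" by (rule complex_Re_le_cmod)
    also have "\<dots> \<le> R * norm z" using that by (simp add: norm_mult mult_right_mono)
    finally show ?thesis by (simp only: norm_exp_eq_Re exp_le_cancel_iff)
  qed
  have int: "integrable M (\<lambda>y. f y * (of_real (X y) ^ m * exp (- \<i> * of_real (X y) * z)))" for z and m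
  proof (rule Bochner_Integration.integrable_bound)
    show "integrable M (\<lambda>y. norm (f y) * (R ^ m * exp (R * norm z)))" by (intro integrable_mult_left integrable_norm f)
    show "AE y in M. norm (f y * (of_real (X y) ^ m * exp (- \<i> * of_real (X y) * z))) \<le> norm (norm (f y) * (R ^ m * exp (R * norm z)))"
      using bound
    proof eventually_elim
      case (elim y)
      show ?case
      proof (cases "f y = 0")
        case False
        then have X: "\<bar>X y\<bar> \<le> R" using elim by blast
        have "norm (of_real (X y) ^ m * exp (- \<i> * of_real (X y) * z)) \<le> R ^ m * exp (R * norm z)"
          unfolding norm_mult[of "of_real (X y) ^ m"] norm_power norm_of_real
          using X R by (intro mult_mono power_mono nexp) auto
        then show ?thesis using R by (simp add: norm_mult mult_left_mono abs_mult)
      qed simp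
    qed
  qed measurable
  show "integrable M (\<lambda>y. f y * exp (- \<i> * of_real (X y) * z))" for z
    using int[of 0 z] by simp
  have "(\<lambda>z. LINT y|M. f y * exp (- \<i> * of_real (X y) * z)) field_differentiable at z" for z
  proof -
    define c where "c = (\<lambda>y. f y * (- \<i>) * (of_real (X y) * exp (- \<i> * of_real (X y) * z)))"
    have c: "integrable M c"
      using integrable_mult_left[OF int[of 1 z], of "- \<i>"] by (simp add: c_def mult_ac)
    have "((\<lambda>z. LINT y|M. f y * exp (- \<i> * of_real (X y) * z)) has_derivative (\<lambda>h. LINT y|M. c y * h)) (at z)"
    proof (rule has_derivative_integral[where B = "\<lambda>y. norm (c y)" and K = "\<lambda>y. norm (f y) * (R\<^sup>2 * exp R * exp (R * norm z))"])
      show "integrable M (\<lambda>y. f y * exp (- \<i> * of_real (X y) * (z + h)))" for h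
        using int[of 0 "z + h"] by simp
      show "integrable M (\<lambda>y. c y * h)" for h by (intro integrable_mult_left c)
      show "linear ((*) (c y))" for y by (rule linearI) (auto simp: algebra_simps)
      show "integrable M (\<lambda>y. norm (c y))" using c by simp
      show "AE y in M. norm (c y * h) \<le> norm h * norm (c y)" for h by (simp add: norm_mult)
      show "integrable M (\<lambda>y. norm (f y) * (R\<^sup>2 * exp R * exp (R * norm z)))" by (intro integrable_mult_left integrable_norm f)
      show "AE y in M. norm (f y * exp (- \<i> * of_real (X y) * (z + h)) - f y * exp (- \<i> * of_real (X y) * z) - c y * h)
          \<le> (norm h)\<^sup>2 * (norm (f y) * (R\<^sup>2 * exp R * exp (R * norm z)))" if h: "norm h \<le> 1" for h
        using bound
      proof eventually_elim
        case (elim y)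
        show ?case
        proof (cases "f y = 0")
          case True
          then show ?thesis by (simp add: c_def)
        next
          case False
          then have X: "\<bar>X y\<bar> \<le> R" using elim by blast
          let ?w = "- \<i> * of_real (X y) * h"
          have w: "norm ?w \<le> R * norm h" using X by (simp add: norm_mult mult_right_mono)
          also have "\<dots> \<le> R * 1" using h R by (intro mult_left_mono) auto
          finally have w1: "norm ?w \<le> R" by simp
          have "f y * exp (- \<i> * of_real (X y) * (z + h)) - f y * exp (- \<i> * of_real (X y) * z) - c y * h =
            f y * exp (- \<i> * of_real (X y) * z) * (exp ?w - 1 - ?w)"
            by (simp add: c_def exp_add[symmetric] algebra_simps)
          also have "norm \<dots> \<le> norm (f y) * exp (R * norm z) * (exp R * (R * norm h)\<^sup>2)"
          proof -
            have "norm (exp ?w - 1 - ?w) \<le> exp (norm ?w) * (norm ?w)\<^sup>2" by (rule norm_exp_remainder)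
            also have "\<dots> \<le> exp R * (R * norm h)\<^sup>2" using w w1 by (intro mult_mono power_mono) auto
            finally show ?thesis
              unfolding norm_mult[of "f y * _"] norm_mult[of "f y"] by (intro mult_mono nexp X) auto
          qed
          finally show ?thesis by (simp add: power_mult_distrib mult_ac)
        qed
      qed
    qed
    then have "((\<lambda>z. LINT y|M. f y * exp (- \<i> * of_real (X y) * z)) has_field_derivative (LINT y|M. c y)) (at z)"
      unfolding has_field_derivative_def by (simp add: integral_mult_left_zero)
    then show ?thesis by (auto simp: field_differentiable_def)
  qed
  then show "(\<lambda>z. LINT y|M. f y * exp (- \<i> * of_real (X y) * z)) holomorphic_on UNIV"
    by (auto simp: holomorphic_on_def field_differentiable_at_within)
qed

subsection \<open>Fourier transforms of test functions\<close>

abbreviation ft :: "(real^'n \<Rightarrow> complex) \<Rightarrow> complex^'n \<Rightarrow> complex" where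
  "ft w \<equiv> fourier (distr_of_fun w)"

lemma ft_eq: "ft w \<zeta> = (LINT x|lborel. w x * exp (- \<i> * (\<Sum>j\<in>UNIV. complex_of_real (x $ j) * \<zeta> $ j)))"
  by (simp add: fourier_def distr_of_fun_def)

definition pdiff :: "'n::finite \<Rightarrow> (real^'n \<Rightarrow> complex) \<Rightarrow> real^'n \<Rightarrow> complex" where
  "pdiff i f x = frechet_derivative f (at x) (axis i 1)"

lemma C_infinity_pdiff: "f \<in> C_infinity \<Longrightarrow> pdiff i f \<in> C_infinity"
  unfolding C_infinity_def pdiff_def[abs_def] using C_k.simps(2) by blast

lemma C_infinity_differentiable: "f \<in> C_infinity \<Longrightarrow> f differentiable (at x)"
  unfolding C_infinity_def using C_k.simps(2)[of 0 f] by blast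

lemma C_infinity_continuous: "f \<in> C_infinity \<Longrightarrow> continuous_on UNIV f"
  unfolding C_infinity_def using C_k.simps(1)[of f] by blast

lemma test_functions_continuous: "f \<in> test_functions \<Longrightarrow> continuous_on UNIV f"
  by (simp add: test_functions_def C_infinity_continuous)

lemma test_functions_support:
  fixes f :: "real^'n \<Rightarrow> complex"
  assumes "f \<in> test_functions"
  obtains R where "R > 0" "\<And>x. f x \<noteq> 0 \<Longrightarrow> norm x \<le> R"
proof -
  have "bounded (closure {x. f x \<noteq> 0})" using assms by (auto simp: test_functions_def compact_imp_bounded)
  then obtain R where "R > 0" "\<forall>x\<in>closure {x. f x \<noteq> 0}. norm x \<le> R" by (auto simp: bounded_pos)
  then show ?thesis using that closure_subset[of "{x. f x \<noteq> 0}"] by blast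
qed

lemma test_functionsI:
  fixes f :: "real^'n \<Rightarrow> complex"
  assumes "f \<in> C_infinity" and "\<And>x. f x \<noteq> 0 \<Longrightarrow> norm x \<le> R"
  shows "f \<in> test_functions"
proof -
  have "bounded {x. f x \<noteq> 0}" using assms(2) by (auto simp: bounded_iff)
  then show ?thesis using assms(1) by (simp add: test_functions_def compact_closure)
qed

lemma frechet_derivative_eq_0:
  assumes "x \<notin> closure {x. f x \<noteq> 0}"
  shows "frechet_derivative f (at x) = (\<lambda>_. 0)"
proof -
  have "((\<lambda>_. 0) has_derivative (\<lambda>_. 0)) (at x)" by simp
  then have "(f has_derivative (\<lambda>_. 0)) (at x)"
    by (rule has_derivative_transform_within_open[where s = "- closure {x. f x \<noteq> 0}"])
       (use assms closure_subset[of "{x. f x \<noteq> 0}"] in auto)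
  then show ?thesis by (rule frechet_derivative_at[symmetric])
qed

lemma test_functions_pdiff:
  fixes f :: "real^'n \<Rightarrow> complex"
  assumes "f \<in> test_functions" shows "pdiff i f \<in> test_functions"
proof -
  have "pdiff i f x = 0" if "x \<notin> closure {x. f x \<noteq> 0}" for x
    unfolding pdiff_def frechet_derivative_eq_0[OF that] ..
  then have "{x. pdiff i f x \<noteq> 0} \<subseteq> closure {x. f x \<noteq> 0}" by blast
  then have "closure {x. pdiff i f x \<noteq> 0} \<subseteq> closure {x. f x \<noteq> 0}"
    by (intro closure_minimal) auto
  then show ?thesis
    using assms C_infinity_pdiff
    unfolding test_functions_def by (auto simp: compact_eq_bounded_closed intro: bounded_subset)
qed

lemma test_functions_bounded:
  fixes f :: "real^'n \<Rightarrow> complex"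
  assumes "f \<in> test_functions"
  obtains B where "B > 0" "\<And>x. norm (f x) \<le> B"
proof -
  obtain R where R: "R > 0" "\<And>x. f x \<noteq> 0 \<Longrightarrow> norm x \<le> R" by (rule test_functions_support[OF assms]) blast
  have "continuous_on (cball 0 R) f" using test_functions_continuous[OF assms] by (rule continuous_on_subset) simp
  then have "bounded (f ` cball 0 R)" by (intro compact_imp_bounded compact_continuous_image) auto
  then obtain B where B: "B > 0" "\<forall>y\<in>f ` cball 0 R. norm y \<le> B" by (auto simp: bounded_pos)
  have "norm (f x) \<le> B" for x
    using B R(2)[of x] by (cases "f x = 0") auto
  then show ?thesis using that B by blast
qed

lemma integrable_bounded_support:
  fixes f :: "real^'n \<Rightarrow> complex"
  assumes [measurable]: "f \<in> borel_measurable borel" and "\<And>x. norm (f x) \<le> B" and supp: "\<And>x. f x \<noteq> 0 \<Longrightarrow> norm x \<le> R"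
  shows "integrable lborel f"
proof (rule Bochner_Integration.integrable_bound)
  show "integrable lborel (\<lambda>x. B * indicator (cball (0::real^'n) R) x)"
    using emeasure_lborel_cball_finite[of "0::real^'n" R]
    by (intro integrable_mult_right integrable_real_indicator) auto
  show "AE x in lborel. norm (f x) \<le> norm (B * indicator (cball 0 R) x)"
  proof (rule AE_I2)
    fix x
    have "0 \<le> B" using assms(2)[of x] norm_ge_zero[of "f x"] by linarith
    then show "norm (f x) \<le> norm (B * indicator (cball 0 R) x)"
      using assms(2)[of x] supp[of x] by (cases "f x = 0") (auto simp: indicator_def)
  qed
qed measurable

lemma test_functions_measurable: "f \<in> test_functions \<Longrightarrow> f \<in> borel_measurable borel"
  by (intro borel_measurable_continuous_onI test_functions_continuous)

lemma test_functions_integrable: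
  assumes "f \<in> test_functions" shows "integrable lborel f"
proof -
  obtain R where "R > 0" "\<And>x. f x \<noteq> 0 \<Longrightarrow> norm x \<le> R" by (rule test_functions_support[OF assms]) blast
  moreover obtain B where "B > 0" "\<And>x. norm (f x) \<le> B" by (rule test_functions_bounded[OF assms]) blast
  ultimately show ?thesis
    by (intro integrable_bounded_support test_functions_measurable assms) auto
qed

lemma difference_quotient_pdiff:
  fixes f :: "real^'n \<Rightarrow> complex"
  assumes "f \<in> C_infinity"
  shows "((\<lambda>t. f (x + t *\<^sub>R axis i 1)) has_vector_derivative pdiff i f (x + t *\<^sub>R axis i 1)) (at t)"
proof -
  have "(f has_derivative frechet_derivative f (at (x + t *\<^sub>R axis i 1))) (at (x + t *\<^sub>R axis i 1))"
    using C_infinity_differentiable[OF assms] frechet_derivative_works by blast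
  moreover have "((\<lambda>t. x + t *\<^sub>R axis i 1) has_derivative (\<lambda>h. h *\<^sub>R axis i 1)) (at t)"
    by (auto intro!: derivative_eq_intros)
  ultimately have "((\<lambda>t. f (x + t *\<^sub>R axis i 1)) has_derivative (\<lambda>h. frechet_derivative f (at (x + t *\<^sub>R axis i 1)) (h *\<^sub>R axis i 1))) (at t)"
    using diff_chain_at by (fastforce simp: o_def)
  moreover have "linear (frechet_derivative f (at (x + t *\<^sub>R axis i 1)))"
    using C_infinity_differentiable[OF assms] linear_frechet_derivative by blast
  ultimately show ?thesis
    unfolding has_vector_derivative_def pdiff_def by (simp add: linear_cmul)
qed

text \<open>Integration by parts through difference quotients: translation invariance computes the
  transform of a difference quotient exactly, and dominated convergence passes to the
  derivative.\<close>

lemma ft_pdiff: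
  fixes w :: "real^'n \<Rightarrow> complex"
  assumes w: "w \<in> test_functions"
  shows "ft (pdiff i w) \<zeta> = \<i> * \<zeta> $ i * ft w \<zeta>"
proof -
  let ?e = "axis i 1 :: real^'n"
  define E where "E = (\<lambda>x::real^'n. exp (- \<i> * (\<Sum>j\<in>UNIV. complex_of_real (x $ j) * \<zeta> $ j)))"
  have contE: "continuous_on UNIV E" unfolding E_def by (intro continuous_intros)
  have [measurable]: "E \<in> borel_measurable borel" by (intro borel_measurable_continuous_onI contE)
  have [measurable]: "w \<in> borel_measurable borel" by (rule test_functions_measurable[OF w])
  have [measurable]: "pdiff i w \<in> borel_measurable borel" by (intro test_functions_measurable test_functions_pdiff w)
  have wC: "w \<in> C_infinity" using w by (simp add: test_functions_def)
  obtain L where L: "L > 0" "\<And>x. norm (pdiff i w x) \<le> L"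
    by (rule test_functions_bounded[OF test_functions_pdiff[OF w]]) blast
  obtain R where R: "R > 0" "\<And>x. w x \<noteq> 0 \<Longrightarrow> norm x \<le> R" by (rule test_functions_support[OF w]) blast
  have "continuous_on (cball 0 (R + 1)) E" using contE by (rule continuous_on_subset) simp
  then have "bounded (E ` cball 0 (R + 1))" by (intro compact_imp_bounded compact_continuous_image) auto
  then obtain B where B: "B > 0" "\<And>x. norm x \<le> R + 1 \<Longrightarrow> norm (E x) \<le> B" by (auto simp: bounded_pos)
  have lip: "norm (w (x + t *\<^sub>R ?e) - w x) \<le> L * \<bar>t\<bar>" for x t
  proof -
    have "norm (w (x + t *\<^sub>R ?e) - w (x + 0 *\<^sub>R ?e)) \<le> L * norm (t - 0)"
    proof (rule differentiable_bound[where S = UNIV and f' = "\<lambda>t h. h *\<^sub>R pdiff i w (x + t *\<^sub>R ?e)"])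
      show "((\<lambda>t. w (x + t *\<^sub>R ?e)) has_derivative (\<lambda>h. h *\<^sub>R pdiff i w (x + t *\<^sub>R ?e))) (at t)" for t
        using difference_quotient_pdiff[OF wC] by (simp add: has_vector_derivative_def)
      show "onorm (\<lambda>h. h *\<^sub>R pdiff i w (x + t *\<^sub>R ?e)) \<le> L" for t
      proof (rule onorm_bound)
        show "norm (h *\<^sub>R pdiff i w (x + t *\<^sub>R ?e)) \<le> L * norm h" for h
          using mult_left_mono[OF L(2)[of "x + t *\<^sub>R ?e"], of "\<bar>h\<bar>"] by (simp add: mult.commute)
      qed (use L in simp)
    qed auto
    then show ?thesis by simp
  qed
  define \<epsilon> :: "nat \<Rightarrow> real" where "\<epsilon> = (\<lambda>k. 1 / real (Suc k))"
  have e: "\<epsilon> k > 0" "\<epsilon> k \<le> 1" for k by (auto simp: \<epsilon>_def)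
  have elim: "\<epsilon> \<longlonglongrightarrow> 0" unfolding \<epsilon>_def by real_asymp
  have efilt: "filterlim \<epsilon> (at 0) sequentially"
    unfolding filterlim_at using elim e by (auto simp: less_imp_neq[symmetric])
  have shift: "(LINT x|lborel. w (x + t *\<^sub>R ?e) * E x) = exp (\<i> * of_real t * \<zeta> $ i) * ft w \<zeta>" for t
  proof -
    have "(\<lambda>x. w x * E (x - t *\<^sub>R ?e)) \<in> borel_measurable borel" by measurable
    from integral_lborel_translate[OF this, of "t *\<^sub>R ?e"]
    have "(LINT x|lborel. w (x + t *\<^sub>R ?e) * E x) = (LINT x|lborel. w x * E (x - t *\<^sub>R ?e))" by simp
    moreover have "E (x - t *\<^sub>R ?e) = exp (\<i> * of_real t * \<zeta> $ i) * E x" for x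
    proof -
      have sum: "(\<Sum>j\<in>UNIV. complex_of_real ((x - t *\<^sub>R ?e) $ j) * \<zeta> $ j) = (\<Sum>j\<in>UNIV. complex_of_real (x $ j) * \<zeta> $ j) - of_real t * \<zeta> $ i"
      proof -
        have "(\<Sum>j\<in>UNIV. complex_of_real (t * ?e $ j) * \<zeta> $ j) = (\<Sum>j\<in>UNIV. if j = i then of_real t * \<zeta> $ j else 0)"
          by (rule sum.cong) (auto simp: axis_def)
        then show ?thesis by (simp add: left_diff_distrib sum_subtractf)
      qed
      have "exp (- \<i> * (S - of_real t * \<zeta> $ i)) = exp (\<i> * of_real t * \<zeta> $ i) * exp (- \<i> * S)" for S
        by (simp add: exp_add[symmetric] algebra_simps)
      then show ?thesis unfolding E_def sum .
    qed
    moreover have "ft w \<zeta> = (LINT x|lborel. w x * E x)" by (simp add: ft_eq E_def)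
    ultimately show ?thesis by (simp add: mult.left_commute[of "w _" "exp _"])
  qed
  have intw: "integrable lborel (\<lambda>x. w (x + t *\<^sub>R ?e) * E x)" if t: "\<bar>t\<bar> \<le> 1" for t
  proof -
    obtain W where W: "W > 0" "\<And>x. norm (w x) \<le> W" by (rule test_functions_bounded[OF w]) blast
    have supp: "norm x \<le> R + 1" if "w (x + t *\<^sub>R ?e) \<noteq> 0" for x
      using R(2)[OF that] norm_triangle_ineq4[of "x + t *\<^sub>R ?e" "t *\<^sub>R ?e"] t by simp
    show ?thesis
    proof (rule integrable_bounded_support[where B = "W * B" and R = "R + 1"])
      show "norm (w (x + t *\<^sub>R ?e) * E x) \<le> W * B" for x
        using W B supp[of x] by (cases "w (x + t *\<^sub>R ?e) = 0") (auto simp: norm_mult intro!: mult_mono mult_nonneg_nonneg)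
      show "norm x \<le> R + 1" if "w (x + t *\<^sub>R ?e) * E x \<noteq> 0" for x using that supp by auto
    qed measurable
  qed
  \<comment> \<open>The steps are at most 1, so all quotients live in the ball of radius R + 1.
    There they are bounded by the Lipschitz constant L, and the exponential by B.\<close>
  have lim1: "(\<lambda>k. LINT x|lborel. (w (x + \<epsilon> k *\<^sub>R ?e) - w x) /\<^sub>R \<epsilon> k * E x) \<longlonglongrightarrow> (LINT x|lborel. pdiff i w x * E x)"
  proof (rule integral_dominated_convergence[where w = "\<lambda>x. (L * B) * indicator (cball (0::real^'n) (R + 1)) x"])
    show "integrable lborel (\<lambda>x. (L * B) * indicator (cball (0::real^'n) (R + 1)) x)"
      using emeasure_lborel_cball_finite[of "0::real^'n" "R + 1"]
      by (intro integrable_mult_right integrable_real_indicator) auto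
    show "AE x in lborel. (\<lambda>k. (w (x + \<epsilon> k *\<^sub>R ?e) - w x) /\<^sub>R \<epsilon> k * E x) \<longlonglongrightarrow> pdiff i w x * E x"
    proof (rule AE_I2)
      fix x
      have "((\<lambda>t. w (x + t *\<^sub>R ?e)) has_vector_derivative pdiff i w x) (at 0)"
        using difference_quotient_pdiff[OF wC, of x i 0] by simp
      then have lim: "((\<lambda>h. norm (w (x + (0 + h) *\<^sub>R ?e) - w (x + 0 *\<^sub>R ?e) - h *\<^sub>R pdiff i w x) / norm h) \<longlongrightarrow> 0) (at 0)"
        unfolding has_vector_derivative_def has_derivative_at by blast
      have "((\<lambda>h. (w (x + h *\<^sub>R ?e) - w x) /\<^sub>R h - pdiff i w x) \<longlongrightarrow> 0) (at 0)"
      proof (rule tendsto_norm_zero_cancel, rule Lim_transform_eventually[OF lim])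
        show "\<forall>\<^sub>F h in at 0. norm (w (x + (0 + h) *\<^sub>R ?e) - w (x + 0 *\<^sub>R ?e) - h *\<^sub>R pdiff i w x) / norm h =
          norm ((w (x + h *\<^sub>R ?e) - w x) /\<^sub>R h - pdiff i w x)"
          unfolding eventually_at
        proof (intro exI[of _ 1] conjI ballI impI)
          fix h :: real assume "h \<noteq> 0 \<and> dist h 0 < 1"
          then have h: "h \<noteq> 0" by blast
          then have "(w (x + h *\<^sub>R ?e) - w x) /\<^sub>R h - pdiff i w x = (w (x + h *\<^sub>R ?e) - w x - h *\<^sub>R pdiff i w x) /\<^sub>R h"
            by (simp add: scaleR_diff_right)
          then show "norm (w (x + (0 + h) *\<^sub>R ?e) - w (x + 0 *\<^sub>R ?e) - h *\<^sub>R pdiff i w x) / norm h =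
            norm ((w (x + h *\<^sub>R ?e) - w x) /\<^sub>R h - pdiff i w x)"
            by (simp only: norm_scaleR) (simp add: divide_inverse mult.commute)
        qed simp
      qed
      then have "((\<lambda>t. (w (x + t *\<^sub>R ?e) - w x) /\<^sub>R t) \<longlongrightarrow> pdiff i w x) (at 0)" by (rule LIM_zero_cancel)
      then have "(\<lambda>k. (w (x + \<epsilon> k *\<^sub>R ?e) - w x) /\<^sub>R \<epsilon> k) \<longlonglongrightarrow> pdiff i w x"
        by (rule filterlim_compose[OF _ efilt])
      then show "(\<lambda>k. (w (x + \<epsilon> k *\<^sub>R ?e) - w x) /\<^sub>R \<epsilon> k * E x) \<longlonglongrightarrow> pdiff i w x * E x"
        by (rule tendsto_mult_right)
    qed
    show "AE x in lborel. norm ((w (x + \<epsilon> k *\<^sub>R ?e) - w x) /\<^sub>R \<epsilon> k * E x) \<le> (L * B) * indicator (cball 0 (R + 1)) x" for k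
    proof (rule AE_I2)
      fix x
      show "norm ((w (x + \<epsilon> k *\<^sub>R ?e) - w x) /\<^sub>R \<epsilon> k * E x) \<le> (L * B) * indicator (cball 0 (R + 1)) x"
      proof (cases "norm x \<le> R + 1")
        case True
        have "norm ((w (x + \<epsilon> k *\<^sub>R ?e) - w x) /\<^sub>R \<epsilon> k) \<le> L"
        proof -
          have "norm ((w (x + \<epsilon> k *\<^sub>R ?e) - w x) /\<^sub>R \<epsilon> k) = inverse (\<epsilon> k) * norm (w (x + \<epsilon> k *\<^sub>R ?e) - w x)"
            using e[of k] by simp
          also have "\<dots> \<le> inverse (\<epsilon> k) * (L * \<epsilon> k)"
            using lip[of x "\<epsilon> k"] e[of k] by (intro mult_left_mono) auto
          also have "\<dots> = L" using e[of k] by simp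
          finally show ?thesis .
        qed
        then have "norm ((w (x + \<epsilon> k *\<^sub>R ?e) - w x) /\<^sub>R \<epsilon> k) * norm (E x) \<le> L * B"
          using B(2)[OF True] L by (intro mult_mono) auto
        then show ?thesis using True by (simp only: norm_mult) simp
      next
        case False
        have "w x = 0" using R(2)[of x] False by auto
        moreover have "w (x + \<epsilon> k *\<^sub>R ?e) = 0"
          using R(2)[of "x + \<epsilon> k *\<^sub>R ?e"] norm_triangle_ineq4[of "x + \<epsilon> k *\<^sub>R ?e" "\<epsilon> k *\<^sub>R ?e"] e[of k] False by auto
        ultimately show ?thesis using L B by simp
      qed
    qed
  qed measurable
  have quot: "(LINT x|lborel. (w (x + \<epsilon> k *\<^sub>R ?e) - w x) /\<^sub>R \<epsilon> k * E x) = (exp (\<i> * of_real (\<epsilon> k) * \<zeta> $ i) - 1) /\<^sub>R \<epsilon> k * ft w \<zeta>" for k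
  proof -
    have "(LINT x|lborel. (w (x + \<epsilon> k *\<^sub>R ?e) - w x) /\<^sub>R \<epsilon> k * E x) =
       (LINT x|lborel. (w (x + \<epsilon> k *\<^sub>R ?e) * E x - w (x + 0 *\<^sub>R ?e) * E x) /\<^sub>R \<epsilon> k)"
      by (simp add: left_diff_distrib)
    also have "\<dots> = (LINT x|lborel. w (x + \<epsilon> k *\<^sub>R ?e) * E x - w (x + 0 *\<^sub>R ?e) * E x) /\<^sub>R \<epsilon> k"
      by (rule integral_scaleR_right)
    also have "(LINT x|lborel. w (x + \<epsilon> k *\<^sub>R ?e) * E x - w (x + 0 *\<^sub>R ?e) * E x) =
        (LINT x|lborel. w (x + \<epsilon> k *\<^sub>R ?e) * E x) - (LINT x|lborel. w (x + 0 *\<^sub>R ?e) * E x)"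
      using e[of k] by (intro Bochner_Integration.integral_diff intw) auto
    also have "\<dots> = (exp (\<i> * of_real (\<epsilon> k) * \<zeta> $ i) - 1) * ft w \<zeta>"
      unfolding shift by (simp add: algebra_simps)
    finally show ?thesis by simp
  qed
  have lim2: "(\<lambda>k. (exp (\<i> * of_real (\<epsilon> k) * \<zeta> $ i) - 1) /\<^sub>R \<epsilon> k * ft w \<zeta>) \<longlonglongrightarrow> \<i> * \<zeta> $ i * ft w \<zeta>"
  proof -
    have "((\<lambda>t. exp (\<i> * t * \<zeta> $ i)) has_field_derivative exp (\<i> * 0 * \<zeta> $ i) * (\<i> * \<zeta> $ i)) (at 0)"
      by (auto intro!: derivative_eq_intros)
    then have "((\<lambda>t. (exp (\<i> * t * \<zeta> $ i) - 1) / t) \<longlongrightarrow> \<i> * \<zeta> $ i) (at 0)" by (simp add: DERIV_def)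
    moreover have "filterlim (\<lambda>k. complex_of_real (\<epsilon> k)) (at 0) sequentially"
      unfolding filterlim_at using tendsto_of_real[OF elim, where 'a = complex] e by (auto simp: less_imp_neq[symmetric])
    ultimately have "(\<lambda>k. (exp (\<i> * of_real (\<epsilon> k) * \<zeta> $ i) - 1) / of_real (\<epsilon> k)) \<longlonglongrightarrow> \<i> * \<zeta> $ i"
      by (rule filterlim_compose)
    then have "(\<lambda>k. (exp (\<i> * of_real (\<epsilon> k) * \<zeta> $ i) - 1) / of_real (\<epsilon> k) * ft w \<zeta>) \<longlonglongrightarrow> \<i> * \<zeta> $ i * ft w \<zeta>"
      by (rule tendsto_mult_right)
    then show ?thesis by (simp add: scaleR_conv_of_real divide_inverse mult.commute mult.left_commute)
  qed
  have "(LINT x|lborel. pdiff i w x * E x) = \<i> * \<zeta> $ i * ft w \<zeta>"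
    by (rule LIMSEQ_unique[OF lim1[unfolded quot] lim2])
  then show ?thesis unfolding ft_eq E_def .
qed


subsection \<open>Points with at most one non-real coordinate\<close>

definition line_pt :: "'n::finite \<Rightarrow> real^'n \<Rightarrow> complex \<Rightarrow> complex^'n" where
  "line_pt j \<xi> z = (\<chi> k. if k = j then z else of_real (\<xi> $ k))"

text \<open>At \<zeta> = \<open>line_pt j \<xi> z\<close> the sum of the squared coordinates, which
  is the argument of the symbol, equals
  \<open>z\<^sup>2 + of_real (rest_sq j \<xi>)\<close>.\<close>

definition rest_sq :: "'n::finite \<Rightarrow> real^'n \<Rightarrow> real" where
  "rest_sq j \<xi> = (\<Sum>k\<in>UNIV - {j}. (\<xi> $ k)\<^sup>2)"

lemma rest_sq_nonneg: "rest_sq j \<xi> \<ge> 0"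
  unfolding rest_sq_def by (intro sum_nonneg) auto

lemma inner_eq_rest_sq: "\<xi> \<bullet> \<xi> = (\<xi> $ j)\<^sup>2 + rest_sq j \<xi>"
  unfolding rest_sq_def inner_vec_def by (subst sum.remove[of _ j]) (auto simp: power2_eq_square)

lemma sum_line_pt:
  "(\<Sum>k\<in>UNIV. complex_of_real (x $ k) * line_pt j \<xi> z $ k) =
    of_real (\<Sum>k\<in>UNIV - {j}. x $ k * \<xi> $ k) + of_real (x $ j) * z"
  by (subst sum.remove[of _ j]) (auto simp: line_pt_def)

lemma sum_Re_sq_line_pt: "(\<Sum>k\<in>UNIV. (Re (line_pt j \<xi> z $ k))\<^sup>2) = (Re z)\<^sup>2 + rest_sq j \<xi>"
  unfolding rest_sq_def by (subst sum.remove[of _ j]) (auto simp: line_pt_def)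

lemma ft_line:
  "ft w (line_pt j \<xi> z) =
    (LINT x|lborel. w x * exp (- \<i> * of_real (\<Sum>k\<in>UNIV - {j}. x $ k * \<xi> $ k)) * exp (- \<i> * of_real (x $ j) * z))"
proof -
  have "exp (- \<i> * (a + b * z)) = exp (- \<i> * a) * exp (- \<i> * b * z)" for a b :: complex
    by (simp add: exp_add[symmetric] algebra_simps)
  then show ?thesis unfolding ft_eq sum_line_pt by (simp only: mult.assoc)
qed

lemma integrable_mult_unimodular:
  fixes w :: "real^'n \<Rightarrow> complex"
  assumes w: "integrable lborel w" and E: "continuous_on UNIV E" "\<And>x. norm (E x) = 1"
  shows "integrable lborel (\<lambda>x. w x * E x)"
proof (rule Bochner_Integration.integrable_bound[OF w])
  have [measurable]: "w \<in> borel_measurable borel" using w by auto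
  have [measurable]: "E \<in> borel_measurable borel" using E by (intro borel_measurable_continuous_onI)
  show "(\<lambda>x. w x * E x) \<in> borel_measurable lborel" by measurable
qed (simp add: norm_mult E)

lemma ft_line_holomorphic:
  fixes w :: "real^'n \<Rightarrow> complex"
  assumes w: "w \<in> test_functions"
  shows "(\<lambda>z. ft w (line_pt j \<xi> z)) holomorphic_on UNIV"
proof -
  obtain R where R: "R > 0" "\<And>x. w x \<noteq> 0 \<Longrightarrow> norm x \<le> R" by (rule test_functions_support[OF w]) blast
  show ?thesis
    unfolding ft_line
  proof (rule holomorphic_exp_integral(1)[where R = R])
    show "integrable lborel (\<lambda>x. w x * exp (- \<i> * of_real (\<Sum>k\<in>UNIV - {j}. x $ k * \<xi> $ k)))"
      by (rule integrable_mult_unimodular[OF test_functions_integrable[OF w]]) (auto intro!: continuous_intros)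
    show "AE x in lborel. w x * exp (- \<i> * of_real (\<Sum>k\<in>UNIV - {j}. x $ k * \<xi> $ k)) \<noteq> 0 \<longrightarrow> \<bar>x $ j\<bar> \<le> R"
      using R(2) component_le_norm_cart[of _ j] by (intro AE_I2) (auto intro: order_trans)
  qed (use R in auto)
qed

lemma ft_line_bound:
  fixes w :: "real^'n \<Rightarrow> complex"
  assumes w: "w \<in> test_functions"
  shows "\<exists>C\<ge>0. \<exists>R\<ge>0. \<forall>j \<xi> z. norm (ft w (line_pt j \<xi> z)) \<le> C * exp (R * \<bar>Im z\<bar>)"
proof -
  obtain R where R: "R > 0" "\<And>x. w x \<noteq> 0 \<Longrightarrow> norm x \<le> R" by (rule test_functions_support[OF w]) blast
  define C where "C = (LINT x|lborel. norm (w x))"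
  have "norm (ft w (line_pt j \<xi> z)) \<le> C * exp (R * \<bar>Im z\<bar>)" for j \<xi> z
  proof -
    let ?F = "\<lambda>x. w x * exp (- \<i> * of_real (\<Sum>k\<in>UNIV - {j}. x $ k * \<xi> $ k)) * exp (- \<i> * of_real (x $ j) * z)"
    have le: "norm (?F x) \<le> norm (w x) * exp (R * \<bar>Im z\<bar>)" for x
    proof (cases "w x = 0")
      case False
      have "\<bar>x $ j\<bar> \<le> R" using R(2)[OF False] component_le_norm_cart[of x j] by linarith
      then have "\<bar>x $ j * Im z\<bar> \<le> R * \<bar>Im z\<bar>" unfolding abs_mult by (rule mult_right_mono) simp
      then have "x $ j * Im z \<le> R * \<bar>Im z\<bar>" by linarith
      then show ?thesis unfolding norm_mult by (simp add: mult_left_mono)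
    qed simp
    have "norm (ft w (line_pt j \<xi> z)) \<le> (LINT x|lborel. norm (?F x))"
      unfolding ft_line by (rule integral_norm_bound)
    also have "\<dots> \<le> (LINT x|lborel. norm (w x) * exp (R * \<bar>Im z\<bar>))"
      using test_functions_integrable[OF w] le
      by (intro integral_mono' integrable_mult_left integrable_norm) auto
    also have "\<dots> = C * exp (R * \<bar>Im z\<bar>)" by (simp add: C_def)
    finally show ?thesis .
  qed
  moreover have "C \<ge> 0" by (simp add: C_def)
  ultimately show ?thesis using R(1) by (meson less_imp_le)
qed

lemma test_functions_pdiff_iter: "w \<in> test_functions \<Longrightarrow> (pdiff i ^^ m) w \<in> test_functions"
  by (induction m) (auto intro: test_functions_pdiff)

lemma ft_pdiff_iter: "w \<in> test_functions \<Longrightarrow> ft ((pdiff i ^^ m) w) \<zeta> = (\<i> * \<zeta> $ i) ^ m * ft w \<zeta>"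
  by (induction m) (auto simp: ft_pdiff test_functions_pdiff_iter)

text \<open>With m the maximum of 1 and all a k, the sum is at most (1 + card S) m, and m^N is
  itself one of the terms on the right. This joins decay in single coordinates into joint
  decay.\<close>

lemma power_sum_le:
  fixes a :: "'a \<Rightarrow> real"
  assumes "finite S" "\<And>k. k \<in> S \<Longrightarrow> a k \<ge> 0"
  shows "(1 + (\<Sum>k\<in>S. a k)) ^ N \<le> (1 + real (card S)) ^ N * (1 + (\<Sum>k\<in>S. a k ^ N))"
proof -
  define m where "m = Max (insert 1 (a ` S))"
  have fin: "finite (insert 1 (a ` S))" using assms by simp
  have m1: "1 \<le> m" unfolding m_def using fin by (intro Max_ge) auto
  have ma: "a k \<le> m" if "k \<in> S" for k unfolding m_def using fin that by (intro Max_ge) auto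
  have mm: "m \<in> insert 1 (a ` S)" unfolding m_def using fin by (intro Max_in) auto
  have "(\<Sum>k\<in>S. a k) \<le> (\<Sum>k\<in>S. m)" by (rule sum_mono) (rule ma)
  then have "1 + (\<Sum>k\<in>S. a k) \<le> (1 + real (card S)) * m" using m1 by (simp add: algebra_simps)
  then have "(1 + (\<Sum>k\<in>S. a k)) ^ N \<le> ((1 + real (card S)) * m) ^ N"
    using assms by (intro power_mono) (auto intro!: add_nonneg_nonneg sum_nonneg)
  also have "\<dots> = (1 + real (card S)) ^ N * m ^ N" by (rule power_mult_distrib)
  also have "m ^ N \<le> 1 + (\<Sum>k\<in>S. a k ^ N)"
  proof (cases "m = 1")
    case True
    then show ?thesis using assms by (auto intro!: sum_nonneg)
  next
    case False
    then obtain k where k: "k \<in> S" "m = a k" using mm by auto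
    have "a k ^ N \<le> (\<Sum>k\<in>S. a k ^ N)" using k assms by (intro member_le_sum) auto
    then show ?thesis using k by simp
  qed
  finally show ?thesis by (simp add: mult_left_mono)
qed

text \<open>Derivatives of order 2 N in each coordinate give decay in that coordinate, and
  \<open>power_sum_le\<close> combines them. The constants do not depend on j or \<xi>, so all lines
  are treated alike.\<close>

lemma ft_line_decay:
  fixes w :: "real^'n \<Rightarrow> complex"
  assumes w: "w \<in> test_functions"
  shows "\<exists>C\<ge>0. \<exists>R\<ge>0. \<forall>j \<xi> z. norm (ft w (line_pt j \<xi> z)) * (1 + (Re z)\<^sup>2 + rest_sq j \<xi>) ^ N \<le> C * exp (R * \<bar>Im z\<bar>)"
proof -
  have "\<forall>k. \<exists>C R. C \<ge> 0 \<and> R \<ge> 0 \<and> (\<forall>j \<xi> z. norm (ft ((pdiff k ^^ (2 * N)) w) (line_pt j \<xi> z)) \<le> C * exp (R * \<bar>Im z\<bar>))"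
    using ft_line_bound[OF test_functions_pdiff_iter[OF w]] by blast
  then obtain C R where C: "\<And>k. C k \<ge> 0" and R: "\<And>k. R k \<ge> 0"
    and CR: "\<And>k j \<xi> z. norm (ft ((pdiff k ^^ (2 * N)) w) (line_pt j \<xi> z)) \<le> C k * exp (R k * \<bar>Im z\<bar>)"
    by metis
  obtain C0 R0 where C0: "C0 \<ge> 0" "R0 \<ge> 0" "\<And>j \<xi> z. norm (ft w (line_pt j \<xi> z)) \<le> C0 * exp (R0 * \<bar>Im z\<bar>)"
    using ft_line_bound[OF w] by blast
  define C' where "C' = (1 + real CARD('n)) ^ N * (C0 + sum C UNIV)"
  define R' where "R' = R0 + sum R UNIV"
  have R'0: "R0 \<le> R'" unfolding R'_def using R by (simp add: sum_nonneg)
  have R'k: "R k \<le> R'" for k unfolding R'_def using R C0 member_le_sum[of k UNIV R] by simp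
  have "norm (ft w (line_pt j \<xi> z)) * (1 + (Re z)\<^sup>2 + rest_sq j \<xi>) ^ N \<le> C' * exp (R' * \<bar>Im z\<bar>)" for j \<xi> z
  proof -
    let ?\<zeta> = "line_pt j \<xi> z" and ?E = "exp (R' * \<bar>Im z\<bar>)"
    have mono: "c * exp (\<rho> * \<bar>Im z\<bar>) \<le> c * ?E" if "c \<ge> 0" "\<rho> \<le> R'" for c \<rho>
      using that by (intro mult_left_mono) (auto intro: mult_right_mono)
    have k: "norm (ft w ?\<zeta>) * ((Re (?\<zeta> $ k))\<^sup>2) ^ N \<le> C k * ?E" for k
    proof -
      have "((Re (?\<zeta> $ k))\<^sup>2) ^ N = \<bar>Re (?\<zeta> $ k)\<bar> ^ (2 * N)" by (simp add: power_mult)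
      also have "\<dots> \<le> norm (?\<zeta> $ k) ^ (2 * N)" by (intro power_mono abs_Re_le_cmod) auto
      finally have "norm (ft w ?\<zeta>) * ((Re (?\<zeta> $ k))\<^sup>2) ^ N \<le> norm (ft w ?\<zeta>) * norm (?\<zeta> $ k) ^ (2 * N)"
        by (rule mult_left_mono) simp
      also have "\<dots> = norm (ft ((pdiff k ^^ (2 * N)) w) ?\<zeta>)"
        unfolding ft_pdiff_iter[OF w] by (simp add: norm_mult norm_power)
      also have "\<dots> \<le> C k * exp (R k * \<bar>Im z\<bar>)" by (rule CR)
      also have "\<dots> \<le> C k * ?E" by (rule mono[OF C R'k])
      finally show ?thesis .
    qed
    have eq: "1 + (Re z)\<^sup>2 + rest_sq j \<xi> = 1 + (\<Sum>k\<in>UNIV. (Re (?\<zeta> $ k))\<^sup>2)" by (simp add: sum_Re_sq_line_pt)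
    then have "(1 + (Re z)\<^sup>2 + rest_sq j \<xi>) ^ N \<le> (1 + real CARD('n)) ^ N * (1 + (\<Sum>k\<in>UNIV. ((Re (?\<zeta> $ k))\<^sup>2) ^ N))"
      unfolding eq using power_sum_le[of UNIV "\<lambda>k. (Re (?\<zeta> $ k))\<^sup>2" N] by simp
    then have "norm (ft w ?\<zeta>) * (1 + (Re z)\<^sup>2 + rest_sq j \<xi>) ^ N \<le> norm (ft w ?\<zeta>) * ((1 + real CARD('n)) ^ N * (1 + (\<Sum>k\<in>UNIV. ((Re (?\<zeta> $ k))\<^sup>2) ^ N)))"
      by (rule mult_left_mono) simp
    also have "\<dots> = (1 + real CARD('n)) ^ N * (norm (ft w ?\<zeta>) + (\<Sum>k\<in>UNIV. norm (ft w ?\<zeta>) * ((Re (?\<zeta> $ k))\<^sup>2) ^ N))"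
      by (simp add: distrib_left sum_distrib_left mult.left_commute)
    also have "\<dots> \<le> (1 + real CARD('n)) ^ N * (C0 * ?E + (\<Sum>k\<in>UNIV. C k * ?E))"
      using order_trans[OF C0(3) mono[OF C0(1) R'0]] by (intro mult_left_mono add_mono sum_mono k) auto
    also have "\<dots> = C' * ?E" by (simp add: C'_def distrib_left distrib_right sum_distrib_right mult.assoc)
    finally show ?thesis .
  qed
  moreover have "C' \<ge> 0" unfolding C'_def using C0 C by (intro mult_nonneg_nonneg add_nonneg_nonneg sum_nonneg) auto
  moreover have "R' \<ge> 0" using R'0 C0 by simp
  ultimately show ?thesis by blast
qed

text \<open>Adding \<rho> preserves Re times Im of the root and raises the difference of their
  squares. A larger |Im| would force a larger |Re| and hence a larger product. So the growth of the
  symbol on a line is governed by Im z, uniformly in the real coordinates.\<close>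

lemma abs_Im_sqrt_le:
  assumes "w\<^sup>2 = v\<^sup>2 + of_real \<rho>" "\<rho> \<ge> 0"
  shows "\<bar>Im w\<bar> \<le> \<bar>Im v\<bar>"
proof (rule ccontr)
  assume "\<not> \<bar>Im w\<bar> \<le> \<bar>Im v\<bar>"
  then have gt: "(Im v)\<^sup>2 < (Im w)\<^sup>2" by (simp add: abs_le_square_iff not_le)
  have re: "(Re w)\<^sup>2 - (Im w)\<^sup>2 = (Re v)\<^sup>2 - (Im v)\<^sup>2 + \<rho>" and im: "Re w * Im w = Re v * Im v"
    using arg_cong[OF assms(1), of Re] arg_cong[OF assms(1), of Im] by (simp_all add: power2_eq_square mult.commute)
  have w0: "(Im w)\<^sup>2 > 0" using gt zero_le_power2[of "Im v"] by linarith
  have "(Re v)\<^sup>2 < (Re w)\<^sup>2" using re gt assms(2) by linarith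
  then have "(Re v)\<^sup>2 * (Im w)\<^sup>2 < (Re w)\<^sup>2 * (Im w)\<^sup>2" using w0 by (rule mult_strict_right_mono)
  moreover have "(Re v)\<^sup>2 * (Im v)\<^sup>2 \<le> (Re v)\<^sup>2 * (Im w)\<^sup>2" using gt by (intro mult_left_mono) auto
  moreover have "(Re w)\<^sup>2 * (Im w)\<^sup>2 = (Re v)\<^sup>2 * (Im v)\<^sup>2" using im by (metis power_mult_distrib)
  ultimately show False by linarith
qed

context slowly_decreasing_symbol
begin

lemma holomorphic: "\<phi> holomorphic_on A"
  using deriv by (auto simp: holomorphic_on_def field_differentiable_def intro: has_field_derivative_at_within)

lemma line_deriv: "((\<lambda>z. \<phi> (z\<^sup>2 + c)) has_field_derivative \<phi>' (z\<^sup>2 + c) * (2 * z)) (at z)"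
  by (rule DERIV_chain2[OF deriv]) (auto intro!: derivative_eq_intros)

lemma line_holomorphic: "(\<lambda>z. \<phi> (z\<^sup>2 + c)) holomorphic_on A"
  using line_deriv by (auto simp: holomorphic_on_def field_differentiable_def intro: has_field_derivative_at_within)

text \<open>The chain rule produces the factor 2 z, and \<phi> c \<noteq> 0 keeps the zeros away
  from z = 0.\<close>

lemma line_zeros_simple:
  assumes "\<phi> c \<noteq> 0" "\<phi> (z\<^sup>2 + c) = 0"
  shows "deriv (\<lambda>z. \<phi> (z\<^sup>2 + c)) z \<noteq> 0"
proof -
  have "z \<noteq> 0" using assms by auto
  then show ?thesis using simple[OF assms(2)] DERIV_imp_deriv[OF line_deriv, of c z] by simp
qed

text \<open>From any \<open>z\<close> a real point with a good lower bound
  for the divisor is reached within a distance \<open>O(1 + \<bar>Im z\<bar>)\<close>.\<close>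

lemma quotient_decay:
  fixes w :: "real^'n \<Rightarrow> complex"
  assumes w: "w \<in> test_functions"
  shows "\<exists>C\<ge>0. \<exists>A\<ge>0. \<forall>j \<xi> Q z. \<phi> (of_real (rest_sq j \<xi>)) \<noteq> 0 \<longrightarrow> Q holomorphic_on UNIV \<longrightarrow>
    (\<forall>z. ft w (line_pt j \<xi> z) = Q z * \<phi> (z\<^sup>2 + of_real (rest_sq j \<xi>))) \<longrightarrow>
    norm (Q z) * (1 + (Re z)\<^sup>2 + rest_sq j \<xi>) ^ N \<le> C * exp (A * \<bar>Im z\<bar>)"
proof -
  obtain \<kappa> A0 M where slow: "\<kappa> > 0" "A0 \<ge> 0" "\<And>s. s \<ge> 0 \<Longrightarrow> \<exists>t. s \<le> t \<and> t \<le> s + A0 \<and> \<kappa> / (1 + s) ^ M \<le> norm (\<phi> (of_real t))"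
    using slow by blast
  obtain C1 A1 where growth: "C1 \<ge> 0" "A1 \<ge> 0" "\<And>w. norm (\<phi> (w\<^sup>2)) \<le> C1 * (1 + norm w) * exp (A1 * \<bar>Im w\<bar>)"
    using growth by blast
  \<comment> \<open>M1 enters squared and costs (1 + s)^2, the lower bound enters cubed and costs (1
    + s)^(3 M); after paying for both, decay of order N is left.\<close>
  define N' where "N' = N + 2 + 3 * M"
  obtain C2 A2 where decay: "C2 \<ge> 0" "A2 \<ge> 0"
    "\<And>j \<xi> z. norm (ft w (line_pt j \<xi> z)) * (1 + (Re z)\<^sup>2 + rest_sq j \<xi>) ^ N' \<le> C2 * exp (A2 * \<bar>Im z\<bar>)"
    using ft_line_decay[OF w, of N'] by blast
  define a where "a = sqrt A0"
  have a: "a \<ge> 0" "a\<^sup>2 = A0" using slow by (auto simp: a_def)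
  \<comment> \<open>A2 and 2 A1 come from M2 and M1^2, and 2 (N' + 2) from the power of P. As a + R
    = 3 a + 2 + 2 |y|, the constant part of the exponent goes into C and the rate becomes 2
    L.\<close>
  define L where "L = A2 + 2 * A1 + 2 * real (N' + 2)"
  define K where "K = C2 * 4 ^ N' * (8 * C1)\<^sup>2 / \<kappa> ^ 3"
  define C where "C = K * exp (L * (3 * a + 2))"
  have L: "L \<ge> 0" using decay growth by (simp add: L_def)
  have K: "K \<ge> 0" unfolding K_def using decay growth slow by (intro divide_nonneg_nonneg mult_nonneg_nonneg) auto
  have C: "C \<ge> 0" using K by (simp add: C_def)
  have "norm (Q z) * (1 + (Re z)\<^sup>2 + rest_sq j \<xi>) ^ N \<le> C * exp (2 * L * \<bar>Im z\<bar>)"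
    if good: "\<phi> (of_real (rest_sq j \<xi>)) \<noteq> 0" and Q: "Q holomorphic_on UNIV"
      and quot: "\<And>z. ft w (line_pt j \<xi> z) = Q z * \<phi> (z\<^sup>2 + of_real (rest_sq j \<xi>))"
    for j \<xi> Q z
  proof -
    define \<rho> where "\<rho> = rest_sq j \<xi>"
    have \<rho>: "\<rho> \<ge> 0" by (simp add: \<rho>_def rest_sq_nonneg)
    define x y where "x = Re z" and "y = Im z"
    define s where "s = x\<^sup>2 + \<rho>"
    have s: "s \<ge> 0" using \<rho> by (simp add: s_def)
    obtain t where t: "s \<le> t" "t \<le> s + A0" "\<kappa> / (1 + s) ^ M \<le> norm (\<phi> (of_real t))" using slow(3)[OF s] by blast
    \<comment> \<open>The real centre c satisfies c^2 + \<rho> = t, so the divisor there is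
      \<phi>(t). Giving c the sign of x keeps it within a = sqrt A0 of x, however large x
      is.\<close>
    define d where "d = sqrt (x\<^sup>2 + (t - s))"
    define c where "c = (if x \<ge> 0 then d else - d)"
    have d2: "d\<^sup>2 = x\<^sup>2 + (t - s)" using t by (simp add: d_def)
    have "c\<^sup>2 + \<rho> = t" using d2 by (simp add: c_def s_def)
    then have ct: "(complex_of_real c)\<^sup>2 + of_real \<rho> = of_real t" by (metis of_real_add of_real_power)
    have xd: "\<bar>x\<bar> \<le> d" using t by (simp add: d_def real_le_rsqrt)
    have "x\<^sup>2 + (t - s) \<le> (\<bar>x\<bar> + a)\<^sup>2"
    proof -
      have "0 \<le> 2 * \<bar>x\<bar> * a" using a by simp
      then show ?thesis unfolding power2_sum power2_abs using t a(2) by linarith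
    qed
    then have "d \<le> sqrt ((\<bar>x\<bar> + a)\<^sup>2)" unfolding d_def by (rule real_sqrt_le_mono)
    then have "d \<le> \<bar>x\<bar> + a" using a by simp
    then have cx: "\<bar>c - x\<bar> \<le> a" using xd by (auto simp: c_def)
    \<comment> \<open>Since |z - c| \<le> a + |y|, the point z lies in the half-size disc that
      \<open>quotient_bound\<close> requires.\<close>
    define R where "R = 2 * (a + \<bar>y\<bar> + 1)"
    have R: "R > 0" using a by (simp add: R_def add_nonneg_pos)
    \<comment> \<open>P dominates the squares of all displacements in the disc. It is polynomial in
      |y|, so an exponential in |y| finally absorbs it.\<close>
    define P where "P = (1 + a + R)\<^sup>2"
    have P1: "P \<ge> 1" unfolding P_def using a R by (intro one_le_power) auto
    have aR: "(a + R)\<^sup>2 \<le> P" "R\<^sup>2 \<le> P" unfolding P_def using a R by (auto intro!: power_mono)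
    have v_facts: "\<bar>Im v\<bar> \<le> R" "(Re v)\<^sup>2 \<le> 2 * x\<^sup>2 + 2 * P" "x\<^sup>2 \<le> 2 * (Re v)\<^sup>2 + 2 * P" if v: "norm (v - of_real c) < R" for v
    proof -
      show "\<bar>Im v\<bar> \<le> R" using abs_Im_le_cmod[of "v - of_real c"] v by simp
      have "\<bar>Re v - c\<bar> \<le> R" using abs_Re_le_cmod[of "v - of_real c"] v by simp
      then have "\<bar>Re v - x\<bar> \<le> a + R" using cx by linarith
      then have le: "(Re v - x)\<^sup>2 \<le> P" using aR(1) a R by (meson abs_le_square_iff abs_of_nonneg add_nonneg_nonneg less_imp_le order_trans power2_le_iff_abs_le)
      have "(Re v)\<^sup>2 \<le> 2 * x\<^sup>2 + 2 * (Re v - x)\<^sup>2"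
        using zero_le_power2[of "Re v - 2 * x"] by (simp add: power2_eq_square algebra_simps)
      then show "(Re v)\<^sup>2 \<le> 2 * x\<^sup>2 + 2 * P" using le by linarith
      have "x\<^sup>2 \<le> 2 * (Re v)\<^sup>2 + 2 * (Re v - x)\<^sup>2"
        using zero_le_power2[of "x - 2 * Re v"] by (simp add: power2_eq_square algebra_simps)
      then show "x\<^sup>2 \<le> 2 * (Re v)\<^sup>2 + 2 * P" using le by linarith
    qed
    define M1 where "M1 = 8 * C1 * P * (1 + s) * exp (A1 * R)"
    define M2 where "M2 = C2 * exp (A2 * R) * (4 * P) ^ N' / (1 + s) ^ N'"
    have M1: "norm (\<phi> (v\<^sup>2 + of_real \<rho>)) \<le> M1" if v: "norm (v - of_real c) < R" for v
    proof -
      note vf = v_facts[OF v]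
      define u where "u = csqrt (v\<^sup>2 + of_real \<rho>)"
      have u: "u\<^sup>2 = v\<^sup>2 + of_real \<rho>" by (simp add: u_def)
      have imu: "\<bar>Im u\<bar> \<le> R" using abs_Im_sqrt_le[OF u \<rho>] vf(1) by linarith
      have "(norm u)\<^sup>2 = norm (v\<^sup>2 + of_real \<rho>)" using u by (metis norm_power)
      also have "\<dots> \<le> norm (v\<^sup>2) + norm (complex_of_real \<rho>)" by (rule norm_triangle_ineq)
      also have "\<dots> = (Re v)\<^sup>2 + (Im v)\<^sup>2 + \<rho>" using \<rho> by (simp add: norm_power cmod_power2)
      also have "(Im v)\<^sup>2 \<le> R\<^sup>2" using vf(1) R by (simp add: power2_le_iff_abs_le)
      finally have nu: "(norm u)\<^sup>2 \<le> 2 * s + 3 * P" using vf(2) aR(2) \<rho> by (simp add: s_def)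
      have "1 + norm u \<le> 2 * (1 + (norm u)\<^sup>2)"
      proof -
        have "1 + b \<le> 2 * (1 + q)" if "2 * b * 1 \<le> q + 1" "0 \<le> q" for b q :: real
          using that by argo
        from this[OF sum_squares_bound[of "norm u" 1, unfolded power_one] zero_le_power2] show ?thesis .
      qed
      also have "\<dots> \<le> 2 * (1 + (2 * s + 3 * P))" using nu by simp
      also have "\<dots> \<le> 8 * P * (1 + s)"
      proof -
        have "s * 1 \<le> s * P" using s P1 by (intro mult_left_mono) auto
        then show ?thesis using P1 s by (simp add: algebra_simps)
      qed
      finally have nu1: "1 + norm u \<le> 8 * P * (1 + s)" .
      have "norm (\<phi> (u\<^sup>2)) \<le> C1 * (1 + norm u) * exp (A1 * \<bar>Im u\<bar>)" by (rule growth)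
      also have "\<dots> \<le> C1 * (8 * P * (1 + s)) * exp (A1 * R)"
        using nu1 imu growth s P1 by (intro mult_mono mult_left_mono) (auto intro!: mult_nonneg_nonneg mult_left_mono)
      finally show ?thesis unfolding u M1_def by (simp add: mult_ac)
    qed
    have M2: "norm (Q v * \<phi> (v\<^sup>2 + of_real \<rho>)) \<le> M2" if v: "norm (v - of_real c) < R" for v
    proof -
      note vf = v_facts[OF v]
      define q where "q = 1 + (Re v)\<^sup>2 + \<rho>"
      have q: "q \<ge> 1" using \<rho> by (simp add: q_def)
      have "1 + s \<le> 4 * P * q"
      proof -
        define V where "V = (Re v)\<^sup>2"
        have V: "V \<ge> 0" "V \<le> V * P" "\<rho> \<le> \<rho> * P"
          using \<rho> P1 mult_left_mono[OF P1, of V] mult_left_mono[OF P1, of \<rho>] by (auto simp: V_def)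
        have "4 * P * q = 4 * P + 4 * (V * P) + 4 * (\<rho> * P)" by (simp add: q_def V_def algebra_simps)
        moreover have "x\<^sup>2 \<le> 2 * V + 2 * P" using vf(3) by (simp add: V_def)
        ultimately show ?thesis unfolding s_def using V P1 \<rho> by linarith
      qed
      then have "(1 + s) ^ N' \<le> (4 * P * q) ^ N'" using s by (intro power_mono) auto
      then have pw: "(1 + s) ^ N' \<le> (4 * P) ^ N' * q ^ N'" by (simp only: power_mult_distrib)
      have "norm (ft w (line_pt j \<xi> v)) * (1 + s) ^ N' \<le> norm (ft w (line_pt j \<xi> v)) * ((4 * P) ^ N' * q ^ N')"
        using pw by (rule mult_left_mono) simp
      also have "\<dots> = (4 * P) ^ N' * (norm (ft w (line_pt j \<xi> v)) * q ^ N')" by (simp add: mult_ac)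
      also have "\<dots> \<le> (4 * P) ^ N' * (C2 * exp (A2 * \<bar>Im v\<bar>))"
        using decay(3)[of j \<xi> v] P1 by (intro mult_left_mono) (auto simp: q_def \<rho>_def)
      also have "\<dots> \<le> (4 * P) ^ N' * (C2 * exp (A2 * R))"
        using vf(1) decay P1 by (intro mult_left_mono) (auto intro!: mult_left_mono)
      finally have "norm (ft w (line_pt j \<xi> v)) \<le> (4 * P) ^ N' * (C2 * exp (A2 * R)) / (1 + s) ^ N'"
        using s by (simp add: pos_le_divide_eq)
      then show ?thesis unfolding quot \<rho>_def[symmetric] M2_def by (simp add: mult_ac)
    qed
    have gc: "norm (\<phi> ((of_real c)\<^sup>2 + of_real \<rho>)) \<ge> \<kappa> / (1 + s) ^ M" unfolding ct by (rule t(3))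
    have kp: "\<kappa> / (1 + s) ^ M > 0" using slow(1) s by simp
    have zc: "norm (z - of_real c) \<le> R / 2"
    proof -
      have "norm (z - of_real c) \<le> \<bar>Re (z - of_real c)\<bar> + \<bar>Im (z - of_real c)\<bar>" by (rule cmod_le)
      also have "\<dots> \<le> a + \<bar>y\<bar>" using cx by (simp add: x_def y_def abs_minus_commute)
      finally show ?thesis by (simp add: R_def)
    qed
    have M2nn: "M2 \<ge> 0" unfolding M2_def using decay P1 s by (intro divide_nonneg_nonneg mult_nonneg_nonneg) auto
    have "norm (Q z) \<le> M2 * M1\<^sup>2 / norm (\<phi> ((of_real c)\<^sup>2 + of_real \<rho>)) ^ 3"
    proof (rule quotient_bound[where g = "\<lambda>v. \<phi> (v\<^sup>2 + of_real \<rho>)" and G = Q and R = R])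
      show "deriv (\<lambda>v. \<phi> (v\<^sup>2 + of_real \<rho>)) v \<noteq> 0" if "\<phi> (v\<^sup>2 + of_real \<rho>) = 0" for v
        using line_zeros_simple good that unfolding \<rho>_def by blast
      show "\<phi> ((of_real c)\<^sup>2 + of_real \<rho>) \<noteq> 0" using gc kp by auto
    qed (use line_holomorphic Q R M1 M2 zc in auto)
    also have "\<dots> \<le> M2 * M1\<^sup>2 / (\<kappa> / (1 + s) ^ M) ^ 3"
      using gc kp M2nn by (intro divide_left_mono power_mono mult_pos_pos zero_less_power mult_nonneg_nonneg) auto
    also have "\<dots> = K * (P ^ N' * P\<^sup>2) * (exp (A2 * R) * (exp (A1 * R))\<^sup>2) * ((1 + s)\<^sup>2 * ((1 + s) ^ M) ^ 3 / (1 + s) ^ N')"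
    proof -
      have "C2 * e2 * (4 * P) ^ N' / \<sigma> ^ N' * (8 * C1 * P * \<sigma> * e1)\<^sup>2 / (\<kappa> / \<sigma> ^ M) ^ 3 =
        C2 * 4 ^ N' * (8 * C1)\<^sup>2 / \<kappa> ^ 3 * (P ^ N' * P\<^sup>2) * (e2 * e1\<^sup>2) * (\<sigma>\<^sup>2 * (\<sigma> ^ M) ^ 3 / \<sigma> ^ N')" for \<sigma> e1 e2
        by (simp add: power_mult_distrib power_divide mult_ac)
      then show ?thesis unfolding M1_def M2_def K_def .
    qed
    also have "(1 + s)\<^sup>2 * ((1 + s) ^ M) ^ 3 / (1 + s) ^ N' = 1 / (1 + s) ^ N"
    proof -
      have "(1 + s) ^ N' = (1 + s) ^ N * ((1 + s)\<^sup>2 * ((1 + s) ^ M) ^ 3)"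
        unfolding N'_def power_add by (simp only: mult.commute[of 3 M] power_mult mult.assoc)
      then show ?thesis using s by simp
    qed
    finally have "norm (Q z) \<le> K * (P ^ N' * P\<^sup>2) * (exp (A2 * R) * (exp (A1 * R))\<^sup>2) / (1 + s) ^ N" by simp
    then have "norm (Q z) * (1 + s) ^ N \<le> K * (P ^ N' * P\<^sup>2) * (exp (A2 * R) * (exp (A1 * R))\<^sup>2)"
      using s by (simp add: pos_le_divide_eq)
    also have "P ^ N' * P\<^sup>2 \<le> exp (2 * real (N' + 2) * (a + R))"
    proof -
      have "1 + a + R \<le> exp (a + R)" using exp_ge_add_one_self[of "a + R"] by (simp add: add.assoc)
      then have "P \<le> (exp (a + R))\<^sup>2" unfolding P_def using a R by (intro power_mono) auto
      then have "P ^ (N' + 2) \<le> ((exp (a + R))\<^sup>2) ^ (N' + 2)" using P1 by (intro power_mono) auto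
      also have "\<dots> = exp (a + R) ^ (2 * (N' + 2))" by (simp only: power_mult)
      also have "\<dots> = exp (real (2 * (N' + 2)) * (a + R))" by (simp only: exp_of_nat_mult)
      finally show ?thesis by (simp only: power_add of_nat_mult of_nat_numeral)
    qed
    also have "exp (A2 * R) * (exp (A1 * R))\<^sup>2 = exp ((A2 + 2 * A1) * R)"
      by (simp add: exp_add[symmetric] exp_double[symmetric] algebra_simps)
    finally have "norm (Q z) * (1 + s) ^ N \<le> K * exp (2 * real (N' + 2) * (a + R)) * exp ((A2 + 2 * A1) * R)"
      using K by (simp add: mult_left_mono mult_right_mono)
    also have "\<dots> = K * exp (2 * real (N' + 2) * (a + R) + (A2 + 2 * A1) * R)" by (simp add: exp_add)
    also have "\<dots> \<le> K * exp (L * (a + R))"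
    proof -
      have "(A2 + 2 * A1) * R \<le> (A2 + 2 * A1) * (a + R)" using a decay growth by (intro mult_left_mono) auto
      then have "2 * real (N' + 2) * (a + R) + (A2 + 2 * A1) * R \<le> L * (a + R)"
        unfolding L_def by (simp add: algebra_simps)
      then show ?thesis using K by (intro mult_left_mono) auto
    qed
    also have "\<dots> = C * exp (2 * L * \<bar>y\<bar>)"
      by (simp add: C_def R_def mult.assoc exp_add[symmetric] algebra_simps)
    finally show ?thesis by (simp add: s_def x_def y_def \<rho>_def add.assoc)
  qed
  then show ?thesis using C L by (intro exI[of _ C] conjI exI[of _ "2 * L"]) auto
qed

end


subsection \<open>Division by the symbol\<close>

definition real_pt :: "real^'n \<Rightarrow> complex^'n" where
  "real_pt \<xi> = (\<chi> k. of_real (\<xi> $ k))"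

lemma line_pt_real: "line_pt j \<xi> (Complex (\<xi> $ j) 0) = real_pt \<xi>"
  by (auto simp: line_pt_def real_pt_def vec_eq_iff complex_eq_iff)

lemma rest_sq_shift_same: "rest_sq j (\<xi> + a *\<^sub>R axis j 1) = rest_sq j \<xi>"
  unfolding rest_sq_def by (rule sum.cong) (auto simp: axis_def)

lemma rest_sq_shift_other:
  assumes "k \<noteq> j"
  shows "rest_sq j (\<xi> + a *\<^sub>R axis k 1) = a\<^sup>2 + 2 * (\<xi> $ k) * a + rest_sq j \<xi>"
proof -
  have k: "k \<in> UNIV - {j}" using assms by simp
  have "rest_sq j (\<xi> + a *\<^sub>R axis k 1) = (\<xi> $ k + a)\<^sup>2 + (\<Sum>i\<in>UNIV - {j} - {k}. (\<xi> $ i)\<^sup>2)"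
    unfolding rest_sq_def by (subst sum.remove[OF _ k]) (auto simp: axis_def intro!: sum.cong)
  moreover have "rest_sq j \<xi> = (\<xi> $ k)\<^sup>2 + (\<Sum>i\<in>UNIV - {j} - {k}. (\<xi> $ i)\<^sup>2)"
    unfolding rest_sq_def by (subst sum.remove[OF _ k]) auto
  ultimately show ?thesis by (simp add: power2_sum)
qed

lemma continuous_on_rest_sq [continuous_intros]: "continuous_on A (rest_sq j)"
  unfolding rest_sq_def[abs_def] by (intro continuous_intros)

lemma axis_inner_1: "(axis j 1 :: real^'n) \<bullet> axis j 1 = 1"
  by (simp add: inner_axis_axis)

lemma ft_line_measurable:
  fixes w :: "real^'n \<Rightarrow> complex"
  assumes w: "w \<in> test_functions"
  shows "(\<lambda>\<xi>. ft w (line_pt j \<xi> (Complex (\<xi> $ j) t))) \<in> borel_measurable borel"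
  unfolding ft_line
proof (rule lborel.borel_measurable_lebesgue_integral)
  have "continuous_on UNIV (\<lambda>p. w (snd p))"
    by (rule continuous_on_compose2[OF test_functions_continuous[OF w]]) (auto intro!: continuous_intros)
  then show "(\<lambda>(\<xi>, x). w x * exp (- \<i> * of_real (\<Sum>k\<in>UNIV - {j}. x $ k * \<xi> $ k)) * exp (- \<i> * of_real (x $ j) * Complex (\<xi> $ j) t))
      \<in> borel_measurable (borel \<Otimes>\<^sub>M lborel)"
    by (intro continuous_imp_borel_measurable_pair) (auto simp: case_prod_beta Complex_eq intro!: continuous_intros)
qed

lemma ft_real_measurable:
  "w \<in> test_functions \<Longrightarrow> (\<lambda>\<xi>. ft w (real_pt (\<xi> :: real^'n))) \<in> borel_measurable borel"
  using ft_line_measurable[of w _ 0] by (simp add: line_pt_real)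

context slowly_decreasing_symbol
begin

lemma continuous_on_symbol: "continuous_on A \<phi>"
  by (rule holomorphic_on_imp_continuous_on) (rule holomorphic)

text \<open>An entire function has countably many zeros unless it vanishes identically, and
  simplicity of the zeros of \<phi> excludes the latter. The quadratic argument covers shifts of any
  one coordinate, real or on a horizontal line.\<close>

lemma AE_line_nonzero: "AE a in lborel. \<phi> ((of_real a)\<^sup>2 + 2 * b * of_real a + c) \<noteq> 0"
proof -
  define h where "h = (\<lambda>z. \<phi> (z\<^sup>2 + 2 * b * z + c))"
  have dh: "(h has_field_derivative \<phi>' (z\<^sup>2 + 2 * b * z + c) * (2 * z + 2 * b)) (at z)" for z
    unfolding h_def by (rule DERIV_chain2[OF deriv]) (auto intro!: derivative_eq_intros)
  have hol: "h holomorphic_on UNIV"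
    using dh by (auto simp: holomorphic_on_def field_differentiable_def)
  have "countable {z \<in> UNIV. h z = 0}"
  proof (cases "h constant_on UNIV")
    case False
    then show ?thesis by (intro holomorphic_countable_zeros[OF hol]) auto
  next
    case True
    then obtain y where y: "\<And>z. h z = y" by (auto simp: constant_on_def)
    show ?thesis
    proof (cases "y = 0")
      case True
      \<comment> \<open>Here the inner derivative 2 z + 2 b equals 2, so vanishing of h would force
        \<phi> and \<phi>' to vanish together.\<close>
      define z where "z = 1 - b"
      have "h = (\<lambda>_. 0)" using y True by auto
      then have "(h has_field_derivative 0) (at z)" by simp
      from DERIV_unique[OF dh this] have "\<phi>' (z\<^sup>2 + 2 * b * z + c) * (2 * z + 2 * b) = 0" .
      then have "\<phi>' (z\<^sup>2 + 2 * b * z + c) = 0" by (simp add: z_def)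
      moreover have "\<phi> (z\<^sup>2 + 2 * b * z + c) = 0" using y[of z] True by (simp add: h_def)
      ultimately show ?thesis using simple[of "z\<^sup>2 + 2 * b * z + c"] by simp
    qed (use y in simp)
  qed
  then have "countable (complex_of_real ` {a. h (of_real a) = 0})"
    by (rule countable_subset[rotated]) auto
  then have "countable {a::real. h (of_real a) = 0}"
    by (rule countable_image_inj_on) (auto simp: inj_on_def)
  then have "{a::real. h (of_real a) = 0} \<in> null_sets lborel" by (rule countable_imp_null_set_lborel)
  then show ?thesis unfolding h_def by (rule AE_I') simp
qed

lemma closed_symbol_zeros:
  assumes "continuous_on UNIV g"
  shows "{\<xi>::'a::topological_space. \<not> \<phi> (g \<xi>) \<noteq> 0} \<in> sets borel"
proof -
  have "closed {\<xi>. \<phi> (g \<xi>) = 0}"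
    by (intro closed_Collect_eq continuous_on_compose2[OF continuous_on_symbol[of UNIV] assms]) auto
  then show ?thesis by simp
qed

text \<open>Dimension at least 2 supplies a coordinate k other than j. Along its axis
  \<open>rest_sq j\<close> is a quadratic polynomial, so \<open>AE_line_nonzero\<close> applies on
  every such line.\<close>

lemma AE_rest_nonzero:
  fixes j :: "'n::finite"
  assumes n: "CARD('n) \<ge> 2"
  shows "AE \<xi> in lborel. \<phi> (of_real (rest_sq j \<xi>)) \<noteq> 0"
proof -
  have "\<exists>k. k \<noteq> j"
  proof (rule ccontr)
    assume "\<nexists>k. k \<noteq> j"
    then have "(UNIV :: 'n set) = {j}" by auto
    then have "CARD('n) = card {j}" by (rule arg_cong)
    then show False using n by simp
  qed
  then obtain k where k: "k \<noteq> j" by blast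
  show ?thesis
  proof (rule AE_lborel_lines[where e = "axis k 1"])
    show "{\<xi>. \<not> \<phi> (of_real (rest_sq j \<xi>)) \<noteq> 0} \<in> sets borel"
      by (rule closed_symbol_zeros) (intro continuous_intros)
    show "AE a in lborel. \<phi> (of_real (rest_sq j (\<xi> + a *\<^sub>R axis k 1))) \<noteq> 0" for \<xi>
      using AE_line_nonzero[of "of_real (\<xi> $ k)" "of_real (rest_sq j \<xi>)"]
      by (simp add: rest_sq_shift_other[OF k])
  qed (rule axis_inner_1)
qed

lemma AE_line_pt_nonzero:
  "AE a in lborel. \<phi> ((Complex (u + a) t)\<^sup>2 + of_real \<rho>) \<noteq> 0"
proof -
  have eq: "(Complex (u + a) t)\<^sup>2 + of_real \<rho> = (of_real a)\<^sup>2 + 2 * Complex u t * of_real a + ((Complex u t)\<^sup>2 + of_real \<rho>)" for a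
    by (simp add: complex_eq_iff power2_eq_square algebra_simps)
  show ?thesis unfolding eq by (rule AE_line_nonzero)
qed

lemma AE_symbol_nonzero:
  "AE \<xi> in lborel. \<phi> ((Complex ((\<xi> :: real^'n) $ j) t)\<^sup>2 + of_real (rest_sq j \<xi>)) \<noteq> 0"
proof (rule AE_lborel_lines[where e = "axis j 1"])
  show "{\<xi> :: real^'n. \<not> \<phi> ((Complex (\<xi> $ j) t)\<^sup>2 + of_real (rest_sq j \<xi>)) \<noteq> 0} \<in> sets borel"
    by (rule closed_symbol_zeros) (auto simp: Complex_eq intro!: continuous_intros)
  show "AE a in lborel. \<phi> ((Complex ((\<xi> + a *\<^sub>R axis j 1) $ j) t)\<^sup>2 + of_real (rest_sq j (\<xi> + a *\<^sub>R axis j 1))) \<noteq> 0" for \<xi> :: "real^'n"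
    using AE_line_pt_nonzero[of "\<xi> $ j" t "rest_sq j \<xi>"] by (simp add: rest_sq_shift_same)
qed (rule axis_inner_1)

text \<open>The quotient on the contour where the j-th coordinate has imaginary part t. On the zeros
  of the symbol, a null set, division in HOL returns 0.\<close>

definition shifted_quotient :: "(real^'n \<Rightarrow> complex) \<Rightarrow> 'n::finite \<Rightarrow> real \<Rightarrow> real^'n \<Rightarrow> complex" where
  "shifted_quotient w j t \<xi> =
     ft w (line_pt j \<xi> (Complex (\<xi> $ j) t)) / \<phi> ((Complex (\<xi> $ j) t)\<^sup>2 + of_real (rest_sq j \<xi>))"

definition quotient :: "(real^'n \<Rightarrow> complex) \<Rightarrow> real^'n \<Rightarrow> complex" where
  "quotient w \<xi> = ft w (real_pt \<xi>) / \<phi> (of_real (\<xi> \<bullet> \<xi>))"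

lemma shifted_quotient_0: "shifted_quotient w j 0 \<xi> = quotient w \<xi>"
proof -
  have "(Complex (\<xi> $ j) 0)\<^sup>2 + of_real (rest_sq j \<xi>) = of_real (\<xi> \<bullet> \<xi>)"
    by (simp add: inner_eq_rest_sq[of \<xi> j] complex_eq_iff power2_eq_square)
  then show ?thesis by (simp only: shifted_quotient_def quotient_def line_pt_real)
qed

context
  fixes w :: "real^'n \<Rightarrow> complex"
  assumes n: "CARD('n) \<ge> 2" and w: "w \<in> test_functions"
    and van: "\<And>j \<xi> z. \<phi> (z\<^sup>2 + of_real (rest_sq j \<xi>)) = 0 \<Longrightarrow> ft w (line_pt j \<xi> z) = 0"
begin

lemma line_quotient:
  assumes "\<phi> (of_real (rest_sq j \<xi>)) \<noteq> 0"
  obtains Q where "Q holomorphic_on UNIV" "\<And>z. ft w (line_pt j \<xi> z) = Q z * \<phi> (z\<^sup>2 + of_real (rest_sq j \<xi>))"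
proof (rule entire_division[of "\<lambda>z. \<phi> (z\<^sup>2 + of_real (rest_sq j \<xi>))" "\<lambda>z. ft w (line_pt j \<xi> z)"])
  show "deriv (\<lambda>z. \<phi> (z\<^sup>2 + of_real (rest_sq j \<xi>))) z \<noteq> 0" if "\<phi> (z\<^sup>2 + of_real (rest_sq j \<xi>)) = 0" for z
    by (rule line_zeros_simple[OF assms that])
qed (rule line_holomorphic ft_line_holomorphic[OF w] van that; assumption?)+

lemma shifted_quotient_measurable: "shifted_quotient w j t \<in> borel_measurable borel"
proof -
  have "continuous_on UNIV (\<lambda>\<xi>::real^'n. \<phi> ((Complex (\<xi> $ j) t)\<^sup>2 + of_real (rest_sq j \<xi>)))"
    by (rule continuous_on_compose2[OF continuous_on_symbol[of UNIV]]) (auto simp: Complex_eq intro!: continuous_intros)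
  then show ?thesis
    unfolding shifted_quotient_def[abs_def]
    by (intro borel_measurable_divide ft_line_measurable[OF w] borel_measurable_continuous_onI)
qed

lemma shifted_quotient_bound:
  "\<exists>C\<ge>0. \<exists>A\<ge>0. \<forall>j t. AE \<xi> in lborel. norm (shifted_quotient w j t \<xi>) * (1 + \<xi> \<bullet> \<xi>) ^ N \<le> C * exp (A * \<bar>t\<bar>)"
proof -
  obtain C A where CA: "C \<ge> 0" "A \<ge> 0" and bound: "\<And>j \<xi> Q z. \<phi> (of_real (rest_sq j \<xi>)) \<noteq> 0 \<Longrightarrow> Q holomorphic_on UNIV \<Longrightarrow>
    (\<And>z. ft w (line_pt j \<xi> z) = Q z * \<phi> (z\<^sup>2 + of_real (rest_sq j \<xi>))) \<Longrightarrow>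
    norm (Q z) * (1 + (Re z)\<^sup>2 + rest_sq j \<xi>) ^ N \<le> C * exp (A * \<bar>Im z\<bar>)"
    using quotient_decay[OF w, of N] by blast
  have "AE \<xi> in lborel. norm (shifted_quotient w j t \<xi>) * (1 + \<xi> \<bullet> \<xi>) ^ N \<le> C * exp (A * \<bar>t\<bar>)" for j t
    using AE_rest_nonzero[OF n, of j] AE_symbol_nonzero[of j t]
  proof eventually_elim
    case (elim \<xi>)
    obtain Q where Q: "Q holomorphic_on UNIV" "\<And>z. ft w (line_pt j \<xi> z) = Q z * \<phi> (z\<^sup>2 + of_real (rest_sq j \<xi>))"
      using line_quotient[OF elim(1)] by blast
    have "shifted_quotient w j t \<xi> = Q (Complex (\<xi> $ j) t)"
      using elim(2) by (simp add: shifted_quotient_def Q(2))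
    then show ?case
      using bound[OF elim(1) Q, of "Complex (\<xi> $ j) t"] by (simp add: inner_eq_rest_sq[of \<xi> j] add.assoc)
  qed
  then show ?thesis using CA by blast
qed

lemma rapidly_decreasing_shifted_quotient: "rapidly_decreasing (shifted_quotient w j t)"
  unfolding rapidly_decreasing_def using shifted_quotient_measurable shifted_quotient_bound by blast

lemma rapidly_decreasing_quotient: "rapidly_decreasing (quotient w)"
proof -
  obtain j :: 'n where True by blast
  have "shifted_quotient w j 0 = quotient w" by (rule ext) (rule shifted_quotient_0)
  then show ?thesis using rapidly_decreasing_shifted_quotient[of j 0] by simp
qed

text \<open>On almost every line parallel to the j-th axis the integrand is the restriction of one
  entire function, whose horizontal integrals do not depend on the height. The factor exp (- t x_j)
  is the modulus of exp (i x_j z) at height t.\<close>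

lemma contour_shift:
  "fourier_integral (quotient w) x = (LINT \<xi>|lborel. shifted_quotient w j t \<xi> * cis (x \<bullet> \<xi>) * of_real (exp (- t * x $ j)))"
proof -
  obtain C A where CA: "C \<ge> 0" "A \<ge> 0" and bound: "\<And>j \<xi> Q z. \<phi> (of_real (rest_sq j \<xi>)) \<noteq> 0 \<Longrightarrow> Q holomorphic_on UNIV \<Longrightarrow>
    (\<And>z. ft w (line_pt j \<xi> z) = Q z * \<phi> (z\<^sup>2 + of_real (rest_sq j \<xi>))) \<Longrightarrow>
    norm (Q z) * (1 + (Re z)\<^sup>2 + rest_sq j \<xi>) ^ 1 \<le> C * exp (A * \<bar>Im z\<bar>)"
    using quotient_decay[OF w, of 1] by blast
  have int: "integrable lborel (\<lambda>\<xi>. shifted_quotient w j s \<xi> * cis (x \<bullet> \<xi>) * of_real (exp (- s * x $ j)))" for s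
    by (intro integrable_mult_left integrable_mult_cis rapidly_decreasing_integrable rapidly_decreasing_shifted_quotient)
  have "(LINT \<xi>|lborel. shifted_quotient w j 0 \<xi> * cis (x \<bullet> \<xi>) * of_real (exp (- 0 * x $ j))) =
     (LINT \<xi>|lborel. shifted_quotient w j t \<xi> * cis (x \<bullet> \<xi>) * of_real (exp (- t * x $ j)))"
  proof (rule integral_lborel_eqI_lines[OF int int axis_inner_1[of j]])
    show "AE \<xi> in lborel.
      (LINT a|lborel. shifted_quotient w j 0 (\<xi> + a *\<^sub>R axis j 1) * cis (x \<bullet> (\<xi> + a *\<^sub>R axis j 1)) * of_real (exp (- 0 * x $ j))) =
      (LINT a|lborel. shifted_quotient w j t (\<xi> + a *\<^sub>R axis j 1) * cis (x \<bullet> (\<xi> + a *\<^sub>R axis j 1)) * of_real (exp (- t * x $ j)))"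
      using AE_rest_nonzero[OF n, of j]
    proof eventually_elim
      case (elim \<xi>)
      obtain Q where Q: "Q holomorphic_on UNIV" "\<And>z. ft w (line_pt j \<xi> z) = Q z * \<phi> (z\<^sup>2 + of_real (rest_sq j \<xi>))"
        using line_quotient[OF elim] by blast
      \<comment> \<open>The part of the phase that is constant along the line.\<close>
      define S where "S = x \<bullet> \<xi> - x $ j * \<xi> $ j"
      define F where "F = (\<lambda>z. Q z * (cis S * exp (\<i> * of_real (x $ j) * z)))"
      have F: "F holomorphic_on UNIV" unfolding F_def by (intro holomorphic_intros Q)
      have Fb: "norm (F (Complex u v)) \<le> C * exp (A * \<bar>t\<bar>) * exp (\<bar>x $ j\<bar> * \<bar>t\<bar>) / (1 + u\<^sup>2)" if v: "\<bar>v\<bar> \<le> \<bar>t\<bar>" for u v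
      proof -
        have "norm (Q (Complex u v)) * (1 + u\<^sup>2) \<le> norm (Q (Complex u v)) * (1 + u\<^sup>2 + rest_sq j \<xi>)"
          using rest_sq_nonneg[of j \<xi>] by (intro mult_left_mono) auto
        also have "\<dots> \<le> C * exp (A * \<bar>v\<bar>)" using bound[OF elim Q, of "Complex u v"] by simp
        also have "\<dots> \<le> C * exp (A * \<bar>t\<bar>)" using CA v by (intro mult_left_mono) (auto intro: mult_left_mono)
        finally have Qb: "norm (Q (Complex u v)) * (1 + u\<^sup>2) \<le> C * exp (A * \<bar>t\<bar>)" .
        have "\<bar>x $ j * v\<bar> \<le> \<bar>x $ j\<bar> * \<bar>t\<bar>" unfolding abs_mult using v by (intro mult_left_mono) auto
        then have "- (x $ j * v) \<le> \<bar>x $ j\<bar> * \<bar>t\<bar>" by linarith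
        then have Eb: "norm (cis S * exp (\<i> * of_real (x $ j) * Complex u v)) \<le> exp (\<bar>x $ j\<bar> * \<bar>t\<bar>)" by (simp add: norm_mult)
        have "norm (F (Complex u v)) * (1 + u\<^sup>2) = norm (Q (Complex u v)) * (1 + u\<^sup>2) * norm (cis S * exp (\<i> * of_real (x $ j) * Complex u v))"
          unfolding F_def norm_mult[of "Q _"] by (simp only: mult_ac)
        also have "\<dots> \<le> C * exp (A * \<bar>t\<bar>) * exp (\<bar>x $ j\<bar> * \<bar>t\<bar>)"
          using CA by (intro mult_mono Qb Eb) auto
        finally show ?thesis by (simp add: pos_le_divide_eq add_pos_nonneg)
      qed
      have line: "(LINT a|lborel. shifted_quotient w j s (\<xi> + a *\<^sub>R axis j 1) * cis (x \<bullet> (\<xi> + a *\<^sub>R axis j 1)) * of_real (exp (- s * x $ j)))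
         = (LINT u|lborel. F (Complex u s))" for s
      proof -
        have cont: "continuous_on UNIV (\<lambda>a. F (Complex (\<xi> $ j + a) s))"
          by (rule continuous_on_compose2[OF holomorphic_on_imp_continuous_on[OF F]]) (auto simp: Complex_eq intro!: continuous_intros)
        have [measurable]: "(\<lambda>a. F (Complex (\<xi> $ j + a) s)) \<in> borel_measurable borel"
          by (intro borel_measurable_continuous_onI cont)
        have [measurable]: "shifted_quotient w j s \<in> borel_measurable borel" by (rule shifted_quotient_measurable)
        have [measurable]: "(\<lambda>a. cis (x \<bullet> (\<xi> + a *\<^sub>R axis j 1))) \<in> borel_measurable borel"
          by (intro borel_measurable_continuous_onI continuous_intros)
        have "(LINT a|lborel. shifted_quotient w j s (\<xi> + a *\<^sub>R axis j 1) * cis (x \<bullet> (\<xi> + a *\<^sub>R axis j 1)) * of_real (exp (- s * x $ j)))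
          = (LINT a|lborel. F (Complex (\<xi> $ j + a) s))"
        proof (rule integral_cong_AE)
          show "AE a in lborel. shifted_quotient w j s (\<xi> + a *\<^sub>R axis j 1) * cis (x \<bullet> (\<xi> + a *\<^sub>R axis j 1)) * of_real (exp (- s * x $ j))
             = F (Complex (\<xi> $ j + a) s)"
            using AE_line_pt_nonzero[of "\<xi> $ j" s "rest_sq j \<xi>"]
          proof eventually_elim
            case (elim a)
            have lp: "line_pt j (\<xi> + a *\<^sub>R axis j 1) z = line_pt j \<xi> z" for z
              by (auto simp: line_pt_def vec_eq_iff axis_def)
            have comp: "(\<xi> + a *\<^sub>R axis j 1) $ j = \<xi> $ j + a" by simp
            have "shifted_quotient w j s (\<xi> + a *\<^sub>R axis j 1) = Q (Complex (\<xi> $ j + a) s)"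
              unfolding shifted_quotient_def comp lp rest_sq_shift_same Q(2) using elim by simp
            moreover have "cis (x \<bullet> (\<xi> + a *\<^sub>R axis j 1)) * of_real (exp (- s * x $ j)) = cis S * exp (\<i> * of_real (x $ j) * Complex (\<xi> $ j + a) s)"
            proof -
              have "x \<bullet> (\<xi> + a *\<^sub>R axis j 1) = S + x $ j * (\<xi> $ j + a)"
                by (simp add: S_def inner_add_right inner_axis algebra_simps)
              moreover have "exp (\<i> * of_real (x $ j) * Complex (\<xi> $ j + a) s) = cis (x $ j * (\<xi> $ j + a)) * of_real (exp (- s * x $ j))"
                by (simp add: cis_conv_exp exp_of_real[symmetric] exp_add[symmetric] Complex_eq algebra_simps)
              ultimately show ?thesis by (simp add: cis_mult[symmetric])
            qed
            ultimately show ?case unfolding F_def by (simp only: mult.assoc)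
          qed
        qed measurable
        also have "\<dots> = (LINT u|lborel. F (Complex u s))"
          using lborel_integral_real_affine[of 1 "\<lambda>u. F (Complex u s)" "\<xi> $ j"] by simp
        finally show ?thesis .
      qed
      show ?case unfolding line by (rule horizontal_line_integral_shift(2)[OF F Fb])
    qed
  qed
  then show ?thesis unfolding fourier_integral_def by (simp add: shifted_quotient_0)
qed

text \<open>The Paley-Wiener argument: at height t the integral is at most C I exp (A |t| - t x_j).
  If |x_j| > A, this tends to 0 as t goes to infinity with the sign of x_j.\<close>

lemma quotient_compact_support: "\<exists>R. \<forall>x. fourier_integral (quotient w) x \<noteq> 0 \<longrightarrow> norm x \<le> R"
proof -
  let ?d = "DIM(real^'n)"
  obtain C A where CA: "C \<ge> 0" "A \<ge> 0" and bound: "\<And>j t. AE \<xi> in lborel. norm (shifted_quotient w j t \<xi>) * (1 + \<xi> \<bullet> \<xi>) ^ ?d \<le> C * exp (A * \<bar>t\<bar>)"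
    using shifted_quotient_bound[of ?d] by blast
  define I where "I = (LINT \<xi>|lborel. 1 / (1 + (\<xi>::real^'n) \<bullet> \<xi>) ^ ?d)"
  have est: "norm (fourier_integral (quotient w) x) \<le> C * I * exp (A * \<bar>t\<bar> - t * x $ j)" for x :: "real^'n" and j :: 'n and t :: real
  proof -
    let ?H = "\<lambda>\<xi>. shifted_quotient w j t \<xi> * cis (x \<bullet> \<xi>) * of_real (exp (- t * x $ j))"
    have intH: "integrable lborel ?H"
      by (intro integrable_mult_left integrable_mult_cis rapidly_decreasing_integrable rapidly_decreasing_shifted_quotient)
    have "norm (fourier_integral (quotient w) x) \<le> (LINT \<xi>|lborel. norm (?H \<xi>))"
      unfolding contour_shift[of x j t] by (rule integral_norm_bound)
    also have "\<dots> \<le> (LINT \<xi>|lborel. (C * exp (A * \<bar>t\<bar>) * exp (- t * x $ j)) * (1 / (1 + (\<xi>::real^'n) \<bullet> \<xi>) ^ ?d))"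
    proof (rule integral_mono_AE)
      show "integrable lborel (\<lambda>\<xi>::real^'n. (C * exp (A * \<bar>t\<bar>) * exp (- t * x $ j)) * (1 / (1 + \<xi> \<bullet> \<xi>) ^ ?d))"
        by (intro integrable_mult_right integrable_inverse_power_one_plus_inner)
      show "AE \<xi> in lborel. norm (?H \<xi>) \<le> (C * exp (A * \<bar>t\<bar>) * exp (- t * x $ j)) * (1 / (1 + \<xi> \<bullet> \<xi>) ^ ?d)"
        using bound[of j t]
      proof eventually_elim
        case (elim \<xi>)
        then have "norm (shifted_quotient w j t \<xi>) \<le> C * exp (A * \<bar>t\<bar>) / (1 + \<xi> \<bullet> \<xi>) ^ ?d"
          using one_plus_inner_power_pos[of \<xi> ?d] by (simp only: pos_le_divide_eq)
        then have "norm (shifted_quotient w j t \<xi>) * exp (- t * x $ j) \<le> C * exp (A * \<bar>t\<bar>) / (1 + \<xi> \<bullet> \<xi>) ^ ?d * exp (- t * x $ j)"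
          by (rule mult_right_mono) simp
        then show ?case by (simp add: norm_mult mult_ac)
      qed
    qed (use intH in simp)
    also have "\<dots> = C * exp (A * \<bar>t\<bar>) * exp (- t * x $ j) * I" unfolding I_def by (rule integral_mult_right_zero)
    also have "\<dots> = C * I * exp (A * \<bar>t\<bar> - t * x $ j)" by (simp add: exp_diff exp_minus divide_inverse)
    finally show ?thesis .
  qed
  have zero: "fourier_integral (quotient w) x = 0" if x: "\<bar>x $ j\<bar> > A" for x :: "real^'n" and j :: 'n
  proof -
    have "norm (fourier_integral (quotient w) x) \<le> C * I * exp ((A - \<bar>x $ j\<bar>) * \<tau>)" if "\<tau> \<ge> 0" for \<tau>
    proof -
      have "A * \<bar>sgn (x $ j) * \<tau>\<bar> - sgn (x $ j) * \<tau> * x $ j = (A - \<bar>x $ j\<bar>) * \<tau>"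
        using x CA that by (auto simp: sgn_if abs_mult algebra_simps)
      then show ?thesis using est[of x "sgn (x $ j) * \<tau>" j] by simp
    qed
    then have "\<forall>\<^sub>F \<tau> in at_top. norm (fourier_integral (quotient w) x) \<le> C * I * exp ((A - \<bar>x $ j\<bar>) * \<tau>)"
      by (intro eventually_at_top_linorderI[of 0]) auto
    moreover have "((\<lambda>\<tau>. C * I * exp ((A - \<bar>x $ j\<bar>) * \<tau>)) \<longlongrightarrow> 0) at_top"
    proof -
      have "A - \<bar>x $ j\<bar> < 0" using x by simp
      then have "((\<lambda>\<tau>. exp ((A - \<bar>x $ j\<bar>) * \<tau>)) \<longlongrightarrow> 0) at_top" by real_asymp
      then show ?thesis by (rule tendsto_mult_right_zero)
    qed
    ultimately have "norm (fourier_integral (quotient w) x) \<le> 0"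
      by (intro tendsto_lowerbound) auto
    then show ?thesis by simp
  qed
  have "norm x \<le> real CARD('n) * A" if "fourier_integral (quotient w) x \<noteq> 0" for x
  proof -
    have "\<bar>x $ j\<bar> \<le> A" for j using zero[of x j] that by linarith
    then have "(\<Sum>j\<in>UNIV. \<bar>x $ j\<bar>) \<le> real CARD('n) * A" by (intro sum_bounded_above) auto
    then show ?thesis using norm_le_l1_cart[of x] by linarith
  qed
  then show ?thesis by blast
qed

lemma AE_quotient: "AE \<xi> in lborel. quotient w \<xi> * \<phi> (of_real (\<xi> \<bullet> \<xi>)) = ft w (real_pt \<xi>)"
proof -
  obtain j :: 'n where True by blast
  have eq: "(Complex (\<xi> $ j) 0)\<^sup>2 + of_real (rest_sq j \<xi>) = of_real (\<xi> \<bullet> \<xi>)" for \<xi> :: "real^'n"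
    by (simp add: inner_eq_rest_sq[of \<xi> j] complex_eq_iff power2_eq_square)
  show ?thesis
    using AE_symbol_nonzero[of j 0] unfolding eq by eventually_elim (simp add: quotient_def)
qed

end

end


subsection \<open>Spherical means of Fourier integrals\<close>

lemma norm_bessel_real_le:
  assumes "CARD('n::finite) \<ge> 2" "q \<ge> 0"
  shows "norm (bessel CARD('n) (of_real (s\<^sup>2 * q))) \<le> 1"
  using norm_bessel_square_le[OF assms(1), of "of_real (s * sqrt q)"] assms(2)
  by (simp add: power_mult_distrib flip: of_real_power)

lemma rapidly_decreasing_cmult:
  assumes "rapidly_decreasing G" shows "rapidly_decreasing (\<lambda>\<xi>. G \<xi> * c)"
  by (rule rapidly_decreasing_mult[OF assms, where K = "norm c" and M = 0]) auto

lemma bessel_measurable: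
  "n \<ge> 1 \<Longrightarrow> (\<lambda>\<xi>::'a::euclidean_space. bessel n (of_real (c * (\<xi> \<bullet> \<xi>)))) \<in> borel_measurable borel"
  by (intro borel_measurable_continuous_onI continuous_on_compose2[OF holomorphic_on_imp_continuous_on[OF bessel_holomorphic[where A = UNIV]]])
     (auto intro!: continuous_intros)

lemma bessel'_measurable:
  "n \<ge> 1 \<Longrightarrow> (\<lambda>\<xi>::'a::euclidean_space. bessel' n (of_real (c * (\<xi> \<bullet> \<xi>)))) \<in> borel_measurable borel"
  by (intro borel_measurable_continuous_onI continuous_on_compose2[OF holomorphic_on_imp_continuous_on[OF bessel'_holomorphic[where A = UNIV]]])
     (auto intro!: continuous_intros)

lemma continuous_on_fourier_integral: "rapidly_decreasing G \<Longrightarrow> continuous_on UNIV (fourier_integral G)"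
  using fourier_integral_in_C_infinity C_infinity_continuous by blast

lemma sphere_prob_cis:
  assumes n: "CARD('n::finite) \<ge> 2"
  shows "(LINT \<omega>|sphere_prob. cis (- (s * (\<omega> \<bullet> (\<xi> :: real^'n))))) = bessel CARD('n) (of_real (s\<^sup>2 * (\<xi> \<bullet> \<xi>)))"
proof -
  obtain i :: 'n where True by blast
  have "(LINT \<omega>|sphere_prob. cis (- (s * (\<omega> \<bullet> \<xi>)))) = (LINT \<omega>|sphere_prob. cis (- (s * (norm \<xi> * (\<omega> \<bullet> axis i 1)))))"
    by (rule integral_sphere_prob_inner[where g = "\<lambda>t. cis (- (s * t))"])
       (auto intro!: borel_measurable_continuous_onI continuous_intros)
  also have "\<dots> = (LINT \<omega>|(sphere_prob :: (real^'n) measure). exp (- \<i> * of_real (\<omega> $ i) * of_real (s * norm \<xi>)))"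
    by (rule Bochner_Integration.integral_cong) (auto simp: inner_axis cis_conv_exp mult_ac)
  also have "\<dots> = bessel CARD('n) ((of_real (s * norm \<xi>))\<^sup>2)" by (rule sphere_prob_exp[OF n])
  also have "(complex_of_real (s * norm \<xi>))\<^sup>2 = of_real (s\<^sup>2 * (\<xi> \<bullet> \<xi>))"
    by (simp add: power_mult_distrib power2_norm_eq_inner flip: of_real_power)
  finally show ?thesis .
qed

text \<open>By Fubini the mean acts on the characters alone, where it produces the symbol at real
  frequencies.\<close>

lemma sphere_mean_fourier_integral:
  fixes G :: "real^'n \<Rightarrow> complex"
  assumes n: "CARD('n) \<ge> 2" and G: "rapidly_decreasing G" and s: "s > 0"
  shows "convolve (sphere_delta s) (fourier_integral G) x =
    fourier_integral (\<lambda>\<xi>. G \<xi> * bessel CARD('n) (of_real (s\<^sup>2 * (\<xi> \<bullet> \<xi>)))) x"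
proof -
  interpret prob_space "sphere_prob :: (real^'n) measure" by (rule prob_space_sphere_prob)
  have cont: "continuous_on UNIV (\<lambda>y. fourier_integral G (x - y))"
    by (rule continuous_on_compose2[OF continuous_on_fourier_integral[OF G]]) (auto intro!: continuous_intros)
  have "convolve (sphere_delta s) (fourier_integral G) x = (LINT \<omega>|sphere_prob. fourier_integral G (x - s *\<^sub>R \<omega>))"
    unfolding convolve_def by (rule sphere_delta_eq[OF s borel_measurable_continuous_onI[OF cont]])
  also have "\<dots> = (LINT \<omega>|sphere_prob. 1 * (LINT \<xi>|lborel. (G \<xi> * cis (x \<bullet> \<xi>)) * cis (- (s * (\<omega> \<bullet> \<xi>)))))"
    unfolding fourier_integral_def
    by (intro Bochner_Integration.integral_cong refl) (simp add: inner_diff_left mult.assoc cis_mult)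
  also have "\<dots> = (LINT \<xi>|lborel. (G \<xi> * cis (x \<bullet> \<xi>)) * (LINT \<omega>|sphere_prob. 1 * cis (- (s * (\<omega> \<bullet> \<xi>)))))"
  proof (rule Fubini_product_bounded)
    show "(\<lambda>(\<omega>, \<xi>). cis (- (s * (\<omega> \<bullet> \<xi>)))) \<in> borel_measurable ((sphere_prob :: (real^'n) measure) \<Otimes>\<^sub>M lborel)"
      by (rule continuous_imp_borel_measurable_pair) (auto simp: case_prod_beta intro!: continuous_intros)
    show "integrable lborel (\<lambda>\<xi>. G \<xi> * cis (x \<bullet> \<xi>))"
      by (intro integrable_mult_cis rapidly_decreasing_integrable G)
  qed (auto intro: sigma_finite_measure_axioms lborel.sigma_finite_measure_axioms)
  also have "\<dots> = fourier_integral (\<lambda>\<xi>. G \<xi> * bessel CARD('n) (of_real (s\<^sup>2 * (\<xi> \<bullet> \<xi>)))) x"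
    unfolding fourier_integral_def by (simp add: sphere_prob_cis[OF n] mult_ac)
  finally show ?thesis .
qed

lemma has_vector_derivative_quadratic:
  fixes f :: "real \<Rightarrow> complex"
  assumes "\<delta> > 0" and "\<And>h. \<bar>h\<bar> < \<delta> \<Longrightarrow> norm (f (r + h) - f r - h *\<^sub>R D) \<le> K * h\<^sup>2"
  shows "(f has_vector_derivative D) (at r)"
  unfolding has_vector_derivative_def has_derivative_at
proof
  show "bounded_linear (\<lambda>h. h *\<^sub>R D)" by (rule bounded_linear_scaleR_left)
  show "((\<lambda>h. norm (f (r + h) - f r - h *\<^sub>R D) / norm h) \<longlongrightarrow> 0) (at 0)"
  proof (rule Lim_null_comparison)
    show "\<forall>\<^sub>F h in at 0. norm (norm (f (r + h) - f r - h *\<^sub>R D) / norm h) \<le> K * \<bar>h\<bar>"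
      unfolding eventually_at
    proof (rule exI[of _ \<delta>], intro conjI ballI impI)
      fix h :: real assume "h \<noteq> 0 \<and> dist h 0 < \<delta>"
      then have h: "h \<noteq> 0" "\<bar>h\<bar> < \<delta>" by auto
      have "norm (f (r + h) - f r - h *\<^sub>R D) \<le> K * \<bar>h\<bar> * \<bar>h\<bar>"
        using assms(2)[OF h(2)] by (simp add: power2_eq_square mult.assoc)
      then show "norm (norm (f (r + h) - f r - h *\<^sub>R D) / norm h) \<le> K * \<bar>h\<bar>"
        using h by (simp add: divide_le_eq)
    qed (rule assms)
    show "((\<lambda>h. K * \<bar>h\<bar>) \<longlongrightarrow> 0) (at 0)" by (auto intro!: tendsto_eq_intros)
  qed
qed

text \<open>Taylor expansion of \<Phi>(w) = bessel(w^2) between r sqrt q and (r + h) sqrt q, whose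
  squared distance is q h^2. On the real axis Cauchy's inequality bounds the second derivative by 2
  e. The result is only linear in q, hence integrable against a rapidly decreasing spectrum.\<close>

lemma bessel_radius_remainder:
  assumes n: "CARD('n::finite) \<ge> 2" and q: "q \<ge> 0"
  shows "norm (bessel CARD('n) (of_real ((r + h)\<^sup>2 * q)) - bessel CARD('n) (of_real (r\<^sup>2 * q))
     - of_real h * (2 * of_real r * of_real q * bessel' CARD('n) (of_real (r\<^sup>2 * q)))) \<le> 2 * exp 1 * q * h\<^sup>2"
proof -
  have n1: "CARD('n) \<ge> 1" using n by simp
  define \<Phi> where "\<Phi> = (\<lambda>w. bessel CARD('n) (w\<^sup>2))"
  have d: "(\<Phi> has_field_derivative bessel' CARD('n) (w\<^sup>2) * (2 * w)) (at w)" for w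
    unfolding \<Phi>_def
    by (rule DERIV_chain2[where f = "bessel CARD('n)" and g = "\<lambda>w. w\<^sup>2", OF DERIV_bessel[OF n1]])
       (auto intro!: derivative_eq_intros)
  have hol: "\<Phi> holomorphic_on A" for A
    using d by (auto simp: holomorphic_on_def field_differentiable_def intro: has_field_derivative_at_within)
  have second: "norm ((deriv ^^ 2) \<Phi> u) \<le> 2 * exp 1" if u: "u \<in> range complex_of_real" for u
  proof -
    have "norm ((deriv ^^ 2) \<Phi> u) \<le> fact 2 * exp 1 / 1 ^ 2"
    proof (rule Cauchy_inequality)
      fix z assume "norm (u - z) = 1"
      then have "\<bar>Im z\<bar> \<le> 1" using u abs_Im_le_cmod[of "u - z"] by auto
      then have "exp \<bar>Im z\<bar> \<le> exp 1" by simp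
      then show "norm (\<Phi> z) \<le> exp 1"
        unfolding \<Phi>_def using norm_bessel_square_le[OF n, of z] by linarith
    qed (auto intro!: hol holomorphic_on_imp_continuous_on)
    then show ?thesis by simp
  qed
  define u v where "u = complex_of_real (r * sqrt q)" and "v = complex_of_real ((r + h) * sqrt q)"
  have "norm ((deriv ^^ 0) \<Phi> v - (\<Sum>i\<le>1. (deriv ^^ i) \<Phi> u * (v - u) ^ i / fact i)) \<le> 2 * exp 1 * norm (v - u) ^ (Suc 1) / fact 1"
  proof (rule complex_Taylor[where S = "range complex_of_real" and f = "\<lambda>i. (deriv ^^ i) \<Phi>"])
    show "convex (range complex_of_real)"
      by (intro convex_linear_image) (auto intro: linearI simp: scaleR_conv_of_real)
    show "((deriv ^^ i) \<Phi> has_field_derivative (deriv ^^ Suc i) \<Phi> x) (at x within range complex_of_real)" for i x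
    proof -
      have "((deriv ^^ i) \<Phi> has_field_derivative deriv ((deriv ^^ i) \<Phi>) x) (at x)"
        by (rule holomorphic_derivI[where S = UNIV]) (auto intro!: holomorphic_higher_deriv hol)
      then show ?thesis by (simp add: has_field_derivative_at_within)
    qed
    show "norm ((deriv ^^ Suc 1) \<Phi> x) \<le> 2 * exp 1" if "x \<in> range complex_of_real" for x
      using second[OF that] by (simp add: numeral_2_eq_2)
  qed (simp_all only: u_def v_def rangeI)
  then have taylor: "norm (\<Phi> v - \<Phi> u - deriv \<Phi> u * (v - u)) \<le> 2 * exp 1 * (norm (v - u))\<^sup>2"
    by (simp add: numeral_2_eq_2 diff_diff_eq)
  have deriv: "deriv \<Phi> u = bessel' CARD('n) (u\<^sup>2) * (2 * u)" by (rule DERIV_imp_deriv[OF d])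
  have uv2: "u\<^sup>2 = of_real (r\<^sup>2 * q)" "v\<^sup>2 = of_real ((r + h)\<^sup>2 * q)"
    unfolding u_def v_def of_real_power[symmetric] power_mult_distrib using q by simp_all
  have vu: "v - u = of_real (h * sqrt q)" by (simp add: u_def v_def algebra_simps)
  have norm_vu: "(norm (v - u))\<^sup>2 = q * h\<^sup>2"
    unfolding vu norm_of_real using q by (simp add: power_mult_distrib)
  have prod: "2 * u * (v - u) = of_real h * (2 * of_real r * of_real q)"
  proof -
    have "complex_of_real (sqrt q) * of_real (sqrt q) = of_real q" using q by (simp flip: of_real_mult)
    then show ?thesis unfolding vu unfolding u_def by (simp add: mult_ac)
  qed
  have dprod: "deriv \<Phi> u * (v - u) = of_real h * (2 * of_real r * of_real q * bessel' CARD('n) (of_real (r\<^sup>2 * q)))"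
  proof -
    have "deriv \<Phi> u * (v - u) = (2 * u * (v - u)) * bessel' CARD('n) (of_real (r\<^sup>2 * q))"
      unfolding deriv uv2 by (simp only: mult_ac)
    then show ?thesis unfolding prod by (simp only: mult.assoc)
  qed
  have "norm (\<Phi> v - \<Phi> u - of_real h * (2 * of_real r * of_real q * bessel' CARD('n) (of_real (r\<^sup>2 * q)))) \<le> 2 * exp 1 * (q * h\<^sup>2)"
    using taylor unfolding dprod norm_vu .
  then show ?thesis unfolding \<Phi>_def uv2 by (simp only: mult.assoc)
qed

lemma rapidly_decreasing_bessel:
  fixes G :: "real^'n \<Rightarrow> complex"
  assumes n: "CARD('n) \<ge> 2" and G: "rapidly_decreasing G"
  shows "rapidly_decreasing (\<lambda>\<xi>. G \<xi> * bessel CARD('n) (of_real (s\<^sup>2 * (\<xi> \<bullet> \<xi>))))"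
  by (rule rapidly_decreasing_mult[OF G, where K = 1 and M = 0])
     (use n norm_bessel_real_le[OF n] in \<open>auto intro!: bessel_measurable simp del: of_real_mult\<close>)

text \<open>The linear bound for the derivative symbol comes from the remainder estimate with h = 1:
  the derivative is a difference of two values of norm at most 1, up to 2 e q.\<close>

lemma rapidly_decreasing_bessel_deriv:
  fixes G :: "real^'n \<Rightarrow> complex"
  assumes n: "CARD('n) \<ge> 2" and G: "rapidly_decreasing G"
  shows "rapidly_decreasing (\<lambda>\<xi>. G \<xi> * (2 * of_real r * of_real (\<xi> \<bullet> \<xi>) * bessel' CARD('n) (of_real (r\<^sup>2 * (\<xi> \<bullet> \<xi>)))))"
proof (rule rapidly_decreasing_mult[OF G, where K = "2 + 2 * exp 1" and M = 1])
  have [measurable]: "(\<lambda>\<xi>::real^'n. bessel' CARD('n) (of_real (r\<^sup>2 * (\<xi> \<bullet> \<xi>)))) \<in> borel_measurable borel"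
    using n by (intro bessel'_measurable) simp
  show "(\<lambda>\<xi>::real^'n. 2 * of_real r * of_real (\<xi> \<bullet> \<xi>) * bessel' CARD('n) (of_real (r\<^sup>2 * (\<xi> \<bullet> \<xi>)))) \<in> borel_measurable borel"
    by measurable
  fix \<xi> :: "real^'n"
  define q where "q = \<xi> \<bullet> \<xi>"
  have q: "q \<ge> 0" by (simp add: q_def)
  let ?D = "2 * of_real r * of_real q * bessel' CARD('n) (of_real (r\<^sup>2 * q))"
  let ?b = "\<lambda>s. bessel CARD('n) (of_real (s\<^sup>2 * q))"
  have "norm (?b (r + 1) - ?b r - ?D) \<le> 2 * exp 1 * q"
    using bessel_radius_remainder[OF n q, of r 1] by simp
  moreover have "norm ?D \<le> norm (?b (r + 1) - ?b r - ?D) + norm (?b (r + 1)) + norm (?b r)"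
  proof -
    have "norm ?D = norm (?b (r + 1) - ?b r - (?b (r + 1) - ?b r - ?D))" by simp
    also have "\<dots> \<le> norm (?b (r + 1) - ?b r) + norm (?b (r + 1) - ?b r - ?D)" by (rule norm_triangle_ineq4)
    also have "norm (?b (r + 1) - ?b r) \<le> norm (?b (r + 1)) + norm (?b r)" by (rule norm_triangle_ineq4)
    finally show ?thesis by linarith
  qed
  ultimately have "norm ?D \<le> 2 * exp 1 * q + 1 + 1"
    using norm_bessel_real_le[OF n q, of r] norm_bessel_real_le[OF n q, of "r + 1"] by linarith
  also have "\<dots> \<le> (2 + 2 * exp 1) * (1 + q) ^ 1" using q by (simp add: algebra_simps)
  finally show "norm (2 * of_real r * of_real (\<xi> \<bullet> \<xi>) * bessel' CARD('n) (of_real (r\<^sup>2 * (\<xi> \<bullet> \<xi>)))) \<le> (2 + 2 * exp 1) * (1 + \<xi> \<bullet> \<xi>) ^ 1"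
    unfolding q_def .
qed

lemma fourier_integral_remainder:
  fixes F0 F1 D :: "real^'n \<Rightarrow> complex" and K :: "real^'n \<Rightarrow> real"
  assumes F: "integrable lborel F1" "integrable lborel F0" "integrable lborel D" and K: "integrable lborel K"
    and le: "\<And>\<xi>. norm (F1 \<xi> - F0 \<xi> - of_real h * D \<xi>) \<le> K \<xi> * h\<^sup>2"
  shows "norm (fourier_integral F1 x - fourier_integral F0 x - h *\<^sub>R fourier_integral D x) \<le> (LINT \<xi>|lborel. K \<xi>) * h\<^sup>2"
proof -
  note int = integrable_mult_cis[OF F(1), of x] integrable_mult_cis[OF F(2), of x] integrable_mult_cis[OF F(3), of x]
  let ?R = "\<lambda>\<xi>. F1 \<xi> * cis (x \<bullet> \<xi>) - F0 \<xi> * cis (x \<bullet> \<xi>) - h *\<^sub>R (D \<xi> * cis (x \<bullet> \<xi>))"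
  have R: "integrable lborel ?R" using int by simp
  have "norm (?R \<xi>) \<le> K \<xi> * h\<^sup>2" for \<xi>
  proof -
    have "?R \<xi> = cis (x \<bullet> \<xi>) * (F1 \<xi> - F0 \<xi> - of_real h * D \<xi>)"
      by (simp add: scaleR_conv_of_real algebra_simps)
    then show ?thesis using le[of \<xi>] by (simp only: norm_mult norm_cis mult_1)
  qed
  then have "(LINT \<xi>|lborel. norm (?R \<xi>)) \<le> (LINT \<xi>|lborel. K \<xi> * h\<^sup>2)"
    by (intro integral_mono integrable_norm R integrable_mult_left K) auto
  moreover have "norm (LINT \<xi>|lborel. ?R \<xi>) \<le> (LINT \<xi>|lborel. norm (?R \<xi>))" by (rule integral_norm_bound)
  moreover have "(LINT \<xi>|lborel. ?R \<xi>) = fourier_integral F1 x - fourier_integral F0 x - h *\<^sub>R fourier_integral D x"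
    unfolding fourier_integral_def using int by simp
  ultimately show ?thesis by simp
qed

text \<open>The bound is independent of x. This will permit differentiating in r under an integral
  over x.\<close>

lemma fourier_integral_radius_remainder:
  fixes G :: "real^'n \<Rightarrow> complex"
  assumes n: "CARD('n) \<ge> 2" and G: "rapidly_decreasing G"
  shows "norm (fourier_integral (\<lambda>\<xi>. G \<xi> * bessel CARD('n) (of_real ((r + h)\<^sup>2 * (\<xi> \<bullet> \<xi>)))) x
      - fourier_integral (\<lambda>\<xi>. G \<xi> * bessel CARD('n) (of_real (r\<^sup>2 * (\<xi> \<bullet> \<xi>)))) x
      - h *\<^sub>R fourier_integral (\<lambda>\<xi>. G \<xi> * (2 * of_real r * of_real (\<xi> \<bullet> \<xi>) * bessel' CARD('n) (of_real (r\<^sup>2 * (\<xi> \<bullet> \<xi>))))) x)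
    \<le> (LINT \<xi>|lborel. norm (G \<xi> * of_real (\<xi> \<bullet> \<xi>)) * (2 * exp 1)) * h\<^sup>2"
proof (rule fourier_integral_remainder)
  have int: "integrable lborel (\<lambda>\<xi>. G \<xi> * bessel CARD('n) (of_real (s\<^sup>2 * (\<xi> \<bullet> \<xi>))))" for s
    by (rule rapidly_decreasing_integrable[OF rapidly_decreasing_bessel[OF n G]])
  show "integrable lborel (\<lambda>\<xi>. G \<xi> * bessel CARD('n) (of_real ((r + h)\<^sup>2 * (\<xi> \<bullet> \<xi>))))"
    "integrable lborel (\<lambda>\<xi>. G \<xi> * bessel CARD('n) (of_real (r\<^sup>2 * (\<xi> \<bullet> \<xi>))))"
    by (rule int)+
  show "integrable lborel (\<lambda>\<xi>. G \<xi> * (2 * of_real r * of_real (\<xi> \<bullet> \<xi>) * bessel' CARD('n) (of_real (r\<^sup>2 * (\<xi> \<bullet> \<xi>)))))"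
    by (rule rapidly_decreasing_integrable[OF rapidly_decreasing_bessel_deriv[OF n G]])
  have "rapidly_decreasing (\<lambda>\<xi>. G \<xi> * of_real (\<xi> \<bullet> \<xi>))"
    by (rule rapidly_decreasing_mult[OF G, where K = 1 and M = 1]) auto
  then show "integrable lborel (\<lambda>\<xi>. norm (G \<xi> * of_real (\<xi> \<bullet> \<xi>)) * (2 * exp 1))"
    by (intro integrable_mult_left integrable_norm rapidly_decreasing_integrable)
  fix \<xi> :: "real^'n"
  define b1 b0 d where "b1 = bessel CARD('n) (of_real ((r + h)\<^sup>2 * (\<xi> \<bullet> \<xi>)))"
    and "b0 = bessel CARD('n) (of_real (r\<^sup>2 * (\<xi> \<bullet> \<xi>)))"
    and "d = 2 * of_real r * of_real (\<xi> \<bullet> \<xi>) * bessel' CARD('n) (of_real (r\<^sup>2 * (\<xi> \<bullet> \<xi>)))"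
  have "norm (b1 - b0 - of_real h * d) \<le> 2 * exp 1 * (\<xi> \<bullet> \<xi>) * h\<^sup>2"
    unfolding b1_def b0_def d_def by (rule bessel_radius_remainder[OF n inner_ge_zero])
  then have "norm (G \<xi>) * norm (b1 - b0 - of_real h * d) \<le> norm (G \<xi>) * (2 * exp 1 * (\<xi> \<bullet> \<xi>) * h\<^sup>2)"
    by (rule mult_left_mono) simp
  moreover have "G \<xi> * b1 - G \<xi> * b0 - of_real h * (G \<xi> * d) = G \<xi> * (b1 - b0 - of_real h * d)"
    by (simp add: algebra_simps)
  ultimately have "norm (G \<xi> * b1 - G \<xi> * b0 - of_real h * (G \<xi> * d)) \<le> norm (G \<xi> * of_real (\<xi> \<bullet> \<xi>)) * (2 * exp 1) * h\<^sup>2"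
    by (simp add: norm_mult mult_ac)
  then show "norm (G \<xi> * bessel CARD('n) (of_real ((r + h)\<^sup>2 * (\<xi> \<bullet> \<xi>))) - G \<xi> * bessel CARD('n) (of_real (r\<^sup>2 * (\<xi> \<bullet> \<xi>)))
      - of_real h * (G \<xi> * (2 * of_real r * of_real (\<xi> \<bullet> \<xi>) * bessel' CARD('n) (of_real (r\<^sup>2 * (\<xi> \<bullet> \<xi>))))))
    \<le> norm (G \<xi> * of_real (\<xi> \<bullet> \<xi>)) * (2 * exp 1) * h\<^sup>2"
    unfolding b1_def b0_def d_def .
qed

text \<open>The symbol of \<open>\<partial>\<^bsup>l\<^esup>\<delta>/\<partial>r\<^bsup>l\<^esup>\<close> as a function of \<open>\<zeta> \<cdot> \<zeta>\<close>.\<close>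

definition sphere_symbol :: "nat \<Rightarrow> nat \<Rightarrow> real \<Rightarrow> complex \<Rightarrow> complex" where
  "sphere_symbol l n r s =
    (if l = 0 then bessel n (of_real (r\<^sup>2) * s) else 2 * of_real r * s * bessel' n (of_real (r\<^sup>2) * s))"

lemma sphere_delta_deriv_0: "sphere_delta_deriv 0 r = sphere_delta r"
  by (rule ext) (simp add: sphere_delta_deriv_def)

lemma sphere_delta_deriv_1: "sphere_delta_deriv 1 r u = vector_derivative (\<lambda>s. sphere_delta s u) (at r)"
  by (simp add: sphere_delta_deriv_def)

text \<open>The formulas for spherical means hold for positive radii only, which suffices for a
  derivative at r > 0.\<close>

lemma has_vector_derivative_positive:
  assumes "r > 0" "(f has_vector_derivative D) (at (r::real))" "\<And>s. s > 0 \<Longrightarrow> f s = g s"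
  shows "(g has_vector_derivative D) (at r)"
  by (rule has_vector_derivative_transform_within_open[OF assms(2), of "{0<..}"]) (use assms in auto)

context
  fixes l :: nat and r :: real
  assumes l: "l \<in> {0, 1}" and n: "CARD('n::finite) \<ge> 2" and r: "r > 0"
begin

lemma mean_has_vector_derivative:
  fixes G :: "real^'n \<Rightarrow> complex"
  assumes G: "rapidly_decreasing G"
  shows "((\<lambda>s. convolve (sphere_delta s) (fourier_integral G) x) has_vector_derivative
    fourier_integral (\<lambda>\<xi>. G \<xi> * sphere_symbol 1 CARD('n) r (of_real (\<xi> \<bullet> \<xi>))) x) (at r)"
proof -
  have "((\<lambda>s. fourier_integral (\<lambda>\<xi>. G \<xi> * bessel CARD('n) (of_real (s\<^sup>2 * (\<xi> \<bullet> \<xi>)))) x) has_vector_derivative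
     fourier_integral (\<lambda>\<xi>. G \<xi> * (2 * of_real r * of_real (\<xi> \<bullet> \<xi>) * bessel' CARD('n) (of_real (r\<^sup>2 * (\<xi> \<bullet> \<xi>))))) x) (at r)"
    by (rule has_vector_derivative_quadratic[OF zero_less_one fourier_integral_radius_remainder[OF n G]])
  then have "((\<lambda>s. convolve (sphere_delta s) (fourier_integral G) x) has_vector_derivative
     fourier_integral (\<lambda>\<xi>. G \<xi> * (2 * of_real r * of_real (\<xi> \<bullet> \<xi>) * bessel' CARD('n) (of_real (r\<^sup>2 * (\<xi> \<bullet> \<xi>))))) x) (at r)"
    by (rule has_vector_derivative_positive[OF r]) (simp add: sphere_mean_fourier_integral[OF n G])
  then show ?thesis by (simp only: sphere_symbol_def of_real_mult one_neq_zero if_False)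
qed

lemma convolve_fourier_integral:
  fixes G :: "real^'n \<Rightarrow> complex"
  assumes G: "rapidly_decreasing G"
  shows "convolve (sphere_delta_deriv l r) (fourier_integral G) =
    fourier_integral (\<lambda>\<xi>. G \<xi> * sphere_symbol l CARD('n) r (of_real (\<xi> \<bullet> \<xi>)))"
proof (cases "l = 0")
  case True
  then show ?thesis
    using sphere_mean_fourier_integral[OF n G r] by (auto simp: sphere_delta_deriv_0 sphere_symbol_def)
next
  case False
  then have l1: "l = 1" using l by auto
  show ?thesis
    using vector_derivative_at[OF mean_has_vector_derivative[OF G]]
    unfolding l1 by (intro ext) (simp only: convolve_def sphere_delta_deriv_1)
qed

lemma rapidly_decreasing_symbol:
  fixes G :: "real^'n \<Rightarrow> complex"
  assumes G: "rapidly_decreasing G"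
  shows "rapidly_decreasing (\<lambda>\<xi>. G \<xi> * sphere_symbol l CARD('n) r (of_real (\<xi> \<bullet> \<xi>)))"
  using rapidly_decreasing_bessel[OF n G, of r] rapidly_decreasing_bessel_deriv[OF n G, of r] l
  by (auto simp: sphere_symbol_def)

end


subsection \<open>The Fourier transforms of the spherical distributions\<close>

lemma entire_eq_on_reals:
  assumes "f holomorphic_on UNIV" "g holomorphic_on UNIV" and eq: "\<And>a::real. f (of_real a) = g (of_real a)"
  shows "f z = g z"
proof -
  have lim: "(0::complex) islimpt range complex_of_real"
    unfolding islimpt_approachable
  proof (intro allI impI)
    fix e :: real assume "e > 0"
    then show "\<exists>x'\<in>range complex_of_real. x' \<noteq> 0 \<and> dist x' 0 < e"
      by (intro bexI[OF _ rangeI[of complex_of_real "e / 2"]]) (simp add: norm_divide)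
  qed
  have "(\<lambda>z. f z - g z) z = 0"
    by (rule analytic_continuation[where S = UNIV and U = "range complex_of_real" and \<xi> = 0])
       (use assms lim in \<open>auto intro!: holomorphic_intros\<close>)
  then show ?thesis by simp
qed

definition fourier_kernel :: "complex^'n \<Rightarrow> real^'n \<Rightarrow> complex" where
  "fourier_kernel \<zeta> x = exp (- \<i> * (\<Sum>j\<in>UNIV. complex_of_real (x $ j) * \<zeta> $ j))"

lemma fourier_fourier_kernel: "fourier T \<zeta> = T (fourier_kernel \<zeta>)"
  by (simp add: fourier_def fourier_kernel_def[abs_def])

lemma ft_fourier_kernel: "ft w \<zeta> = (LINT x|lborel. w x * fourier_kernel \<zeta> x)"
  by (simp add: ft_eq fourier_kernel_def)

lemma continuous_on_fourier_kernel: "continuous_on A (fourier_kernel \<zeta>)"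
  unfolding fourier_kernel_def[abs_def] by (intro continuous_intros)

lemma fourier_kernel_measurable [measurable]: "fourier_kernel \<zeta> \<in> borel_measurable borel"
  by (intro borel_measurable_continuous_onI continuous_on_fourier_kernel)

lemma fourier_kernel_add: "fourier_kernel \<zeta> (x + y) = fourier_kernel \<zeta> x * fourier_kernel \<zeta> y"
proof -
  have "(\<Sum>j\<in>UNIV. complex_of_real ((x + y) $ j) * \<zeta> $ j) =
      (\<Sum>j\<in>UNIV. complex_of_real (x $ j) * \<zeta> $ j) + (\<Sum>j\<in>UNIV. complex_of_real (y $ j) * \<zeta> $ j)"
    by (simp add: distrib_right sum.distrib)
  moreover have "exp (- \<i> * (a + b)) = exp (- \<i> * a) * exp (- \<i> * b)" for a b :: complex
    by (simp add: exp_add[symmetric] algebra_simps)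
  ultimately show ?thesis unfolding fourier_kernel_def by (simp only:)
qed

lemma fourier_kernel_real_pt: "fourier_kernel (real_pt \<xi>) x = cis (- (x \<bullet> \<xi>))"
  by (simp add: fourier_kernel_def real_pt_def cis_conv_exp inner_vec_def)

lemma fourier_kernel_line_pt:
  "fourier_kernel (line_pt j \<xi> z) x = exp (- \<i> * of_real (\<Sum>k\<in>UNIV - {j}. x $ k * \<xi> $ k)) * exp (- \<i> * of_real (x $ j) * z)"
proof -
  have "exp (- \<i> * (a + b * z)) = exp (- \<i> * a) * exp (- \<i> * b * z)" for a b :: complex
    by (simp add: exp_add[symmetric] algebra_simps)
  then show ?thesis unfolding fourier_kernel_def sum_line_pt .
qed

lemma fourier_sphere_delta:
  assumes "s > 0"
  shows "fourier (sphere_delta s) \<zeta> = (LINT \<omega>|sphere_prob. fourier_kernel \<zeta> (s *\<^sub>R \<omega>))"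
  unfolding fourier_fourier_kernel by (rule sphere_delta_eq[OF assms fourier_kernel_measurable])

text \<open>Both sides are entire in z and agree for real z by \<open>sphere_prob_cis\<close>; the
  identity theorem does the rest.\<close>

lemma fourier_sphere_delta_line:
  fixes \<xi> :: "real^'n"
  assumes n: "CARD('n) \<ge> 2" and s: "s > 0"
  shows "fourier (sphere_delta s) (line_pt j \<xi> z) = bessel CARD('n) (of_real (s\<^sup>2) * (z\<^sup>2 + of_real (rest_sq j \<xi>)))"
proof (rule entire_eq_on_reals[where f = "\<lambda>z. fourier (sphere_delta s) (line_pt j \<xi> z)"
      and g = "\<lambda>z. bessel CARD('n) (of_real (s\<^sup>2) * (z\<^sup>2 + of_real (rest_sq j \<xi>)))"])
  let ?f = "\<lambda>\<omega>::real^'n. exp (- \<i> * of_real (\<Sum>k\<in>UNIV - {j}. (s *\<^sub>R \<omega>) $ k * \<xi> $ k))"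
  have "(\<lambda>z. LINT \<omega>|sphere_prob. ?f \<omega> * exp (- \<i> * of_real ((s *\<^sub>R \<omega>) $ j) * z)) holomorphic_on UNIV"
  proof (rule holomorphic_exp_integral(1))
    show "integrable sphere_prob ?f"
      by (rule integrable_sphere_prob_bounded[where B = 1]) (auto intro!: borel_measurable_continuous_onI continuous_intros)
    have "(\<lambda>\<omega>::real^'n. (s *\<^sub>R \<omega>) $ j) \<in> borel_measurable borel"
      by (intro borel_measurable_continuous_onI continuous_intros)
    then show "(\<lambda>\<omega>::real^'n. (s *\<^sub>R \<omega>) $ j) \<in> borel_measurable sphere_prob"
      by (simp only: measurable_cong_sets[OF sets_sphere_prob refl])
    show "AE \<omega> in sphere_prob. ?f \<omega> \<noteq> 0 \<longrightarrow> \<bar>(s *\<^sub>R \<omega>) $ j\<bar> \<le> s"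
      using AE_sphere_prob
    proof eventually_elim
      case (elim \<omega>)
      then show ?case using component_le_norm_cart[of "s *\<^sub>R \<omega>" j] s by simp
    qed
    show "0 \<le> s" using s by simp
  qed
  then show "(\<lambda>z. fourier (sphere_delta s) (line_pt j \<xi> z)) holomorphic_on UNIV"
    unfolding fourier_sphere_delta[OF s] fourier_kernel_line_pt .
  have "bessel CARD('n) \<circ> (\<lambda>z. of_real (s\<^sup>2) * (z\<^sup>2 + of_real (rest_sq j \<xi>))) holomorphic_on UNIV"
    using n by (intro holomorphic_on_compose bessel_holomorphic holomorphic_intros) auto
  then show "(\<lambda>z. bessel CARD('n) (of_real (s\<^sup>2) * (z\<^sup>2 + of_real (rest_sq j \<xi>)))) holomorphic_on UNIV"
    by (simp add: o_def)
  fix a :: real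
  define \<xi>' :: "real^'n" where "\<xi>' = (\<chi> k. if k = j then a else \<xi> $ k)"
  have pt: "line_pt j \<xi> (of_real a) = real_pt \<xi>'"
    by (auto simp: line_pt_def real_pt_def \<xi>'_def vec_eq_iff)
  have "rest_sq j \<xi>' = rest_sq j \<xi>" unfolding rest_sq_def \<xi>'_def by (rule sum.cong) auto
  then have inner: "\<xi>' \<bullet> \<xi>' = a\<^sup>2 + rest_sq j \<xi>" using inner_eq_rest_sq[of \<xi>' j] by (simp add: \<xi>'_def)
  show "fourier (sphere_delta s) (line_pt j \<xi> (of_real a)) = bessel CARD('n) (of_real (s\<^sup>2) * ((of_real a)\<^sup>2 + of_real (rest_sq j \<xi>)))"
    unfolding fourier_sphere_delta[OF s] pt fourier_kernel_real_pt inner_scaleR_left sphere_prob_cis[OF n] inner by simp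
qed

lemma fourier_sphere_delta_deriv_line:
  fixes \<xi> :: "real^'n"
  assumes l: "l \<in> {0, 1}" and n: "CARD('n) \<ge> 2" and r: "r > 0"
  shows "fourier (sphere_delta_deriv l r) (line_pt j \<xi> z) = sphere_symbol l CARD('n) r (z\<^sup>2 + of_real (rest_sq j \<xi>))"
proof (cases "l = 0")
  case True
  then show ?thesis by (simp add: sphere_delta_deriv_0 sphere_symbol_def fourier_sphere_delta_line[OF n r])
next
  case False
  then have l1: "l = 1" using l by auto
  define c where "c = z\<^sup>2 + of_real (rest_sq j \<xi>)"
  have "((\<lambda>s. of_real (s\<^sup>2) * c) has_vector_derivative 2 * of_real r * c) (at r)"
  proof -
    have "((\<lambda>s. s\<^sup>2) has_vector_derivative 2 * r) (at r)"
      unfolding has_real_derivative_iff_has_vector_derivative[symmetric] by (auto intro!: derivative_eq_intros)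
    then have "((\<lambda>s. complex_of_real (s\<^sup>2)) has_vector_derivative of_real (2 * r)) (at r)"
      by (rule bounded_linear.has_vector_derivative[OF bounded_linear_of_real])
    then have "((\<lambda>s. complex_of_real (s\<^sup>2) * c) has_vector_derivative of_real (2 * r) * c) (at r)"
      by (rule has_vector_derivative_mult_left)
    then show ?thesis by simp
  qed
  moreover have "(bessel CARD('n) has_field_derivative bessel' CARD('n) (of_real (r\<^sup>2) * c)) (at (of_real (r\<^sup>2) * c))"
    using n by (intro DERIV_bessel) simp
  ultimately have "(bessel CARD('n) \<circ> (\<lambda>s. of_real (s\<^sup>2) * c) has_vector_derivative 2 * of_real r * c * bessel' CARD('n) (of_real (r\<^sup>2) * c)) (at r)"
    by (rule field_vector_diff_chain_at)
  then have "((\<lambda>s. fourier (sphere_delta s) (line_pt j \<xi> z)) has_vector_derivative 2 * of_real r * c * bessel' CARD('n) (of_real (r\<^sup>2) * c)) (at r)"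
    by (rule has_vector_derivative_positive[OF r]) (simp add: fourier_sphere_delta_line[OF n] c_def)
  then have "vector_derivative (\<lambda>s. fourier (sphere_delta s) (line_pt j \<xi> z)) (at r) = 2 * of_real r * c * bessel' CARD('n) (of_real (r\<^sup>2) * c)"
    by (rule vector_derivative_at)
  then show ?thesis
    unfolding l1 fourier_fourier_kernel sphere_delta_deriv_1 by (simp add: sphere_symbol_def c_def)
qed

lemma sphere_symbol_slowly_decreasing:
  assumes l: "l \<in> {0, 1}" and n: "CARD('n::finite) \<ge> 2" and r: "r > 0"
  obtains \<phi>' where "slowly_decreasing_symbol (sphere_symbol l CARD('n) r) \<phi>'"
proof (cases "l = 0")
  case True
  then have "sphere_symbol l CARD('n) r = (\<lambda>s. bessel CARD('n) (of_real (r\<^sup>2) * s))"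
    by (intro ext) (simp add: sphere_symbol_def)
  then show ?thesis using that bessel_symbol[OF n r] by (simp del: of_real_power)
next
  case False
  then have "sphere_symbol l CARD('n) r = (\<lambda>s. 2 * of_real r * s * bessel' CARD('n) (of_real (r\<^sup>2) * s))"
    by (intro ext) (simp add: sphere_symbol_def)
  then show ?thesis using that bessel_deriv_symbol[OF n r] by (simp del: of_real_power)
qed

section \<open>Test functions: inversion and the convolution theorem\<close>

lemma rapidly_decreasing_ft:
  fixes w :: "real^'n \<Rightarrow> complex"
  assumes w: "w \<in> test_functions"
  shows "rapidly_decreasing (\<lambda>\<xi>. ft w (real_pt \<xi>))"
  unfolding rapidly_decreasing_def
proof (intro conjI allI)
  show "(\<lambda>\<xi>. ft w (real_pt \<xi>)) \<in> borel_measurable borel" by (rule ft_real_measurable[OF w])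
  fix N
  obtain C R where CR: "\<And>j \<xi> z. norm (ft w (line_pt j \<xi> z)) * (1 + (Re z)\<^sup>2 + rest_sq j \<xi>) ^ N \<le> C * exp (R * \<bar>Im z\<bar>)"
    using ft_line_decay[OF w, of N] by blast
  obtain j :: 'n where True by blast
  have "norm (ft w (real_pt \<xi>)) * (1 + \<xi> \<bullet> \<xi>) ^ N \<le> C" for \<xi>
    using CR[of j \<xi> "Complex (\<xi> $ j) 0"] by (simp add: line_pt_real inner_eq_rest_sq[of \<xi> j] add.assoc)
  then show "\<exists>C. AE \<xi> in lborel. norm (ft w (real_pt \<xi>)) * (1 + \<xi> \<bullet> \<xi>) ^ N \<le> C" by blast
qed

lemma test_function_inversion:
  fixes w :: "real^'n \<Rightarrow> complex"
  assumes w: "w \<in> test_functions"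
  shows "fourier_integral (\<lambda>\<xi>. ft w (real_pt \<xi>) * of_real (1 / (2 * pi) ^ CARD('n))) = w"
proof
  fix x
  obtain B where B: "\<And>x. norm (w x) \<le> B" by (rule test_functions_bounded[OF w]) blast
  have "fourier_integral (\<lambda>\<xi>. ft w (real_pt \<xi>)) x = of_real ((2 * pi) ^ CARD('n)) * w x"
    by (rule fourier_inversion[OF test_functions_continuous[OF w] test_functions_integrable[OF w] B _
          rapidly_decreasing_integrable[OF rapidly_decreasing_ft[OF w]]])
       (simp add: ft_fourier_kernel fourier_kernel_real_pt)
  moreover have "fourier_integral (\<lambda>\<xi>. ft w (real_pt \<xi>) * of_real (1 / (2 * pi) ^ CARD('n))) x =
     of_real (1 / (2 * pi) ^ CARD('n)) * fourier_integral (\<lambda>\<xi>. ft w (real_pt \<xi>)) x"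
    unfolding fourier_integral_def by (subst integral_mult_right_zero[symmetric]) (simp only: mult_ac)
  ultimately show "fourier_integral (\<lambda>\<xi>. ft w (real_pt \<xi>) * of_real (1 / (2 * pi) ^ CARD('n))) x = w x"
    by simp
qed

lemma pred_mem_cball [measurable]:
  assumes [measurable]: "f \<in> borel_measurable M"
  shows "Measurable.pred M (\<lambda>x. f x \<in> cball (a::'a::euclidean_space) r)"
  unfolding mem_cball dist_norm by measurable

lemma integrable_test_mult_fourier_kernel:
  fixes u :: "real^'n \<Rightarrow> complex"
  assumes u: "u \<in> test_functions"
  shows "integrable lborel (\<lambda>x. u x * fourier_kernel \<zeta> x)"
proof -
  obtain R where R: "\<And>x. u x \<noteq> 0 \<Longrightarrow> norm x \<le> R" by (rule test_functions_support[OF u]) blast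
  obtain W where W: "W > 0" "\<And>x. norm (u x) \<le> W" by (rule test_functions_bounded[OF u]) blast
  have "bounded (fourier_kernel \<zeta> ` cball 0 R)" by (intro compact_imp_bounded compact_continuous_image continuous_on_fourier_kernel) auto
  then obtain B where B: "B > 0" "\<And>x. norm x \<le> R \<Longrightarrow> norm (fourier_kernel \<zeta> x) \<le> B" by (auto simp: bounded_pos)
  have [measurable]: "u \<in> borel_measurable borel" by (rule test_functions_measurable[OF u])
  show ?thesis
  proof (rule integrable_bounded_support[where B = "W * B" and R = R])
    show "norm (u x * fourier_kernel \<zeta> x) \<le> W * B" for x
      using W B R[of x] by (cases "u x = 0") (auto simp: norm_mult intro!: mult_mono mult_nonneg_nonneg)
  qed (use R in auto)
qed

lemma sphere_mean_support:
  fixes u :: "real^'n \<Rightarrow> complex"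
  assumes s: "s > 0" and u: "u \<in> test_functions" and R: "\<And>x. u x \<noteq> 0 \<Longrightarrow> norm x \<le> R"
    and x: "norm x > R + s"
  shows "convolve (sphere_delta s) u x = 0"
proof -
  have [measurable]: "u \<in> borel_measurable borel" by (rule test_functions_measurable[OF u])
  have "convolve (sphere_delta s) u x = (LINT \<omega>|sphere_prob. u (x - s *\<^sub>R \<omega>))"
    unfolding convolve_def by (rule sphere_delta_eq[OF s]) measurable
  also have "\<dots> = (LINT \<omega>|(sphere_prob :: (real^'n) measure). 0)"
  proof (rule integral_cong_AE)
    show "AE \<omega> in sphere_prob. u (x - s *\<^sub>R \<omega>) = 0"
      using AE_sphere_prob
    proof eventually_elim
      case (elim \<omega>)
      have "norm x \<le> norm (x - s *\<^sub>R \<omega>) + norm (s *\<^sub>R \<omega>)" using norm_triangle_ineq[of "x - s *\<^sub>R \<omega>" "s *\<^sub>R \<omega>"] by simp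
      then show ?case using R[of "x - s *\<^sub>R \<omega>"] x s elim by force
    qed
  qed measurable
  finally show ?thesis by simp
qed

text \<open>The convolution theorem at complex \<zeta>: after Fubini, translating by a point of the
  sphere splits off one value of the exponential kernel.\<close>

lemma ft_sphere_mean:
  fixes u :: "real^'n \<Rightarrow> complex"
  assumes s: "s > 0" and u: "u \<in> test_functions"
  shows "ft (convolve (sphere_delta s) u) \<zeta> = fourier (sphere_delta s) \<zeta> * ft u \<zeta>"
proof -
  interpret prob_space "sphere_prob :: (real^'n) measure" by (rule prob_space_sphere_prob)
  have um [measurable]: "u \<in> borel_measurable borel" by (rule test_functions_measurable[OF u])
  obtain R where R: "R > 0" "\<And>x. u x \<noteq> 0 \<Longrightarrow> norm x \<le> R" by (rule test_functions_support[OF u]) blast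
  obtain W where W: "W > 0" "\<And>x. norm (u x) \<le> W" by (rule test_functions_bounded[OF u]) blast
  \<comment> \<open>For complex \<zeta> the kernel is not integrable over the whole space, so it is
    cut off to a ball that contains the supports of all translates involved.\<close>
  define f where "f = (\<lambda>x. fourier_kernel \<zeta> x * indicator (cball 0 (R + s)) x)"
  have "bounded (fourier_kernel \<zeta> ` cball 0 (R + s))" by (intro compact_imp_bounded compact_continuous_image continuous_on_fourier_kernel) auto
  then obtain B where B: "B > 0" "\<And>x. norm x \<le> R + s \<Longrightarrow> norm (fourier_kernel \<zeta> x) \<le> B" by (auto simp: bounded_pos)
  have f: "integrable lborel f"
  proof (rule integrable_bounded_support[where B = B and R = "R + s"])
    show "f \<in> borel_measurable borel" unfolding f_def by measurable
    show "norm (f x) \<le> B" for x using B by (auto simp: f_def indicator_def)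
    show "norm x \<le> R + s" if "f x \<noteq> 0" for x using that by (auto simp: f_def indicator_def split: if_splits)
  qed
  \<comment> \<open>Division by the bound W makes the coupling kernel at most 1, as
    \<open>Fubini_product_bounded\<close> demands.\<close>
  define k where "k = (\<lambda>x \<omega>. u (x - s *\<^sub>R \<omega>) / of_real W)"
  have kW: "of_real W * k x \<omega> = u (x - s *\<^sub>R \<omega>)" for x \<omega> using W by (simp add: k_def)
  have mean: "convolve (sphere_delta s) u x = (LINT \<omega>|sphere_prob. u (x - s *\<^sub>R \<omega>))" for x
    unfolding convolve_def by (rule sphere_delta_eq[OF s]) measurable
  have "ft (convolve (sphere_delta s) u) \<zeta> = (LINT x|lborel. f x * (LINT \<omega>|sphere_prob. of_real W * k x \<omega>))"
    unfolding ft_fourier_kernel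
  proof (rule Bochner_Integration.integral_cong[OF refl])
    fix x
    show "convolve (sphere_delta s) u x * fourier_kernel \<zeta> x = f x * (LINT \<omega>|sphere_prob. of_real W * k x \<omega>)"
      unfolding kW mean[symmetric] using sphere_mean_support[OF s u R(2), of x]
      by (cases "norm x \<le> R + s") (auto simp: f_def)
  qed
  also have "\<dots> = (LINT \<omega>|sphere_prob. of_real W * (LINT x|lborel. f x * k x \<omega>))"
  proof (rule Fubini_product_bounded[OF lborel.sigma_finite_measure_axioms sigma_finite_measure_axioms f])
    have "continuous_on UNIV (\<lambda>p. u (fst p - s *\<^sub>R snd p))"
      by (rule continuous_on_compose2[OF test_functions_continuous[OF u]]) (auto intro!: continuous_intros)
    then show "(\<lambda>(x, \<omega>). k x \<omega>) \<in> borel_measurable (lborel \<Otimes>\<^sub>M sphere_prob)"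
      unfolding k_def using W
      by (intro continuous_imp_borel_measurable_pair) (auto simp: case_prod_beta intro!: continuous_intros)
    show "norm (k x \<omega>) \<le> 1" for x \<omega> using W by (simp add: k_def norm_divide divide_le_eq)
  qed simp
  also have "\<dots> = (LINT \<omega>|sphere_prob. fourier_kernel \<zeta> (s *\<^sub>R \<omega>) * ft u \<zeta>)"
  proof (rule integral_cong_AE)
    show "AE \<omega> in sphere_prob. of_real W * (LINT x|lborel. f x * k x \<omega>) = fourier_kernel \<zeta> (s *\<^sub>R \<omega>) * ft u \<zeta>"
      using AE_sphere_prob
    proof eventually_elim
      case (elim \<omega>)
      have "of_real W * (LINT x|lborel. f x * k x \<omega>) = (LINT x|lborel. f x * u (x - s *\<^sub>R \<omega>))"
        unfolding kW[symmetric] by (subst integral_mult_right_zero[symmetric]) (simp only: mult_ac)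
      also have "\<dots> = (LINT x|lborel. u (x - s *\<^sub>R \<omega>) * fourier_kernel \<zeta> x)"
      proof (rule Bochner_Integration.integral_cong[OF refl])
        fix x
        have "norm x \<le> norm (x - s *\<^sub>R \<omega>) + norm (s *\<^sub>R \<omega>)" using norm_triangle_ineq[of "x - s *\<^sub>R \<omega>" "s *\<^sub>R \<omega>"] by simp
        then have "norm x \<le> R + s" if "u (x - s *\<^sub>R \<omega>) \<noteq> 0" using R(2)[OF that] s elim by simp
        then show "f x * u (x - s *\<^sub>R \<omega>) = u (x - s *\<^sub>R \<omega>) * fourier_kernel \<zeta> x" by (auto simp: f_def indicator_def)
      qed
      also have "\<dots> = (LINT x|lborel. u x * fourier_kernel \<zeta> (x + s *\<^sub>R \<omega>))"
      proof -
        have "(\<lambda>x. u (x - s *\<^sub>R \<omega>) * fourier_kernel \<zeta> x) \<in> borel_measurable borel" by measurable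
        from integral_lborel_translate[OF this, of "s *\<^sub>R \<omega>"] show ?thesis by simp
      qed
      also have "\<dots> = (LINT x|lborel. fourier_kernel \<zeta> (s *\<^sub>R \<omega>) * (u x * fourier_kernel \<zeta> x))" unfolding fourier_kernel_add by (simp only: mult_ac)
      also have "\<dots> = fourier_kernel \<zeta> (s *\<^sub>R \<omega>) * ft u \<zeta>" unfolding ft_fourier_kernel by (rule integral_mult_right_zero)
      finally show ?case .
    qed
    have "(\<lambda>\<omega>. LINT x|lborel. f x * k x \<omega>) \<in> borel_measurable sphere_prob"
    proof (rule lborel.borel_measurable_lebesgue_integral)
      have [measurable]: "f \<in> borel_measurable borel" unfolding f_def by measurable
      have "continuous_on UNIV (\<lambda>p. u (snd p - s *\<^sub>R fst p))"
        by (rule continuous_on_compose2[OF test_functions_continuous[OF u]]) (auto intro!: continuous_intros)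
      then have [measurable]: "(\<lambda>p. k (snd p) (fst p)) \<in> borel_measurable (sphere_prob \<Otimes>\<^sub>M lborel)"
        unfolding k_def using W
        by (intro continuous_imp_borel_measurable_pair) (auto intro!: continuous_intros)
      show "(\<lambda>(\<omega>, x). f x * k x \<omega>) \<in> borel_measurable (sphere_prob \<Otimes>\<^sub>M lborel)"
        unfolding case_prod_beta by measurable
    qed
    then show "(\<lambda>\<omega>. of_real W * (LINT x|lborel. f x * k x \<omega>)) \<in> borel_measurable sphere_prob"
      by (intro borel_measurable_times) auto
  qed measurable
  also have "\<dots> = fourier (sphere_delta s) \<zeta> * ft u \<zeta>"
    unfolding fourier_sphere_delta[OF s] by (rule integral_mult_left_zero)
  finally show ?thesis .
qed

context
  fixes l :: nat and r :: real and u :: "real^'n \<Rightarrow> complex"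
  assumes l: "l \<in> {0, 1}" and n: "CARD('n) \<ge> 2" and r: "r > 0" and u: "u \<in> test_functions"
begin

lemma spectrum_rapid: "rapidly_decreasing (\<lambda>\<xi>. ft u (real_pt \<xi>) * of_real (1 / (2 * pi) ^ CARD('n)))"
  by (intro rapidly_decreasing_cmult rapidly_decreasing_ft u)

text \<open>The radial derivative sees a neighbourhood of r. All radii below 2 r give mean 0 at x,
  hence the margin 2 r instead of r.\<close>

lemma convolve_support:
  assumes R: "\<And>x. u x \<noteq> 0 \<Longrightarrow> norm x \<le> R" and x: "norm x > R + 2 * r"
  shows "convolve (sphere_delta_deriv l r) u x = 0"
proof (cases "l = 0")
  case True
  then show ?thesis
    using sphere_mean_support[OF r u R, of x] x r by (simp add: sphere_delta_deriv_0)
next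
  case False
  then have l1: "l = 1" using l by auto
  have "((\<lambda>s. convolve (sphere_delta s) u x) has_vector_derivative 0) (at r)"
  proof (rule has_vector_derivative_transform_within_open[where f = "\<lambda>_. 0" and S = "{0<..<2 * r}"])
    show "0 = convolve (sphere_delta s) u x" if "s \<in> {0<..<2 * r}" for s
      using sphere_mean_support[OF _ u R, of s x] that x by simp
  qed (use r in auto)
  then show ?thesis
    unfolding l1 convolve_def sphere_delta_deriv_1 by (rule vector_derivative_at)
qed

text \<open>Smoothness is read off from the spectrum: by inversion u is a Fourier integral, and the
  convolution only multiplies its rapidly decreasing spectrum by the symbol.\<close>

lemma convolve_test_function: "convolve (sphere_delta_deriv l r) u \<in> test_functions"
proof -
  obtain R where R: "\<And>x. u x \<noteq> 0 \<Longrightarrow> norm x \<le> R" by (rule test_functions_support[OF u]) blast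
  have "convolve (sphere_delta_deriv l r) u \<in> C_infinity"
    using convolve_fourier_integral[OF l n r spectrum_rapid]
      fourier_integral_in_C_infinity[OF rapidly_decreasing_symbol[OF l n r spectrum_rapid]]
    unfolding test_function_inversion[OF u] by simp
  then show ?thesis
    by (rule test_functionsI[where R = "R + 2 * r"]) (use convolve_support[OF R] in \<open>fastforce simp: not_le[symmetric]\<close>)
qed

end

text \<open>The remainder in the radius is quadratic in h uniformly in x and vanishes outside a
  fixed ball, so integrating it against the kernel of a complex \<zeta> leaves a quadratic
  remainder.\<close>

lemma ft_mean_has_vector_derivative:
  fixes u :: "real^'n \<Rightarrow> complex"
  assumes n: "CARD('n) \<ge> 2" and r: "r > 0" and u: "u \<in> test_functions"
  shows "((\<lambda>s. ft (convolve (sphere_delta s) u) \<zeta>) has_vector_derivative ft (convolve (sphere_delta_deriv 1 r) u) \<zeta>) (at r)"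
proof -
  define G where "G = (\<lambda>\<xi>. ft u (real_pt \<xi>) * of_real (1 / (2 * pi) ^ CARD('n)))"
  have G: "rapidly_decreasing G" unfolding G_def by (rule spectrum_rapid[OF _ n r u, of 1]) simp
  have uG: "u = fourier_integral G" unfolding G_def by (rule test_function_inversion[OF u, symmetric])
  define K where "K = (LINT \<xi>|lborel. norm (G \<xi> * of_real (\<xi> \<bullet> \<xi>)) * (2 * exp 1))"
  have K: "K \<ge> 0" unfolding K_def by (intro Bochner_Integration.integral_nonneg) simp
  let ?A = "\<lambda>s. convolve (sphere_delta s) u" and ?A' = "convolve (sphere_delta_deriv 1 r) u"
  obtain R where R: "\<And>x. u x \<noteq> 0 \<Longrightarrow> norm x \<le> R" by (rule test_functions_support[OF u]) blast
  have "bounded (fourier_kernel \<zeta> ` cball 0 (R + 2 * r))" by (intro compact_imp_bounded compact_continuous_image continuous_on_fourier_kernel) auto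
  then obtain B where B: "B > 0" "\<And>x. norm x \<le> R + 2 * r \<Longrightarrow> norm (fourier_kernel \<zeta> x) \<le> B" by (auto simp: bounded_pos)
  have test: "?A s \<in> test_functions" if "s > 0" for s
    using convolve_test_function[OF _ n that u, of 0] by (simp add: sphere_delta_deriv_0)
  have test': "?A' \<in> test_functions" by (rule convolve_test_function[OF _ n r u]) simp
  let ?V = "LINT x|lborel. B * indicator (cball (0::real^'n) (R + 2 * r)) x"
  have intV: "integrable lborel (\<lambda>x. B * indicator (cball (0::real^'n) (R + 2 * r)) x)"
    using emeasure_lborel_cball_finite[of "0::real^'n" "R + 2 * r"]
    by (intro integrable_mult_right integrable_real_indicator) auto
  show ?thesis
  proof (rule has_vector_derivative_quadratic[OF r])
    \<comment> \<open>This keeps r + h positive and below 2 r, so all functions involved vanish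
      outside the ball of radius R + 2 r.\<close>
    fix h :: real assume h: "\<bar>h\<bar> < r"
    then have rh: "r + h > 0" "r + h < 2 * r" by auto
    define D where "D = (\<lambda>x. ?A (r + h) x - ?A r x - h *\<^sub>R ?A' x)"
    have D: "norm (D x) \<le> K * h\<^sup>2" for x
    proof -
      have 1: "?A s x = fourier_integral (\<lambda>\<xi>. G \<xi> * bessel CARD('n) (of_real (s\<^sup>2 * (\<xi> \<bullet> \<xi>)))) x" if "s > 0" for s
        unfolding uG by (rule sphere_mean_fourier_integral[OF n G that])
      have 2: "?A' x = fourier_integral (\<lambda>\<xi>. G \<xi> * (2 * of_real r * of_real (\<xi> \<bullet> \<xi>) * bessel' CARD('n) (of_real (r\<^sup>2 * (\<xi> \<bullet> \<xi>))))) x"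
      proof -
        have "?A' = fourier_integral (\<lambda>\<xi>. G \<xi> * sphere_symbol 1 CARD('n) r (of_real (\<xi> \<bullet> \<xi>)))"
          unfolding uG by (rule convolve_fourier_integral[OF _ n r G]) simp
        then show ?thesis by (simp only: sphere_symbol_def of_real_mult one_neq_zero if_False)
      qed
      show ?thesis
        unfolding D_def 1[OF rh(1)] 1[OF r] 2 K_def by (rule fourier_integral_radius_remainder[OF n G])
    qed
    have D0: "D x = 0" if "norm x > R + 2 * r" for x
      using sphere_mean_support[OF rh(1) u R, of x] sphere_mean_support[OF r u R, of x]
        convolve_support[OF _ n r u R, of 1 x] that rh r by (simp add: D_def)
    have le: "norm (D x * fourier_kernel \<zeta> x) \<le> K * h\<^sup>2 * (B * indicator (cball 0 (R + 2 * r)) x)" for x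
    proof (cases "norm x \<le> R + 2 * r")
      case True
      then have "norm (D x) * norm (fourier_kernel \<zeta> x) \<le> K * h\<^sup>2 * B" using D B K by (intro mult_mono) auto
      then show ?thesis using True by (simp add: norm_mult)
    qed (use D0[of x] in simp)
    note int = integrable_test_mult_fourier_kernel[OF test[OF rh(1)], of \<zeta>] integrable_test_mult_fourier_kernel[OF test[OF r], of \<zeta>]
      integrable_scaleR_right[OF integrable_test_mult_fourier_kernel[OF test', of \<zeta>], of h]
    have intD: "integrable lborel (\<lambda>x. D x * fourier_kernel \<zeta> x)"
      using Bochner_Integration.integrable_diff[OF Bochner_Integration.integrable_diff[OF int(1,2)] int(3)]
      by (simp add: D_def left_diff_distrib)
    have "ft (?A (r + h)) \<zeta> - ft (?A r) \<zeta> - h *\<^sub>R ft ?A' \<zeta> =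
        (LINT x|lborel. ?A (r + h) x * fourier_kernel \<zeta> x - ?A r x * fourier_kernel \<zeta> x - h *\<^sub>R (?A' x * fourier_kernel \<zeta> x))"
      unfolding ft_fourier_kernel
      by (subst Bochner_Integration.integral_diff[OF Bochner_Integration.integrable_diff[OF int(1,2)] int(3)],
          subst Bochner_Integration.integral_diff[OF int(1,2)], subst integral_scaleR_right, rule refl)
    also have "\<dots> = (LINT x|lborel. D x * fourier_kernel \<zeta> x)" by (simp add: D_def left_diff_distrib)
    finally have "norm (ft (?A (r + h)) \<zeta> - ft (?A r) \<zeta> - h *\<^sub>R ft ?A' \<zeta>) \<le> (LINT x|lborel. norm (D x * fourier_kernel \<zeta> x))"
      by (simp only: integral_norm_bound)
    also have "\<dots> \<le> (LINT x|lborel. K * h\<^sup>2 * (B * indicator (cball (0::real^'n) (R + 2 * r)) x))"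
      by (rule integral_mono[OF integrable_norm[OF intD] integrable_mult_right[OF intV] le])
    also have "\<dots> = K * h\<^sup>2 * ?V" by (rule integral_mult_right_zero)
    finally show "norm (ft (?A (r + h)) \<zeta> - ft (?A r) \<zeta> - h *\<^sub>R ft ?A' \<zeta>) \<le> K * ?V * h\<^sup>2"
      by (simp only: mult_ac)
  qed
qed

text \<open>For l = 1 the product formula for spheres is differentiated at r. At a general \<zeta>
  the radial derivative of the factor \<open>fourier (sphere_delta s) \<zeta>\<close> is not
  computed but inherited from the product, divided by \<open>ft u \<zeta>\<close>; if that number is
  0, the product vanishes for all positive s.\<close>

lemma ft_convolve_eq_0:
  fixes u :: "real^'n \<Rightarrow> complex"
  assumes l: "l \<in> {0, 1}" and n: "CARD('n) \<ge> 2" and r: "r > 0" and u: "u \<in> test_functions"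
    and zero: "fourier (sphere_delta_deriv l r) \<zeta> = 0"
  shows "ft (convolve (sphere_delta_deriv l r) u) \<zeta> = 0"
proof (cases "l = 0")
  case True
  then show ?thesis using zero by (simp add: sphere_delta_deriv_0 ft_sphere_mean[OF r u])
next
  case False
  then have l1: "l = 1" using l by auto
  let ?J = "\<lambda>s. ft (convolve (sphere_delta s) u) \<zeta>" and ?J' = "ft (convolve (sphere_delta_deriv 1 r) u) \<zeta>"
  have J: "(?J has_vector_derivative ?J') (at r)" by (rule ft_mean_has_vector_derivative[OF n r u])
  show ?thesis
  proof (cases "ft u \<zeta> = 0")
    case True
    have "((\<lambda>_. 0) has_vector_derivative ?J') (at r)"
      by (rule has_vector_derivative_positive[OF r J]) (simp add: ft_sphere_mean[OF _ u] True)
    then show ?thesis unfolding l1 using vector_derivative_unique_at has_vector_derivative_const by blast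
  next
    case False
    have "((\<lambda>s. ?J s * inverse (ft u \<zeta>)) has_vector_derivative ?J' * inverse (ft u \<zeta>)) (at r)"
      by (rule has_vector_derivative_mult_left[OF J])
    then have "((\<lambda>s. fourier (sphere_delta s) \<zeta>) has_vector_derivative ?J' * inverse (ft u \<zeta>)) (at r)"
      by (rule has_vector_derivative_positive[OF r]) (use False in \<open>simp add: ft_sphere_mean[OF _ u]\<close>)
    then have "vector_derivative (\<lambda>s. fourier (sphere_delta s) \<zeta>) (at r) = ?J' * inverse (ft u \<zeta>)"
      by (rule vector_derivative_at)
    then have "?J' * inverse (ft u \<zeta>) = 0"
      using zero unfolding l1 fourier_fourier_kernel sphere_delta_deriv_1 by simp
    then show ?thesis unfolding l1 using False by simp
  qed
qed

section \<open>The characterisation of the range\<close>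

theorem theorem25:
  fixes l :: nat and r :: real
  assumes "l \<in> {0, 1}" and "2 \<le> CARD('n::finite)" and "0 < r"
  shows "convolve (sphere_delta_deriv l r) ` (test_functions :: (real^'n \<Rightarrow> complex) set) =
    {w \<in> test_functions. \<forall>\<zeta>. fourier (sphere_delta_deriv l r) \<zeta> = 0 \<longrightarrow> fourier (distr_of_fun w) \<zeta> = 0}"
proof (intro equalityI subsetI)
  fix v :: "real^'n \<Rightarrow> complex" assume "v \<in> convolve (sphere_delta_deriv l r) ` test_functions"
  then obtain u where u: "u \<in> test_functions" "v = convolve (sphere_delta_deriv l r) u" by blast
  then show "v \<in> {w \<in> test_functions. \<forall>\<zeta>. fourier (sphere_delta_deriv l r) \<zeta> = 0 \<longrightarrow> fourier (distr_of_fun w) \<zeta> = 0}"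
    using convolve_test_function[OF assms u(1)] ft_convolve_eq_0[OF assms u(1)] by simp
next
  fix w :: "real^'n \<Rightarrow> complex"
  assume "w \<in> {w \<in> test_functions. \<forall>\<zeta>. fourier (sphere_delta_deriv l r) \<zeta> = 0 \<longrightarrow> fourier (distr_of_fun w) \<zeta> = 0}"
  then have w: "w \<in> test_functions" and zero: "\<And>\<zeta>. fourier (sphere_delta_deriv l r) \<zeta> = 0 \<Longrightarrow> ft w \<zeta> = 0" by auto
  let ?\<phi> = "sphere_symbol l CARD('n) r"
  obtain \<phi>' where "slowly_decreasing_symbol ?\<phi> \<phi>'" by (rule sphere_symbol_slowly_decreasing[OF assms])
  then interpret slowly_decreasing_symbol ?\<phi> \<phi>' .
  \<comment> \<open>At these points the symbol is the Fourier transform of the distribution, so its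
    zeros fall under the condition on w.\<close>
  have van: "ft w (line_pt j \<xi> z) = 0" if "?\<phi> (z\<^sup>2 + of_real (rest_sq j \<xi>)) = 0" for j and \<xi> :: "real^'n" and z
    by (rule zero) (simp only: fourier_sphere_delta_deriv_line[OF assms] that)
  define c where "c = complex_of_real (1 / (2 * pi) ^ CARD('n))"
  define u where "u = fourier_integral (\<lambda>\<xi>. quotient w \<xi> * c)"
  have q: "rapidly_decreasing (quotient w)" by (rule rapidly_decreasing_quotient[OF assms(2) w]) (rule van)
  have aeq: "AE \<xi> in lborel. quotient w \<xi> * ?\<phi> (of_real (\<xi> \<bullet> \<xi>)) = ft w (real_pt \<xi>)"
    by (rule AE_quotient[OF assms(2) w]) (rule van)
  have qc: "rapidly_decreasing (\<lambda>\<xi>. quotient w \<xi> * c)" by (rule rapidly_decreasing_cmult[OF q])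
  have u_eq: "u x = c * fourier_integral (quotient w) x" for x
    unfolding u_def fourier_integral_def by (subst integral_mult_right_zero[symmetric]) (simp only: mult_ac)
  have "\<exists>R. \<forall>x. fourier_integral (quotient w) x \<noteq> 0 \<longrightarrow> norm x \<le> R"
    by (rule quotient_compact_support[OF assms(2) w]) (rule van)
  then obtain R where R: "\<And>x. fourier_integral (quotient w) x \<noteq> 0 \<Longrightarrow> norm x \<le> R" by blast
  have "u \<in> C_infinity" unfolding u_def by (rule fourier_integral_in_C_infinity[OF qc])
  then have u: "u \<in> test_functions"
    by (rule test_functionsI[where R = R]) (use R u_eq in auto)
  have "convolve (sphere_delta_deriv l r) u = fourier_integral (\<lambda>\<xi>. quotient w \<xi> * c * ?\<phi> (of_real (\<xi> \<bullet> \<xi>)))"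
    unfolding u_def by (rule convolve_fourier_integral[OF assms qc])
  also have "\<dots> = fourier_integral (\<lambda>\<xi>. ft w (real_pt \<xi>) * c)"
  proof
    fix x :: "real^'n"
    have [measurable]: "(\<lambda>\<xi>. quotient w \<xi> * c * ?\<phi> (of_real (\<xi> \<bullet> \<xi>))) \<in> borel_measurable borel"
      by (rule rapidly_decreasing_measurable[OF rapidly_decreasing_symbol[OF assms qc]])
    have [measurable]: "(\<lambda>\<xi>. ft w (real_pt \<xi>)) \<in> borel_measurable (borel :: (real^'n) measure)" by (rule ft_real_measurable[OF w])
    have [measurable]: "(\<lambda>\<xi>. cis (x \<bullet> \<xi>)) \<in> borel_measurable borel"
      by (intro borel_measurable_continuous_onI continuous_intros)
    show "fourier_integral (\<lambda>\<xi>. quotient w \<xi> * c * ?\<phi> (of_real (\<xi> \<bullet> \<xi>))) x = fourier_integral (\<lambda>\<xi>. ft w (real_pt \<xi>) * c) x"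
      unfolding fourier_integral_def
    proof (rule integral_cong_AE)
      show "AE \<xi> in lborel. quotient w \<xi> * c * ?\<phi> (of_real (\<xi> \<bullet> \<xi>)) * cis (x \<bullet> \<xi>) = ft w (real_pt \<xi>) * c * cis (x \<bullet> \<xi>)"
        using aeq
      proof eventually_elim
        case (elim \<xi>)
        have "quotient w \<xi> * c * ?\<phi> (of_real (\<xi> \<bullet> \<xi>)) = quotient w \<xi> * ?\<phi> (of_real (\<xi> \<bullet> \<xi>)) * c" by (simp only: mult_ac)
        then show ?case unfolding elim by simp
      qed
    qed measurable
  qed
  also have "\<dots> = w" unfolding c_def by (rule test_function_inversion[OF w])
  finally show "w \<in> convolve (sphere_delta_deriv l r) ` test_functions" using u by (metis imageI)
qed

end
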